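(* Let $\mathfrak{g}$ be a finite dimensional simple Lie algebra over $\mathbb{C}$, let $\lambda,\mu\in P^+$ be dominant integral weights, and let $k\geq 1$ be an integer (the level). If $k$ is large enough so that $\Pi^\lambda+\mu+\rho\subseteq \mathcal{F}_k'$, then for all $\nu\in P_k^+$ we have $$N_{\lambda,\mu}^{(k)\ \nu} = Mult_{\lambda,\mu}^{\nu}.$$
   Context: Let $\mathfrak{g}$ be a finite dimensional simple complex Lie algebra of rank $\ell$ with Cartan subalgebra $H$, simple roots $\alpha_1,\dots,\alpha_\ell$, highest root $\theta$, and Weyl group $W$ acting on $H^*$. The symmetric bilinear form $(\cdot,\cdot)$ on $H^*$ is the $W$-invariant one normalized by $(\theta,\theta)=2$. For a root $\alpha$ put $\langle\lambda,\alpha\rangle = 2(\lambda,\alpha)/(\alpha,\alpha)$; in particular $\langle\lambda,w\theta\rangle=(\lambda,w\theta)$ for $w\in W$. The fundamental weights $\lambda_1,\dots,\lambda_\ell$ satisfy $\langle\lambda_i,\alpha_j\rangle=\delta_{ij}$; $P$ is their $\mathbb{Z}$-span (the weight lattice), $P^+$ is the set of their nonnegative integer combinations (dominant integral weights), and $\rho=\sum_{i=1}^{\ell}\lambda_i$. The dual Coxeter number is $\check h = 1+\langle\rho,\theta\rangle$. For an integer $k\geq 1$, $$P_k^+=\{\lambda\in P^+ \mid \langle\lambda,\theta\rangle\leq k\},$$ $$\mathcal{F}_k'=\{\mu\in P \mid -(k+\check h)<\langle\mu,w\theta\rangle<k+\check h \text{ for all } w\in W\}.$$ For $\lambda\in P^+$,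 $V^\lambda$ is the finite dimensional irreducible $\mathfrak{g}$-module with highest weight $\lambda$, $V^\lambda_\beta$ is its $\beta$ weight space, $\Pi^\lambda=\{\beta\in H^*\mid V^\lambda_\beta\neq 0\}$ is its set of weights, and $Mult_\lambda(\beta)=\dim V^\lambda_\beta$. The set $\Pi^\lambda+\mu+\rho$ is $\{\beta+\mu+\rho\mid\beta\in\Pi^\lambda\}$. For $\lambda,\mu,\nu\in P^+$, $Mult_{\lambda,\mu}^\nu$ is the multiplicity of $V^\nu$ in the decomposition of $V^\lambda\otimes V^\mu$ into irreducible $\mathfrak{g}$-modules; set $Mult_{\lambda,\mu}^{\gamma}=0$ if $\gamma\in P\setminus P^+$. The affine Weyl group $\widehat W$ (at level $k$) is the group of transformations of $H^*$ generated by $W$ and the affine reflection $r_0(\beta)=r_\theta(\beta)+(k+\check h)\theta$, where $r_\theta(\beta)=\beta-\langle\beta,\theta\rangle\theta$. It is a Coxeter group with generators $r_0$ and the simple reflections $r_1,\dots,r_\ell$ of $W$, and $\epsilon(w)=(-1)^{\mathrm{length}(w)}$. The level $k$ fusion coefficients of the untwisted affine Kac-Moody algebra of $\mathfrak{g}$ are given, for $\lambda,\mu,\nu\in P_k^+$, by the Kac-Walton formula $$N_{\lambda,\mu}^{(k)\ \nu}=\sum_{w\in\widehat W}\epsilon(w)\,Mult_{\lambda,\mu}^{w(\nu+\rho)-\rho},$$ or equivalently $N_{\lambda,\mu}^{(k)\ \nu}=\sum_{w\in\widehat W}\epsilon(w)\,Mult_\lambda(w(\nu+\rho)-\mu-\rho)$;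 take this as the definition. (Under the hypothesis of the claim, $\lambda$ and $\mu$ automatically lie in $P_k^+$.) *)

theory Defs
  imports
    Complex_Main
    "HOL-Library.Function_Algebras"
    "HOL-Algebra.Bij"
    "HOL-Algebra.Generated_Groups"
begin

section \<open>Simple Lie algebras and their root data\<close>

locale complex_lie_algebra = vector_space scale
  for scale :: "complex \<Rightarrow> 'g::ab_group_add \<Rightarrow> 'g" +
  fixes br :: "'g \<Rightarrow> 'g \<Rightarrow> 'g"
  assumes br_add_left: "br (x + y) z = br x z + br y z"
    and br_add_right: "br x (y + z) = br x y + br x z"
    and br_scale_left: "br (scale c x) y = scale c (br x y)"
    and br_scale_right: "br x (scale c y) = scale c (br x y)"
    and br_alternating: "br x x = 0"
    and jacobi: "br x (br y z) + br y (br z x) + br z (br x y) = 0"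

definition lie_ideal :: "(complex \<Rightarrow> 'g::ab_group_add \<Rightarrow> 'g) \<Rightarrow> ('g \<Rightarrow> 'g \<Rightarrow> 'g) \<Rightarrow> 'g set \<Rightarrow> bool" where
  "lie_ideal scale br I \<longleftrightarrow> module.subspace scale I \<and> (\<forall>x. \<forall>y\<in>I. br x y \<in> I)"

locale fin_dim_simple_lie_algebra = complex_lie_algebra +
  assumes fin_dim: "\<exists>B. finite B \<and> module.span scale B = UNIV"
    and non_abelian: "\<exists>x y. br x y \<noteq> 0"
    and simple: "lie_ideal scale br I \<Longrightarrow> I = {0} \<or> I = UNIV"

text \<open>
  A Lie algebra on the type \<^typ>\<open>'g\<close> together with a subalgebra \<open>H\<close>, the number and the list (with
  indices \<open>1..\<ell>\<close>) of the simple roots, the highest root and the form on \<open>H\<^sup>*\<close>. The conditions on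
  these components are collected in \<open>simple_lie_data\<close> below.
\<close>

record 'g lie_data =
  lscale :: "complex \<Rightarrow> 'g \<Rightarrow> 'g"
  bracket :: "'g \<Rightarrow> 'g \<Rightarrow> 'g"
  cartan :: "'g set"
  lie_rank :: nat
  simple_root :: "nat \<Rightarrow> 'g \<Rightarrow> complex"
  highest_root :: "'g \<Rightarrow> complex"
  root_form :: "('g \<Rightarrow> complex) \<Rightarrow> ('g \<Rightarrow> complex) \<Rightarrow> complex"

text \<open>
  A linear functional on a subspace \<open>C\<close> is represented by the function that extends it by \<open>0\<close>
  outside \<open>C\<close>; thus pointwise addition and equality of functions are those of the dual space.
\<close>

definition dual_space :: "(complex \<Rightarrow> 'v::ab_group_add \<Rightarrow> 'v) \<Rightarrow> 'v set \<Rightarrow> ('v \<Rightarrow> complex) set" where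
  "dual_space scale C =
    {f. (\<forall>x\<in>C. \<forall>y\<in>C. f (x + y) = f x + f y) \<and> (\<forall>c. \<forall>x\<in>C. f (scale c x) = c * f x) \<and>
        (\<forall>x. x \<notin> C \<longrightarrow> f x = 0)}"

definition fscale :: "complex \<Rightarrow> ('v \<Rightarrow> complex) \<Rightarrow> 'v \<Rightarrow> complex" where
  "fscale c f = (\<lambda>x. c * f x)"

abbreviation Hdual :: "'g::ab_group_add lie_data \<Rightarrow> ('g \<Rightarrow> complex) set" where
  "Hdual L \<equiv> dual_space (lscale L) (cartan L)"

text \<open>
  For a semisimple complex Lie algebra, a Cartan subalgebra is a commutative subalgebra that is its
  own centralizer and acts diagonalizably in the adjoint representation.
\<close>

definition cartan_subalgebra :: "'g::ab_group_add lie_data \<Rightarrow> bool" where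
  "cartan_subalgebra L \<longleftrightarrow>
    module.subspace (lscale L) (cartan L) \<and>
    (\<forall>h\<in>cartan L. \<forall>h'\<in>cartan L. bracket L h h' = 0) \<and>
    (\<forall>x. (\<forall>h\<in>cartan L. bracket L h x = 0) \<longrightarrow> x \<in> cartan L) \<and>
    (\<forall>h\<in>cartan L. module.span (lscale L) {x. \<exists>c. bracket L h x = lscale L c x} = UNIV)"

definition root_space :: "'g::ab_group_add lie_data \<Rightarrow> ('g \<Rightarrow> complex) \<Rightarrow> 'g set" where
  "root_space L \<alpha> = {x. \<forall>h\<in>cartan L. bracket L h x = lscale L (\<alpha> h) x}"

definition roots :: "'g::ab_group_add lie_data \<Rightarrow> ('g \<Rightarrow> complex) set" where
  "roots L = {\<alpha> \<in> Hdual L. \<alpha> \<noteq> 0 \<and> root_space L \<alpha> \<noteq> {0}}"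

text \<open>\<open>n\<^sub>1 \<alpha>\<^sub>1 + \<dots> + n\<^sub>\<ell> \<alpha>\<^sub>\<ell>\<close> with natural coefficients.\<close>

definition root_comb :: "'g::ab_group_add lie_data \<Rightarrow> (nat \<Rightarrow> nat) \<Rightarrow> 'g \<Rightarrow> complex" where
  "root_comb L n = (\<Sum>i=1..lie_rank L. fscale (of_nat (n i)) (simple_root L i))"

definition is_simple_system :: "'g::ab_group_add lie_data \<Rightarrow> bool" where
  "is_simple_system L \<longleftrightarrow>
    inj_on (simple_root L) {1..lie_rank L} \<and>
    simple_root L ` {1..lie_rank L} \<subseteq> roots L \<and>
    \<not> module.dependent fscale (simple_root L ` {1..lie_rank L}) \<and>
    module.span fscale (simple_root L ` {1..lie_rank L}) = Hdual L \<and>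
    (\<forall>\<beta>\<in>roots L. \<exists>n. \<beta> = root_comb L n \<or> \<beta> = - root_comb L n)"

definition positive_roots :: "'g::ab_group_add lie_data \<Rightarrow> ('g \<Rightarrow> complex) set" where
  "positive_roots L = {\<beta> \<in> roots L. \<exists>n. \<beta> = root_comb L n}"

definition is_highest_root :: "'g::ab_group_add lie_data \<Rightarrow> bool" where
  "is_highest_root L \<longleftrightarrow>
    highest_root L \<in> roots L \<and> (\<forall>\<beta>\<in>roots L. \<exists>n. highest_root L - \<beta> = root_comb L n)"

text \<open>
  The Weyl group is defined through the coroots \<open>h\<^sub>\<alpha> \<in> [g\<^sub>\<alpha>, g\<^sub>-\<^sub>\<alpha>]\<close>, \<open>\<alpha>(h\<^sub>\<alpha>) = 2\<close>, and not
  through the form, since the form is in turn characterized by its invariance under the Weyl group.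
  Its elements are maps on \<open>H\<^sup>*\<close>, \<open>undefined\<close> elsewhere, as in \<^const>\<open>BijGroup\<close>.
\<close>

definition coroot :: "'g::ab_group_add lie_data \<Rightarrow> ('g \<Rightarrow> complex) \<Rightarrow> 'g" where
  "coroot L \<alpha> = (THE h. h \<in> module.span (lscale L)
      {bracket L x y | x y. x \<in> root_space L \<alpha> \<and> y \<in> root_space L (- \<alpha>)} \<and> \<alpha> h = 2)"

definition root_reflection ::
    "'g::ab_group_add lie_data \<Rightarrow> ('g \<Rightarrow> complex) \<Rightarrow> ('g \<Rightarrow> complex) \<Rightarrow> 'g \<Rightarrow> complex" where
  "root_reflection L \<alpha> = (\<lambda>\<beta>\<in>Hdual L. \<beta> - fscale (\<beta> (coroot L \<alpha>)) \<alpha>)"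

definition weyl_group :: "'g::ab_group_add lie_data \<Rightarrow> (('g \<Rightarrow> complex) \<Rightarrow> 'g \<Rightarrow> complex) set" where
  "weyl_group L = generate (BijGroup (Hdual L)) (root_reflection L ` roots L)"

text \<open>The \<open>W\<close>-invariant symmetric bilinear form on \<open>H\<^sup>*\<close> with \<open>(\<theta>,\<theta>) = 2\<close>.\<close>

definition is_normalized_form :: "'g::ab_group_add lie_data \<Rightarrow> bool" where
  "is_normalized_form L \<longleftrightarrow>
    (\<forall>\<beta>\<in>Hdual L. \<forall>\<gamma>\<in>Hdual L. \<forall>\<delta>\<in>Hdual L.
        root_form L (\<beta> + \<gamma>) \<delta> = root_form L \<beta> \<delta> + root_form L \<gamma> \<delta>) \<and>
    (\<forall>c. \<forall>\<beta>\<in>Hdual L. \<forall>\<gamma>\<in>Hdual L. root_form L (fscale c \<beta>) \<gamma> = c * root_form L \<beta> \<gamma>) \<and>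
    (\<forall>\<beta>\<in>Hdual L. \<forall>\<gamma>\<in>Hdual L. root_form L \<beta> \<gamma> = root_form L \<gamma> \<beta>) \<and>
    (\<forall>w\<in>weyl_group L. \<forall>\<beta>\<in>Hdual L. \<forall>\<gamma>\<in>Hdual L. root_form L (w \<beta>) (w \<gamma>) = root_form L \<beta> \<gamma>) \<and>
    root_form L (highest_root L) (highest_root L) = 2"

definition simple_lie_data :: "'g::ab_group_add lie_data \<Rightarrow> bool" where
  "simple_lie_data L \<longleftrightarrow>
    fin_dim_simple_lie_algebra (lscale L) (bracket L) \<and>
    cartan_subalgebra L \<and> is_simple_system L \<and> is_highest_root L \<and> is_normalized_form L"

section \<open>Weights\<close>

definition root_pairing ::
    "'g::ab_group_add lie_data \<Rightarrow> ('g \<Rightarrow> complex) \<Rightarrow> ('g \<Rightarrow> complex) \<Rightarrow> complex" where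
  "root_pairing L \<beta> \<alpha> = 2 * root_form L \<beta> \<alpha> / root_form L \<alpha> \<alpha>"

definition fund_weight :: "'g::ab_group_add lie_data \<Rightarrow> nat \<Rightarrow> 'g \<Rightarrow> complex" where
  "fund_weight L i = (THE \<omega>. \<omega> \<in> Hdual L \<and>
      (\<forall>j\<in>{1..lie_rank L}. root_pairing L \<omega> (simple_root L j) = (if i = j then 1 else 0)))"

definition weight_lattice :: "'g::ab_group_add lie_data \<Rightarrow> ('g \<Rightarrow> complex) set" where
  "weight_lattice L =
    {\<Sum>i=1..lie_rank L. fscale (of_int (n i)) (fund_weight L i) | n :: nat \<Rightarrow> int. True}"

definition dominant_weights :: "'g::ab_group_add lie_data \<Rightarrow> ('g \<Rightarrow> complex) set" where
  "dominant_weights L =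
    {\<Sum>i=1..lie_rank L. fscale (of_nat (n i)) (fund_weight L i) | n :: nat \<Rightarrow> nat. True}"

definition weyl_vector :: "'g::ab_group_add lie_data \<Rightarrow> 'g \<Rightarrow> complex" where
  "weyl_vector L = (\<Sum>i=1..lie_rank L. fund_weight L i)"

definition dual_coxeter :: "'g::ab_group_add lie_data \<Rightarrow> complex" where
  "dual_coxeter L = 1 + root_pairing L (weyl_vector L) (highest_root L)"

text \<open>
  The pairings of integral weights with roots are integers, of type \<^typ>\<open>complex\<close> here; \<^const>\<open>Re\<close>
  only serves to compare them.
\<close>

definition level_weights :: "'g::ab_group_add lie_data \<Rightarrow> nat \<Rightarrow> ('g \<Rightarrow> complex) set" where
  "level_weights L k =
    {\<beta> \<in> dominant_weights L. Re (root_pairing L \<beta> (highest_root L)) \<le> real k}"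

definition F' :: "'g::ab_group_add lie_data \<Rightarrow> nat \<Rightarrow> ('g \<Rightarrow> complex) set" where
  "F' L k = {\<mu> \<in> weight_lattice L. \<forall>w\<in>weyl_group L.
      - (real k + Re (dual_coxeter L)) < Re (root_pairing L \<mu> (w (highest_root L))) \<and>
      Re (root_pairing L \<mu> (w (highest_root L))) < real k + Re (dual_coxeter L)}"

section \<open>Modules\<close>

text \<open>The module is the set \<open>mcarrier M\<close>, a subspace of the type \<^typ>\<open>'v\<close>.\<close>

record ('g, 'v) lie_module =
  mcarrier :: "'v set"
  mscale :: "complex \<Rightarrow> 'v \<Rightarrow> 'v"
  mact :: "'g \<Rightarrow> 'v \<Rightarrow> 'v"

definition is_lie_module :: "'g::ab_group_add lie_data \<Rightarrow> ('g, 'v::ab_group_add) lie_module \<Rightarrow> bool" where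
  "is_lie_module L M \<longleftrightarrow>
    vector_space (mscale M) \<and> module.subspace (mscale M) (mcarrier M) \<and>
    (\<forall>x. \<forall>v\<in>mcarrier M. mact M x v \<in> mcarrier M) \<and>
    (\<forall>x. \<forall>v\<in>mcarrier M. \<forall>u\<in>mcarrier M. mact M x (v + u) = mact M x v + mact M x u) \<and>
    (\<forall>x c. \<forall>v\<in>mcarrier M. mact M x (mscale M c v) = mscale M c (mact M x v)) \<and>
    (\<forall>x y. \<forall>v\<in>mcarrier M. mact M (x + y) v = mact M x v + mact M y v) \<and>
    (\<forall>x c. \<forall>v\<in>mcarrier M. mact M (lscale L c x) v = mscale M c (mact M x v)) \<and>
    (\<forall>x y. \<forall>v\<in>mcarrier M.
        mact M (bracket L x y) v = mact M x (mact M y v) - mact M y (mact M x v))"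

definition submodule_on :: "('g, 'v) lie_module \<Rightarrow> 'v set \<Rightarrow> ('g, 'v) lie_module" where
  "submodule_on M S = M\<lparr>mcarrier := S\<rparr>"

definition irreducible_module :: "'g::ab_group_add lie_data \<Rightarrow> ('g, 'v::ab_group_add) lie_module \<Rightarrow> bool" where
  "irreducible_module L M \<longleftrightarrow>
    is_lie_module L M \<and> mcarrier M \<noteq> {0} \<and>
    (\<forall>S \<subseteq> mcarrier M. is_lie_module L (submodule_on M S) \<longrightarrow> S = {0} \<or> S = mcarrier M)"

definition weight_space ::
    "'g::ab_group_add lie_data \<Rightarrow> ('g, 'v::ab_group_add) lie_module \<Rightarrow> ('g \<Rightarrow> complex) \<Rightarrow> 'v set" where
  "weight_space L M \<beta> = {v \<in> mcarrier M. \<forall>h\<in>cartan L. mact M h v = mscale M (\<beta> h) v}"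

definition module_weights ::
    "'g::ab_group_add lie_data \<Rightarrow> ('g, 'v::ab_group_add) lie_module \<Rightarrow> ('g \<Rightarrow> complex) set" where
  "module_weights L M = {\<beta> \<in> Hdual L. weight_space L M \<beta> \<noteq> {0}}"

text \<open>\<open>M\<close> is a model of \<open>V\<^sup>\<nu>\<close>, which is unique up to isomorphism.\<close>

definition is_highest_weight_irrep ::
    "'g::ab_group_add lie_data \<Rightarrow> ('g \<Rightarrow> complex) \<Rightarrow> ('g, 'v::ab_group_add) lie_module \<Rightarrow> bool" where
  "is_highest_weight_irrep L \<nu> M \<longleftrightarrow>
    irreducible_module L M \<and>
    (\<exists>B. finite B \<and> module.span (mscale M) B = mcarrier M) \<and>
    \<nu> \<in> Hdual L \<and>
    (\<exists>v\<in>weight_space L M \<nu>. v \<noteq> 0 \<and> (\<forall>\<alpha>\<in>positive_roots L. \<forall>x\<in>root_space L \<alpha>. mact M x v = 0))"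

subsection \<open>Tensor products\<close>

text \<open>
  The tensor product of finite dimensional spaces \<open>V\<close>, \<open>U\<close> is realized in the space of bilinear
  forms on \<open>V\<^sup>* \<times> U\<^sup>*\<close>: the elementary tensor \<open>v \<otimes> u\<close> is the form \<open>(f, g) \<mapsto> f v \<cdot> g u\<close>. Like the
  functionals, the forms are extended by \<open>0\<close>.
\<close>

type_synonym ('v, 'u) tensor = "('v \<Rightarrow> complex) \<Rightarrow> ('u \<Rightarrow> complex) \<Rightarrow> complex"

abbreviation mdual :: "('g, 'v::ab_group_add) lie_module \<Rightarrow> ('v \<Rightarrow> complex) set" where
  "mdual M \<equiv> dual_space (mscale M) (mcarrier M)"

definition elem_tensor ::
    "('g, 'v::ab_group_add) lie_module \<Rightarrow> ('g, 'u::ab_group_add) lie_module \<Rightarrow> 'v \<Rightarrow> 'u \<Rightarrow> ('v, 'u) tensor" where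
  "elem_tensor V U v u = (\<lambda>f g. if f \<in> mdual V \<and> g \<in> mdual U then f v * g u else 0)"

definition tscale :: "complex \<Rightarrow> ('v, 'u) tensor \<Rightarrow> ('v, 'u) tensor" where
  "tscale c t = (\<lambda>f g. c * t f g)"

definition precomp_act :: "('g, 'v) lie_module \<Rightarrow> 'g \<Rightarrow> ('v \<Rightarrow> complex) \<Rightarrow> 'v \<Rightarrow> complex" where
  "precomp_act M x f = (\<lambda>v. if v \<in> mcarrier M then f (mact M x v) else 0)"

definition tensor_act ::
    "('g, 'v::ab_group_add) lie_module \<Rightarrow> ('g, 'u::ab_group_add) lie_module \<Rightarrow> 'g \<Rightarrow> ('v, 'u) tensor \<Rightarrow> ('v, 'u) tensor" where
  "tensor_act V U x t = (\<lambda>f g. if f \<in> mdual V \<and> g \<in> mdual U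
      then t (precomp_act V x f) g + t f (precomp_act U x g) else 0)"

definition tensor_module ::
    "('g, 'v::ab_group_add) lie_module \<Rightarrow> ('g, 'u::ab_group_add) lie_module \<Rightarrow> ('g, ('v, 'u) tensor) lie_module" where
  "tensor_module V U =
    \<lparr>mcarrier = module.span tscale {elem_tensor V U v u | v u. v \<in> mcarrier V \<and> u \<in> mcarrier U},
     mscale = tscale,
     mact = tensor_act V U\<rparr>"

lemma precomp_act_in_mdual:
  assumes "is_lie_module L M" "f \<in> mdual M"
  shows "precomp_act M x f \<in> mdual M"
proof -
  interpret vector_space "mscale M" using assms by (simp add: is_lie_module_def)
  have "subspace (mcarrier M)" using assms by (simp add: is_lie_module_def)
  then show ?thesis
    using assms by (auto simp: is_lie_module_def dual_space_def precomp_act_def subspace_def)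
qed

lemma tensor_act_elem_tensor:
  assumes "is_lie_module L V" "is_lie_module L U" "v \<in> mcarrier V" "u \<in> mcarrier U"
  shows "tensor_act V U x (elem_tensor V U v u) =
    elem_tensor V U (mact V x v) u + elem_tensor V U v (mact U x u)"
  using assms precomp_act_in_mdual[OF assms(1)] precomp_act_in_mdual[OF assms(2)]
  by (auto simp: fun_eq_iff tensor_act_def elem_tensor_def precomp_act_def)

subsection \<open>Multiplicities\<close>

definition irreducible_decomposition ::
    "'g::ab_group_add lie_data \<Rightarrow> ('g, 'v::ab_group_add) lie_module \<Rightarrow> 'v set set \<Rightarrow> bool" where
  "irreducible_decomposition L M D \<longleftrightarrow>
    finite D \<and>
    (\<forall>S\<in>D. S \<subseteq> mcarrier M \<and> irreducible_module L (submodule_on M S)) \<and>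
    (\<forall>v\<in>mcarrier M. \<exists>!f. f \<in> (\<Pi>\<^sub>E S\<in>D. S) \<and> v = (\<Sum>S\<in>D. f S))"

text \<open>
  The number of summands isomorphic to \<open>V\<^sup>\<nu>\<close> in a decomposition of \<open>M\<close> into irreducible modules.
  A decomposition exists by complete reducibility, and the number does not depend on its choice.
\<close>

definition irrep_multiplicity ::
    "'g::ab_group_add lie_data \<Rightarrow> ('g, 'v::ab_group_add) lie_module \<Rightarrow> ('g \<Rightarrow> complex) \<Rightarrow> nat" where
  "irrep_multiplicity L M \<nu> =
    card {S \<in> (SOME D. irreducible_decomposition L M D).
      S \<subseteq> mcarrier M \<and> is_highest_weight_irrep L \<nu> (submodule_on M S)}"

definition tensor_mult ::
    "'g::ab_group_add lie_data \<Rightarrow> ('g, 'v::ab_group_add) lie_module \<Rightarrow> ('g, 'u::ab_group_add) lie_module \<Rightarrow>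
     ('g \<Rightarrow> complex) \<Rightarrow> nat" where
  "tensor_mult L V U \<gamma> =
    (if \<gamma> \<in> dominant_weights L then irrep_multiplicity L (tensor_module V U) \<gamma> else 0)"

section \<open>The affine Weyl group and fusion coefficients\<close>

definition affine_reflection ::
    "'g::ab_group_add lie_data \<Rightarrow> nat \<Rightarrow> ('g \<Rightarrow> complex) \<Rightarrow> 'g \<Rightarrow> complex" where
  "affine_reflection L k = (\<lambda>\<beta>\<in>Hdual L.
      \<beta> - fscale (root_pairing L \<beta> (highest_root L)) (highest_root L)
        + fscale (of_nat k + dual_coxeter L) (highest_root L))"

definition affine_weyl_group ::
    "'g::ab_group_add lie_data \<Rightarrow> nat \<Rightarrow> (('g \<Rightarrow> complex) \<Rightarrow> 'g \<Rightarrow> complex) set" where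
  "affine_weyl_group L k =
    generate (BijGroup (Hdual L)) (insert (affine_reflection L k) (weyl_group L))"

definition affine_generators ::
    "'g::ab_group_add lie_data \<Rightarrow> nat \<Rightarrow> (('g \<Rightarrow> complex) \<Rightarrow> 'g \<Rightarrow> complex) set" where
  "affine_generators L k =
    insert (affine_reflection L k) ((\<lambda>i. root_reflection L (simple_root L i)) ` {1..lie_rank L})"

definition affine_length ::
    "'g::ab_group_add lie_data \<Rightarrow> nat \<Rightarrow> (('g \<Rightarrow> complex) \<Rightarrow> 'g \<Rightarrow> complex) \<Rightarrow> nat" where
  "affine_length L k w = (LEAST n. \<exists>ws. length ws = n \<and> set ws \<subseteq> affine_generators L k \<and>
      w = foldr (mult (BijGroup (Hdual L))) ws (one (BijGroup (Hdual L))))"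

text \<open>
  The Kac-Walton formula. The affine Weyl group is infinite, but only finitely many
  terms are nonzero.
\<close>

definition fusion_coeff ::
    "'g::ab_group_add lie_data \<Rightarrow> nat \<Rightarrow> ('g, 'v::ab_group_add) lie_module \<Rightarrow> ('g, 'u::ab_group_add) lie_module \<Rightarrow>
     ('g \<Rightarrow> complex) \<Rightarrow> int" where
  "fusion_coeff L k V U \<nu> =
    (\<Sum>w \<in> {w \<in> affine_weyl_group L k. tensor_mult L V U (w (\<nu> + weyl_vector L) - weyl_vector L) \<noteq> 0}.
      (- 1) ^ affine_length L k w *
      int (tensor_mult L V U (w (\<nu> + weyl_vector L) - weyl_vector L)))"

end

theory Submission
  imports Defs
begin

text \<open>
  A summand of highest weight \<open>\<gamma>\<close> of \<open>V\<^sup>\<lambda> \<otimes> V\<^sup>\<mu>\<close> gives, by contraction of its highest weight vector with the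
  lowest weight vector of the dual of \<open>V\<^sup>\<mu>\<close>, a weight vector of \<open>V\<^sup>\<lambda>\<close> of weight \<open>\<gamma> - \<mu>\<close>. The
  contraction is not zero because the dual is generated by its lowest weight vector under the raising
  operators. So if the term of \<open>w\<close> in the Kac-Walton formula is not zero, then
  \<open>w(\<nu> + \<rho>) \<in> \<Pi>\<^sup>\<lambda> + \<mu> + \<rho>\<close>, and \<open>w(\<nu> + \<rho>)\<close> lies in the open fundamental alcove, as \<open>\<nu> + \<rho>\<close> does.
  The affine Weyl group acts freely on alcoves, by the exchange condition, whence \<open>w = 1\<close>.

  The root system properties that this needs are derived without the Killing form: that the spaces
  \<open>[g\<^sub>\<alpha>, g\<^sub>-\<^sub>\<alpha>]\<close> are not zero and that roots have positive length follows from simplicity, since the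
  exceptional roots would span an ideal.
\<close>

section \<open>Weight spaces and the root decomposition\<close>

text \<open>The form is given only by bilinearity, symmetry, Weyl invariance and (\<theta>,\<theta>)
  = 2, so neither its nondegeneracy nor the reality of its values on roots is available at the
  start. Pairings of roots are therefore first compared through \<open>root_sum_form\<close>, which
  lives on \<open>H\<close> and is built from the roots alone; the normalization at \<theta>
  supplies the one root whose length is known. All pairings have complex values, hence the recurring
  steps that recognize a value as an integer or a positive real before an inequality is stated.
  Alcoves are handled by combinatorics rather than topology: a point is located by the signs of the
  affine roots at it, and an element of the affine group is represented by a word in simple
  reflections, so that a nonempty word leading from the open alcove into itself can be replaced by a
  shorter one. On the module side only the nonvanishing of a tensor multiplicity is turned into
  information about weights; its value enters the result unchanged, as the term of the
  identity.\<close>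

lemma vector_space_fscale: "vector_space fscale"
  by unfold_locales (auto simp: fscale_def fun_eq_iff algebra_simps)

lemma fscale_apply [simp]: "fscale c f x = c * f x"
  by (simp add: fscale_def)

lemma sum_fun_apply: "(\<Sum>i\<in>A. f i) x = (\<Sum>i\<in>A. f i x)"
  by (induction A rule: infinite_finite_induct) auto

text \<open>The induction merges a new vector into the summand already present for its index, so
  each index occurs once. This makes the independence of eigenvectors applicable to the
  summands.\<close>

lemma (in module) span_UN_subspaceE:
  assumes "x \<in> span (\<Union>j\<in>J. S j)" "\<And>j. j \<in> J \<Longrightarrow> subspace (S j)"
  obtains F v where "finite F" "F \<subseteq> J" "\<And>j. j \<in> F \<Longrightarrow> v j \<in> S j" "x = (\<Sum>j\<in>F. v j)"
proof -
  have "\<exists>F v. finite F \<and> F \<subseteq> J \<and> (\<forall>j\<in>F. v j \<in> S j) \<and> x = (\<Sum>j\<in>F. v j)"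
    using assms(1)
  proof (induction rule: span_induct_alt)
    case base
    show ?case by (rule exI[of _ "{}"]) auto
  next
    case (step c y z)
    then obtain F v j where F: "finite F" "F \<subseteq> J" "\<forall>j\<in>F. v j \<in> S j" "z = (\<Sum>j\<in>F. v j)"
      and j: "j \<in> J" "y \<in> S j" by blast
    let ?v = "\<lambda>i. if i = j then scale c y + (if j \<in> F then v j else 0) else v i"
    have "\<forall>i\<in>insert j F. ?v i \<in> S i"
      using F j assms(2) by (auto intro!: subspace_add subspace_scale subspace_0)
    moreover have "scale c y + z = (\<Sum>i\<in>insert j F. ?v i)"
    proof -
      have "(\<Sum>i\<in>insert j F. ?v i) = ?v j + (\<Sum>i\<in>F - {j}. ?v i)"
        using F(1) by (simp add: sum.insert_remove)
      also have "(\<Sum>i\<in>F - {j}. ?v i) = (\<Sum>i\<in>F - {j}. v i)" by (rule sum.cong) auto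
      finally show ?thesis
        using F(1,4) by (cases "j \<in> F") (auto simp: sum.remove[of F j] add_ac)
    qed
    ultimately show ?case
      using F(1,2) j(1) by (intro exI[of _ "insert j F"] exI[of _ ?v]) auto
  qed
  then show ?thesis using that by blast
qed

section \<open>Independence of joint eigenvectors of a family of operators\<close>

context vector_space
begin

text \<open>Linearity of \<open>T i\<close> is asked only on \<open>C\<close>, since
  \<open>mact M\<close> is linear only on \<open>mcarrier M\<close>. The \<open>v j\<close> may be
  zero, so independence takes the form that a vanishing sum vanishes termwise.\<close>

lemma joint_eigenvectors_sum_eq_0:
  fixes T :: "'i \<Rightarrow> 'b \<Rightarrow> 'b" and e :: "'j \<Rightarrow> 'i \<Rightarrow> 'a"
  assumes "finite F" "subspace C"
    and "\<And>i x y. i \<in> I \<Longrightarrow> x \<in> C \<Longrightarrow> y \<in> C \<Longrightarrow> T i (x + y) = T i x + T i y"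
    and "\<And>i c x. i \<in> I \<Longrightarrow> x \<in> C \<Longrightarrow> T i (scale c x) = scale c (T i x)"
    and "\<And>j. j \<in> F \<Longrightarrow> v j \<in> C"
    and "\<And>i j. i \<in> I \<Longrightarrow> j \<in> F \<Longrightarrow> T i (v j) = scale (e j i) (v j)"
    and "\<And>j j'. j \<in> F \<Longrightarrow> j' \<in> F \<Longrightarrow> j \<noteq> j' \<Longrightarrow> \<exists>i\<in>I. e j i \<noteq> e j' i"
    and "sum v F = 0" and "j \<in> F"
  shows "v j = 0"
  using assms(1,5-)
proof (induction F arbitrary: v j rule: finite_induct)
  case (insert g F)
  note vC = insert.prems(1)
  have T0: "T i 0 = 0" if "i \<in> I" for i
    using assms(4)[OF that subspace_0[OF assms(2)], of 0] by simp
  have Tsum: "T i (sum v G) = (\<Sum>j\<in>G. T i (v j))" if "i \<in> I" "G \<subseteq> insert g F" for i G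
  proof -
    have "finite G" using that(2) insert.hyps(1) finite_subset by auto
    then show ?thesis using that(2)
    proof (induction G rule: finite_induct)
      case empty
      show ?case using T0[OF that(1)] by simp
    next
      case (insert a G)
      have "sum v G \<in> C"
        using insert.prems vC assms(2) by (intro subspace_sum) auto
      then show ?case
        using insert assms(3)[OF that(1)] vC by auto
    qed
  qed
  have F0: "v f = 0" if f: "f \<in> F" for f
  proof -
    have "f \<noteq> g" using f insert.hyps by auto
    then obtain i where i: "i \<in> I" "e f i \<noteq> e g i" using insert.prems(3)[of f g] f by auto
    \<comment> \<open>\<open>?w\<close> is the effect of \<open>T i - e g i\<close> on the summands:
      it removes \<open>v g\<close> and multiplies the others by scalars, of which the one at
      \<open>f\<close> is nonzero.\<close>
    let ?w = "\<lambda>j. scale (e j i - e g i) (v j)"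
    have "sum ?w F = sum ?w (insert g F)" using insert.hyps by simp
    also have "\<dots> = (\<Sum>j\<in>insert g F. T i (v j)) - scale (e g i) (\<Sum>j\<in>insert g F. v j)"
      unfolding scale_sum_right sum_subtractf[symmetric]
      by (intro sum.cong refl) (use insert.prems(2) i in \<open>auto simp: scale_left_diff_distrib\<close>)
    also have "\<dots> = 0"
      using Tsum[OF i(1) subset_refl] insert.prems(4) T0[OF i(1)] by simp
    finally have 0: "sum ?w F = 0" .
    have "?w f = 0"
    proof (rule insert.IH[of ?w, OF _ _ _ 0 f])
      show "?w j \<in> C" if "j \<in> F" for j
        using that insert.prems(1) assms(2) by (auto intro: subspace_scale)
      show "T i' (?w j) = scale (e j i') (?w j)" if "i' \<in> I" "j \<in> F" for i' j
        using that insert.prems(1,2) assms(4) by (auto simp: mult.commute)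
      show "\<exists>i\<in>I. e j i \<noteq> e j' i" if "j \<in> F" "j' \<in> F" "j \<noteq> j'" for j j'
        using that insert.prems(3) by auto
    qed
    then show ?thesis using i by simp
  qed
  then have "v g = 0" using insert.prems(4) insert.hyps by simp
  then show ?case using F0 insert.prems(5) by auto
qed simp

text \<open>Serves both the bracket on the whole algebra and the action on a module carrier. Moving
  \<open>x\<close> to the other side gives a vanishing sum of eigenvectors for
  \<open>insert k F\<close>.\<close>

lemma joint_eigenvector_in_span_others:
  fixes T :: "'i \<Rightarrow> 'b \<Rightarrow> 'b" and e :: "'j \<Rightarrow> 'i \<Rightarrow> 'a"
  defines "E \<equiv> \<lambda>C I j. {x \<in> C. \<forall>i\<in>I. T i x = scale (e j i) x}"
  assumes "subspace C"
    and add: "\<And>i x y. i \<in> I \<Longrightarrow> x \<in> C \<Longrightarrow> y \<in> C \<Longrightarrow> T i (x + y) = T i x + T i y"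
    and hom: "\<And>i c x. i \<in> I \<Longrightarrow> x \<in> C \<Longrightarrow> T i (scale c x) = scale c (T i x)"
    and dist: "\<And>j j'. j \<in> insert k J \<Longrightarrow> j' \<in> insert k J \<Longrightarrow> j \<noteq> j' \<Longrightarrow> \<exists>i\<in>I. e j i \<noteq> e j' i"
    and "k \<notin> J" and "x \<in> E C I k" and "x \<in> span (\<Union>j\<in>J. E C I j)"
  shows "x = 0"
proof -
  have "subspace (E C I j)" for j
    unfolding subspace_def E_def
    using assms(2) subspace_0[OF assms(2)] hom[OF _ subspace_0[OF assms(2)], of _ 0]
    by (auto simp: add hom subspace_add subspace_scale scale_right_distrib mult.commute)
  with assms(8) obtain F v where F: "finite F" "F \<subseteq> J" "\<And>j. j \<in> F \<Longrightarrow> v j \<in> E C I j"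
    "x = (\<Sum>j\<in>F. v j)"
    by (rule span_UN_subspaceE) auto
  let ?v = "v(k := - x)"
  have "k \<notin> F" using F \<open>k \<notin> J\<close> by auto
  have "sum ?v F = sum v F" by (rule sum.cong) (use \<open>k \<notin> F\<close> in auto)
  then have s: "sum ?v (insert k F) = 0" using F \<open>k \<notin> F\<close> by simp
  have x: "x \<in> C" "\<And>i. i \<in> I \<Longrightarrow> T i x = scale (e k i) x" using assms(7) by (auto simp: E_def)
  have "?v k = 0"
  proof (rule joint_eigenvectors_sum_eq_0[where T = T and e = e and I = I, OF _ assms(2) add hom _ _ _ s])
    show "?v j \<in> C" if "j \<in> insert k F" for j
      using that F x subspace_neg[OF assms(2)] by (auto simp: E_def)
    show "T i (?v j) = scale (e j i) (?v j)" if "i \<in> I" "j \<in> insert k F" for i j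
    proof (cases "j = k")
      case True
      then show ?thesis using hom[OF that(1) x(1), of "-1"] x(2)[OF that(1)] by simp
    qed (use that F in \<open>auto simp: E_def\<close>)
    show "\<exists>i\<in>I. e j i \<noteq> e j' i" if "j \<in> insert k F" "j' \<in> insert k F" "j \<noteq> j'" for j j'
      using that F(2) by (intro dist) auto
  qed (use F in auto)
  then show ?thesis by simp
qed

end

text \<open>The data without simple roots and form. Coroots and root reflections depend on these
  alone, and the form can be analysed only once they are understood.\<close>

locale simple_lie_cartan =
  fixes L :: "'g::ab_group_add lie_data"
  assumes lie: "fin_dim_simple_lie_algebra (lscale L) (bracket L)"
    and cartan: "cartan_subalgebra L"

sublocale simple_lie_cartan \<subseteq> fin_dim_simple_lie_algebra "lscale L" "bracket L"
  by (rule lie)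

context simple_lie_cartan
begin

abbreviation br :: "'g \<Rightarrow> 'g \<Rightarrow> 'g" where "br \<equiv> bracket L"
abbreviation sc :: "complex \<Rightarrow> 'g \<Rightarrow> 'g" where "sc \<equiv> lscale L"
abbreviation H :: "'g set" where "H \<equiv> cartan L"

lemma subspace_H: "subspace H" and H_abelian: "h \<in> H \<Longrightarrow> h' \<in> H \<Longrightarrow> br h h' = 0"
  and H_self_centralizing: "(\<And>h. h \<in> H \<Longrightarrow> br h x = 0) \<Longrightarrow> x \<in> H"
  and H_diagonalizable: "h \<in> H \<Longrightarrow> span {x. \<exists>c. br h x = sc c x} = UNIV"
  using cartan unfolding cartan_subalgebra_def by blast+

lemma br_zero [simp]: "br 0 x = 0" "br x 0 = 0"
  using br_scale_left[of 0 x x] br_scale_right[of x 0 x] br_add_left[of 0 0 x] br_add_right[of x 0 0] by auto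

lemma br_minus_left: "br (- x) y = - br x y" and br_minus_right: "br x (- y) = - br x y"
  using br_scale_left[of "-1" x y] br_scale_right[of x "-1" y] by auto

lemma br_diff_left: "br (x - y) z = br x z - br y z" and br_diff_right: "br x (y - z) = br x y - br x z"
  using br_add_left[of x "- y" z] br_add_right[of x y "- z"] by (auto simp: br_minus_left br_minus_right)

lemma br_anti: "br y x = - br x y"
proof -
  have "br x y + br y x = br (x + y) (x + y)"
    unfolding br_add_left br_add_right by (simp add: br_alternating)
  also have "\<dots> = 0" by (rule br_alternating)
  finally have "br x y + br y x = 0" .
  then show ?thesis by (simp add: add_eq_0_iff)
qed

lemma jacobi_right: "br x (br y z) = br (br x y) z + br y (br x z)"
  using jacobi[of x y z] br_anti[of z "br x y"] br_anti[of z x]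
  by (simp add: br_minus_right algebra_simps add_eq_0_iff)

lemma jacobi_left: "br (br x y) z = br x (br y z) - br y (br x z)"
  using jacobi_right[of x y z] by simp

lemma subspace_root_space: "subspace (root_space L \<alpha>)"
  by (auto simp: subspace_def root_space_def br_add_right br_scale_right scale_right_distrib mult.commute)

lemma root_spaceD: "x \<in> root_space L \<alpha> \<Longrightarrow> h \<in> H \<Longrightarrow> br h x = sc (\<alpha> h) x"
  by (simp add: root_space_def)

lemma root_spaceD': "x \<in> root_space L \<alpha> \<Longrightarrow> h \<in> H \<Longrightarrow> br x h = sc (- \<alpha> h) x"
  using root_spaceD br_anti[of x h] by simp

lemma root_space_0: "root_space L 0 = H"
  using H_abelian H_self_centralizing by (auto simp: root_space_def)

lemma br_root_space:
  assumes "x \<in> root_space L \<alpha>" "y \<in> root_space L \<beta>"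
  shows "br x y \<in> root_space L (\<alpha> + \<beta>)"
  unfolding root_space_def
proof safe
  fix h assume h: "h \<in> H"
  have "br h (br x y) = br (br h x) y + br x (br h y)" by (rule jacobi_right)
  then show "br h (br x y) = sc ((\<alpha> + \<beta>) h) (br x y)"
    using assms h by (simp add: root_spaceD br_scale_left br_scale_right scale_left_distrib)
qed

lemma subspace_Hdual: "module.subspace fscale (Hdual L)"
proof -
  interpret F: vector_space fscale by (rule vector_space_fscale)
  show ?thesis using subspace_H
    by (auto simp: F.subspace_def dual_space_def subspace_def algebra_simps)
qed

lemma Hdual_0: "0 \<in> Hdual L" and Hdual_add: "\<alpha> \<in> Hdual L \<Longrightarrow> \<beta> \<in> Hdual L \<Longrightarrow> \<alpha> + \<beta> \<in> Hdual L"
  and Hdual_scale: "\<alpha> \<in> Hdual L \<Longrightarrow> fscale c \<alpha> \<in> Hdual L"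
  and Hdual_uminus: "\<alpha> \<in> Hdual L \<Longrightarrow> - \<alpha> \<in> Hdual L"
  and Hdual_diff: "\<alpha> \<in> Hdual L \<Longrightarrow> \<beta> \<in> Hdual L \<Longrightarrow> \<alpha> - \<beta> \<in> Hdual L"
proof -
  interpret F: vector_space fscale by (rule vector_space_fscale)
  note S = subspace_Hdual
  show "0 \<in> Hdual L" "\<alpha> \<in> Hdual L \<Longrightarrow> \<beta> \<in> Hdual L \<Longrightarrow> \<alpha> + \<beta> \<in> Hdual L"
    "\<alpha> \<in> Hdual L \<Longrightarrow> fscale c \<alpha> \<in> Hdual L" "\<alpha> \<in> Hdual L \<Longrightarrow> - \<alpha> \<in> Hdual L"
    "\<alpha> \<in> Hdual L \<Longrightarrow> \<beta> \<in> Hdual L \<Longrightarrow> \<alpha> - \<beta> \<in> Hdual L"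
    using F.subspace_0[OF S] F.subspace_add[OF S] F.subspace_scale[OF S] F.subspace_neg[OF S]
      F.subspace_diff[OF S] by auto
qed

lemma Hdual_sum: "(\<And>i. i \<in> A \<Longrightarrow> f i \<in> Hdual L) \<Longrightarrow> sum f A \<in> Hdual L"
  by (induction A rule: infinite_finite_induct) (auto intro: Hdual_add simp: Hdual_0)

lemma Hdual_add_apply: "\<alpha> \<in> Hdual L \<Longrightarrow> h \<in> H \<Longrightarrow> h' \<in> H \<Longrightarrow> \<alpha> (h + h') = \<alpha> h + \<alpha> h'"
  and Hdual_scale_apply: "\<alpha> \<in> Hdual L \<Longrightarrow> h \<in> H \<Longrightarrow> \<alpha> (sc c h) = c * \<alpha> h"
  and Hdual_outside: "\<alpha> \<in> Hdual L \<Longrightarrow> h \<notin> H \<Longrightarrow> \<alpha> h = 0"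
  by (auto simp: dual_space_def)

lemma Hdual_diff_apply: "\<alpha> \<in> Hdual L \<Longrightarrow> h \<in> H \<Longrightarrow> h' \<in> H \<Longrightarrow> \<alpha> (h - h') = \<alpha> h - \<alpha> h'"
  using Hdual_add_apply[of \<alpha> h "- h'"] Hdual_scale_apply[of \<alpha> h' "-1"] subspace_neg[OF subspace_H] by auto

lemma Hdual_uminus_apply: "\<alpha> \<in> Hdual L \<Longrightarrow> h \<in> H \<Longrightarrow> \<alpha> (- h) = - \<alpha> h"
  using Hdual_scale_apply[of \<alpha> h "-1"] by auto

lemma Hdual_zero_apply: "\<alpha> \<in> Hdual L \<Longrightarrow> \<alpha> 0 = 0"
  using Hdual_scale_apply[of \<alpha> 0 0] subspace_0[OF subspace_H] by auto

lemma Hdual_eqI: "\<alpha> \<in> Hdual L \<Longrightarrow> \<beta> \<in> Hdual L \<Longrightarrow> (\<And>h. h \<in> H \<Longrightarrow> \<alpha> h = \<beta> h) \<Longrightarrow> \<alpha> = \<beta>"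
  using Hdual_outside by (metis ext)

lemma Hdual_neqE:
  assumes "\<alpha> \<in> Hdual L" "\<beta> \<in> Hdual L" "\<alpha> \<noteq> \<beta>"
  obtains h where "h \<in> H" "\<alpha> h \<noteq> \<beta> h"
  using Hdual_eqI assms by blast

lemma rootsD: "\<alpha> \<in> roots L \<Longrightarrow> \<alpha> \<in> Hdual L" "\<alpha> \<in> roots L \<Longrightarrow> \<alpha> \<noteq> 0"
  by (auto simp: roots_def)

lemma rootE:
  assumes "\<alpha> \<in> roots L" obtains x where "x \<in> root_space L \<alpha>" "x \<noteq> 0"
  using assms subspace_0[OF subspace_root_space] by (auto simp: roots_def)

lemma rootI: "\<alpha> \<in> Hdual L \<Longrightarrow> \<alpha> \<noteq> 0 \<Longrightarrow> x \<in> root_space L \<alpha> \<Longrightarrow> x \<noteq> 0 \<Longrightarrow> \<alpha> \<in> roots L"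
  by (auto simp: roots_def)

text \<open>\<open>J\<close> consists of arbitrary functionals so that it may contain 0, whose root
  space is \<open>H\<close>.\<close>

lemma root_space_Int_span:
  assumes "J \<subseteq> Hdual L" "\<alpha> \<in> Hdual L" "\<alpha> \<notin> J" "x \<in> root_space L \<alpha>"
    "x \<in> span (\<Union>\<beta>\<in>J. root_space L \<beta>)"
  shows "x = 0"
proof (rule joint_eigenvector_in_span_others[where C = UNIV and I = H and T = br and k = \<alpha> and J = J and e = "\<lambda>\<alpha>. \<alpha>"])
  show "\<exists>i\<in>H. j i \<noteq> j' i" if "j \<in> insert \<alpha> J" "j' \<in> insert \<alpha> J" "j \<noteq> j'" for j j'
    using Hdual_neqE[of j j'] that assms by blast
qed (use assms in \<open>auto simp: br_add_right br_scale_right root_space_def\<close>)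

section \<open>Finiteness of the root system and the root space decomposition\<close>

lemma finite_roots: "finite (roots L)"
proof -
  have "\<exists>x. x \<in> root_space L \<alpha> \<and> x \<noteq> 0" if "\<alpha> \<in> roots L" for \<alpha> using that by (auto elim: rootE)
  then obtain f where f: "\<And>\<alpha>. \<alpha> \<in> roots L \<Longrightarrow> f \<alpha> \<in> root_space L \<alpha> \<and> f \<alpha> \<noteq> 0" by metis
  have nin: "f \<alpha> \<notin> span (f ` (roots L - {\<alpha>}))" if "\<alpha> \<in> roots L" for \<alpha>
  proof
    assume a: "f \<alpha> \<in> span (f ` (roots L - {\<alpha>}))"
    have "f ` (roots L - {\<alpha>}) \<subseteq> (\<Union>\<beta>\<in>roots L - {\<alpha>}. root_space L \<beta>)" using f by auto
    with a have "f \<alpha> \<in> span (\<Union>\<beta>\<in>roots L - {\<alpha>}. root_space L \<beta>)" using span_mono by blast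
    then have "f \<alpha> = 0"
      using f that rootsD by (intro root_space_Int_span[of "roots L - {\<alpha>}" \<alpha>]) auto
    then show False using f that by auto
  qed
  have inj: "inj_on f (roots L)"
  proof (rule inj_onI, rule ccontr)
    fix \<alpha> \<beta> assume a: "\<alpha> \<in> roots L" "\<beta> \<in> roots L" "f \<alpha> = f \<beta>" "\<alpha> \<noteq> \<beta>"
    then have "f \<alpha> \<in> f ` (roots L - {\<alpha>})" by auto
    then have "f \<alpha> \<in> span (f ` (roots L - {\<alpha>}))" by (rule span_base)
    then show False using nin[OF a(1)] by contradiction
  qed
  have "independent (f ` roots L)"
    unfolding dependent_def
  proof safe
    fix \<alpha> assume a: "\<alpha> \<in> roots L" "f \<alpha> \<in> span (f ` roots L - {f \<alpha>})"
    have "f ` roots L - {f \<alpha>} = f ` (roots L - {\<alpha>})" using inj a(1) by (auto dest: inj_onD)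
    then show False using nin a by auto
  qed
  moreover obtain B where "finite B" "span B = UNIV" using fin_dim by blast
  ultimately have "finite (f ` roots L)" using independent_span_bound[of B "f ` roots L"] by auto
  then show ?thesis using inj finite_imageD by blast
qed

text \<open>Elements of \<open>H\<close> commute, so splitting a joint eigenvector of
  \<open>B\<close> into eigenvectors of one more element \<open>a\<close> keeps the pieces
  eigenvectors for \<open>B\<close>.\<close>

lemma simultaneous_diagonalization:
  assumes "finite B" "B \<subseteq> H"
  shows "span {x. \<forall>h\<in>B. \<exists>c. br h x = sc c x} = UNIV"
  using assms
proof (induction B rule: finite_induct)
  case (insert a B)
  have aH: "a \<in> H" using insert by auto
  have "x \<in> span {x. \<forall>h\<in>insert a B. \<exists>c. br h x = sc c x}" if x: "\<forall>h\<in>B. \<exists>c. br h x = sc c x" for x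
  proof -
    let ?E = "\<lambda>c. {x. br a x = sc c x}"
    have E: "subspace (?E c)" for c
      by (auto simp: subspace_def br_add_right br_scale_right scale_right_distrib mult.commute)
    have "{x. \<exists>c. br a x = sc c x} = (\<Union>c\<in>UNIV. ?E c)" by auto
    then have "x \<in> span (\<Union>c\<in>UNIV. ?E c)" using H_diagonalizable[OF aH] by auto
    then obtain F v where F: "finite F" "\<And>c. c \<in> F \<Longrightarrow> v c \<in> ?E c" "x = (\<Sum>c\<in>F. v c)"
      using E by (elim span_UN_subspaceE) auto
    have "v c \<in> {x. \<forall>h\<in>insert a B. \<exists>c. br h x = sc c x}" if c: "c \<in> F" for c
    proof -
      have "\<exists>d. br h (v c) = sc d (v c)" if h: "h \<in> B" for h
      proof -
        obtain d where d: "br h x = sc d x" using x h by auto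
        \<comment> \<open>\<open>?w c\<close> measures the failure of \<open>v c\<close> to be an
          eigenvector of \<open>h\<close>. It lies in the same eigenspace of \<open>a\<close> as
          \<open>v c\<close>, and these failures add up to zero.\<close>
        let ?w = "\<lambda>c. br h (v c) - sc d (v c)"
        have brsum: "br h (\<Sum>c\<in>G. v c) = (\<Sum>c\<in>G. br h (v c))" for G
          by (induction G rule: infinite_finite_induct) (auto simp: br_add_right)
        have "sum ?w F = br h x - sc d x"
          unfolding F(3) brsum by (simp add: sum_subtractf scale_sum_right)
        then have s: "sum ?w F = 0" using d by simp
        have "?w c = 0"
        proof (rule joint_eigenvectors_sum_eq_0[where I = "{a}" and T = br and e = "\<lambda>c _. c",
              OF F(1) subspace_UNIV _ _ _ _ _ s c])
          show "br i (?w j) = sc j (?w j)" if "i \<in> {a}" "j \<in> F" for i j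
          proof -
            have "br a (br h (v j)) = br h (br a (v j))"
              using jacobi_right[of a h "v j"] H_abelian[OF aH, of h] h insert by auto
            then show ?thesis using that F(2)[OF that(2)]
              by (simp add: br_diff_right br_scale_right scale_right_diff_distrib mult.commute)
          qed
        qed (auto simp: br_add_right br_scale_right)
        then show ?thesis by auto
      qed
      then show ?thesis using F(2)[OF c] by auto
    qed
    then show ?thesis unfolding F(3) by (intro span_sum) (auto intro: span_base)
  qed
  then have "{x. \<forall>h\<in>B. \<exists>c. br h x = sc c x} \<subseteq> span {x. \<forall>h\<in>insert a B. \<exists>c. br h x = sc c x}" by auto
  then have "span {x. \<forall>h\<in>B. \<exists>c. br h x = sc c x} \<subseteq> span {x. \<forall>h\<in>insert a B. \<exists>c. br h x = sc c x}"
    by (rule span_minimal) auto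
  then show ?case using insert by auto
qed auto

lemma root_decomposition: "span (H \<union> (\<Union>\<alpha>\<in>roots L. root_space L \<alpha>)) = UNIV"
proof -
  obtain B where B: "B \<subseteq> H" "independent B" "H \<subseteq> span B" using maximal_independent_subset[of H] by blast
  obtain C where "finite C" "span C = UNIV" using fin_dim by blast
  then have "finite B" using independent_span_bound[of C B] B by auto
  have "x \<in> H \<union> (\<Union>\<alpha>\<in>roots L. root_space L \<alpha>)" if x: "\<forall>h\<in>B. \<exists>c. br h x = sc c x" for x
  proof (cases "x = 0")
    case True
    then show ?thesis using subspace_0[OF subspace_H] by auto
  next
    case False
    have "\<exists>c. br h x = sc c x" if "h \<in> H" for h
    proof -
      have "h \<in> span B" using that B by auto
      then show ?thesis
      proof (induction rule: span_induct_alt)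
        case base
        show ?case by (rule exI[of _ 0]) simp
      next
        case (step c y z)
        obtain c1 where "br y x = sc c1 x" using x step by blast
        moreover obtain c2 where "br z x = sc c2 x" using step by blast
        ultimately have "br (sc c y + z) x = sc (c * c1 + c2) x"
          by (simp add: br_add_left br_scale_left scale_left_distrib)
        then show ?case by blast
      qed
    qed
    then obtain c where c: "\<And>h. h \<in> H \<Longrightarrow> br h x = sc (c h) x" by metis
    \<comment> \<open>The eigenvalue depends linearly on \<open>h\<close> because \<open>x\<close>
      is nonzero; extension by 0 puts it into \<open>Hdual L\<close>.\<close>
    define \<alpha> where "\<alpha> h = (if h \<in> H then c h else 0)" for h
    have "c (h + h') = c h + c h'" if "h \<in> H" "h' \<in> H" for h h'
    proof -
      have "sc (c (h + h')) x = sc (c h + c h') x"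
        using c[of h] c[of h'] c[of "h + h'"] that subspace_add[OF subspace_H]
        by (simp add: br_add_left scale_left_distrib)
      then show ?thesis using False by (simp only: scale_cancel_right) simp
    qed
    moreover have "c (sc a h) = a * c h" if "h \<in> H" for a h
    proof -
      have "sc (c (sc a h)) x = sc (a * c h) x"
        using c[OF that] c[of "sc a h"] that subspace_scale[OF subspace_H]
        by (simp only: br_scale_left scale_scale)
      then show ?thesis using False by (auto simp only: scale_cancel_right)
    qed
    ultimately have \<alpha>: "\<alpha> \<in> Hdual L"
      using subspace_add[OF subspace_H] subspace_scale[OF subspace_H]
      by (auto simp: dual_space_def \<alpha>_def)
    have x\<alpha>: "x \<in> root_space L \<alpha>" using c by (auto simp: root_space_def \<alpha>_def)
    show ?thesis
    proof (cases "\<alpha> = 0")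
      case True
      then show ?thesis using x\<alpha> root_space_0 by auto
    qed (use rootI[OF \<alpha> _ x\<alpha> False] x\<alpha> in auto)
  qed
  then have "span {x. \<forall>h\<in>B. \<exists>c. br h x = sc c x} \<subseteq> span (H \<union> (\<Union>\<alpha>\<in>roots L. root_space L \<alpha>))"
    by (intro span_mono) auto
  then show ?thesis using simultaneous_diagonalization[OF \<open>finite B\<close> B(1)] by auto
qed

section \<open>Roots and coroots\<close>

text \<open>The center is an ideal, and it is not everything because some bracket is
  nonzero.\<close>

lemma center_trivial:
  assumes "\<And>x. br z x = 0" shows "z = 0"
proof -
  have "lie_ideal sc br {z. \<forall>x. br z x = 0}"
    unfolding lie_ideal_def subspace_def
    by (auto simp: br_add_left br_scale_left) (metis br_anti br_zero(2) neg_equal_0_iff_equal)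
  then have "{z. \<forall>x. br z x = 0} = {0} \<or> {z. \<forall>x. br z x = 0} = UNIV" by (rule simple)
  then show ?thesis using non_abelian assms by auto
qed

text \<open>Such an \<open>h\<close> commutes with \<open>H\<close> and with every root space, hence
  is central.\<close>

lemma H_annihilated_by_roots:
  assumes "h \<in> H" "\<And>\<alpha>. \<alpha> \<in> roots L \<Longrightarrow> \<alpha> h = 0" shows "h = 0"
proof (rule center_trivial)
  fix x
  have "x \<in> span (H \<union> (\<Union>\<alpha>\<in>roots L. root_space L \<alpha>))" using root_decomposition by auto
  then show "br h x = 0"
    by (induction rule: span_induct_alt)
      (use assms H_abelian root_spaceD[OF _ assms(1)] in \<open>auto simp: br_add_right br_scale_right\<close>)
qed

lemma lie_ideal_span:
  assumes A: "span A = UNIV" and gen: "\<And>x y. x \<in> A \<Longrightarrow> y \<in> X \<Longrightarrow> br x y \<in> span X"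
  shows "lie_ideal sc br (span X)"
proof -
  have *: "br x y \<in> span X" if y: "y \<in> X" for x y
  proof -
    have "x \<in> span A" using A by auto
    then show ?thesis
      by (induction rule: span_induct_alt)
        (use gen y in \<open>auto simp: br_add_left br_scale_left span_zero intro!: span_add span_scale\<close>)
  qed
  have "br x y \<in> span X" if "y \<in> span X" for x y
    using that by (induction rule: span_induct_alt)
      (auto simp: br_add_right br_scale_right span_zero * intro!: span_add span_scale)
  then show ?thesis by (auto simp: lie_ideal_def)
qed

text \<open>The root spaces of \<open>S\<close> together with their brackets in \<open>H\<close> span an ideal.\<close>

lemma closed_root_subset_trivial:
  assumes "S \<subseteq> roots L"
    and clos: "\<And>\<alpha> \<beta> x y. \<alpha> \<in> roots L \<Longrightarrow> \<beta> \<in> S \<Longrightarrow> \<alpha> + \<beta> \<noteq> 0 \<Longrightarrow> x \<in> root_space L \<alpha> \<Longrightarrow>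
      y \<in> root_space L \<beta> \<Longrightarrow> br x y \<noteq> 0 \<Longrightarrow> \<alpha> + \<beta> \<in> S"
    and orth: "\<And>\<alpha> \<beta> x y. \<alpha> \<in> roots L - S \<Longrightarrow> \<beta> \<in> S \<Longrightarrow> x \<in> root_space L \<beta> \<Longrightarrow>
      y \<in> root_space L (- \<beta>) \<Longrightarrow> \<alpha> (br x y) = 0"
    and "S \<noteq> {}"
  shows "S = roots L" and "H = span {br x y | x y. \<exists>\<beta>\<in>S. x \<in> root_space L \<beta> \<and> y \<in> root_space L (- \<beta>)}"
proof -
  let ?B = "{br x y | x y. \<exists>\<beta>\<in>S. x \<in> root_space L \<beta> \<and> y \<in> root_space L (- \<beta>)}"
  let ?G = "\<Union>\<beta>\<in>S. root_space L \<beta>"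
  let ?I = "span (?G \<union> ?B)"
  have BH: "?B \<subseteq> H" using br_root_space root_space_0 by fastforce
  have GI: "z \<in> ?I" if "z \<in> root_space L \<beta>" "\<beta> \<in> S" for z \<beta> using that by (auto intro: span_base)
  have BI: "z \<in> ?I" if "z \<in> ?B" for z using that by (auto intro: span_base)
  have gen: "br x y \<in> ?I" if x: "x \<in> H \<union> (\<Union>\<alpha>\<in>roots L. root_space L \<alpha>)" and y: "y \<in> ?G \<union> ?B" for x y
  proof (cases "x \<in> H")
    case True
    show ?thesis
    proof (cases "y \<in> ?B")
      case True
      then show ?thesis using H_abelian[OF \<open>x \<in> H\<close>] BH span_zero by (metis (lifting) subsetD)
    next
      case False
      then obtain \<beta> where "\<beta> \<in> S" "y \<in> root_space L \<beta>" using y by auto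
      then show ?thesis using root_spaceD[OF _ True] by (auto intro!: span_scale intro: GI)
    qed
  next
    case False
    then obtain \<alpha> where \<alpha>: "\<alpha> \<in> roots L" "x \<in> root_space L \<alpha>" using x by auto
    show ?thesis
    proof (cases "y \<in> ?B")
      case True
      then have "br x y = sc (- \<alpha> y) x" using BH root_spaceD'[OF \<alpha>(2)] by auto
      moreover have "\<alpha> y = 0" if "\<alpha> \<notin> S" using orth that \<alpha> True by blast
      ultimately show ?thesis using GI[OF \<alpha>(2)] by (cases "\<alpha> \<in> S") (auto intro!: span_neg span_scale span_zero)
    next
      case False
      then obtain \<beta> where \<beta>: "\<beta> \<in> S" "y \<in> root_space L \<beta>" using y by auto
      show ?thesis
      proof (cases "\<alpha> + \<beta> = 0")
        case True
        then have "\<alpha> = - \<beta>" by (simp add: add_eq_0_iff2)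
        then have "br y x \<in> ?B" using \<alpha>(2) \<beta> by auto
        then show ?thesis unfolding br_anti[of x y] by (intro span_neg BI)
      next
        case False
        show ?thesis
        proof (cases "br x y = 0")
          case True
          then show ?thesis by (simp add: span_zero)
        next
          case F: False
          then show ?thesis using clos[OF \<alpha>(1) \<beta>(1) False \<alpha>(2) \<beta>(2)] br_root_space[OF \<alpha>(2) \<beta>(2)] GI by blast
        qed
      qed
    qed
  qed
  have "lie_ideal sc br ?I" by (rule lie_ideal_span[OF root_decomposition gen])
  moreover have "?I \<noteq> {0}"
  proof -
    obtain \<beta> where "\<beta> \<in> S" using \<open>S \<noteq> {}\<close> by auto
    moreover then obtain x where "x \<in> root_space L \<beta>" "x \<noteq> 0" using assms(1) rootE by blast
    ultimately show ?thesis using GI by auto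
  qed
  ultimately have I: "?I = UNIV" using simple by blast
  have UnE: "\<exists>a b. z = a + b \<and> a \<in> span ?G \<and> b \<in> span ?B" for z
  proof -
    have "z \<in> ?I" using I by auto
    then show ?thesis unfolding span_Un by auto
  qed
  have spanBH: "span ?B \<subseteq> H" by (rule span_minimal[OF BH subspace_H])
  show "S = roots L"
  proof (rule ccontr)
    assume "S \<noteq> roots L"
    then obtain \<alpha> where \<alpha>: "\<alpha> \<in> roots L" "\<alpha> \<notin> S" using assms(1) by auto
    obtain x where x: "x \<in> root_space L \<alpha>" "x \<noteq> 0" using \<alpha> rootE by auto
    \<comment> \<open>The brackets lie in \<open>H\<close>, the root space of 0, so a root outside
      \<open>S\<close> would have its root vectors in the span of root spaces of other
      functionals.\<close>
    have "?I \<subseteq> span (\<Union>\<beta>\<in>insert 0 S. root_space L \<beta>)"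
      by (rule span_mono) (use BH root_space_0 in auto)
    then have "x \<in> span (\<Union>\<beta>\<in>insert 0 S. root_space L \<beta>)" using I by blast
    then have "x = 0"
      by (rule root_space_Int_span[rotated 4]) (use \<alpha> x assms(1) rootsD Hdual_0 in auto)
    then show False using x by simp
  qed
  show "H = span ?B"
  proof
    show "H \<subseteq> span ?B"
    proof
      fix h assume h: "h \<in> H"
      obtain a b where ab: "h = a + b" "a \<in> span ?G" "b \<in> span ?B" using UnE by blast
      \<comment> \<open>The component along the root spaces of \<open>S\<close> then lies in
        \<open>H\<close> as well, and the two meet only in 0.\<close>
      have "h - b \<in> H" using subspace_diff[OF subspace_H h] ab(3) spanBH by blast
      then have "a \<in> root_space L 0" using ab(1) root_space_0 by simp
      then have "a = 0"
        by (rule root_space_Int_span[rotated 3]) (use ab assms(1) rootsD Hdual_0 in auto)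
      then show "h \<in> span ?B" using ab by simp
    qed
  qed (rule spanBH)
qed

lemma roots_nonempty: "roots L \<noteq> {}"
proof
  assume "roots L = {}"
  then have "span H = UNIV" using root_decomposition by simp
  then have "H = UNIV" using subspace_H by (metis span_eq_iff)
  then show False using non_abelian H_abelian by auto
qed

subsection \<open>Strings\<close>

lemma ad_pow_root_space:
  assumes "x \<in> root_space L \<alpha>" "v \<in> root_space L \<beta>"
  shows "(br x ^^ j) v \<in> root_space L (\<beta> + fscale (of_nat j) \<alpha>)"
proof (induction j)
  case 0
  have "\<beta> + fscale (of_nat 0) \<alpha> = \<beta>" by (auto simp: fun_eq_iff)
  then show ?case using assms by simp
next
  case (Suc j)
  have eq: "\<alpha> + (\<beta> + fscale (of_nat j) \<alpha>) = \<beta> + fscale (of_nat (Suc j)) \<alpha>"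
    by (auto simp: fun_eq_iff algebra_simps)
  show ?case using br_root_space[OF assms(1) Suc] unfolding eq by (simp only: funpow.simps o_apply)
qed

text \<open>An endless string would pass through infinitely many roots.\<close>

lemma string_top:
  assumes "x \<in> root_space L \<alpha>" "\<alpha> \<in> Hdual L" "\<alpha> \<noteq> 0" "v \<in> root_space L \<beta>" "\<beta> \<in> Hdual L" "v \<noteq> 0"
  obtains p where "(br x ^^ p) v \<noteq> 0" "br x ((br x ^^ p) v) = 0"
proof -
  have "\<exists>n. (br x ^^ n) v = 0"
  proof (rule ccontr)
    assume "\<nexists>n. (br x ^^ n) v = 0"
    \<comment> \<open>The string may pass through weight 0, where the vector lies in
      \<open>H\<close> and yields no root.\<close>
    then have "\<beta> + fscale (of_nat j) \<alpha> \<in> insert 0 (roots L)" for j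
      using rootI[OF _ _ ad_pow_root_space[OF assms(1,4)], of j] assms(2,5)
      by (auto intro: Hdual_add Hdual_scale)
    then have "range (\<lambda>j. \<beta> + fscale (of_nat j) \<alpha>) \<subseteq> insert 0 (roots L)" by auto
    then have "finite (range (\<lambda>j. \<beta> + fscale (of_nat j) \<alpha>))" using finite_roots finite_subset by blast
    moreover have "inj (\<lambda>j. \<beta> + fscale (of_nat j) \<alpha>)"
    proof (rule injI)
      fix i j :: nat assume a: "\<beta> + fscale (of_nat i) \<alpha> = \<beta> + fscale (of_nat j) \<alpha>"
      obtain z where "\<alpha> z \<noteq> 0" using assms(3) by (auto simp: fun_eq_iff)
      then show "i = j" using fun_cong[OF a, of z] by simp
    qed
    ultimately show False using finite_imageD by auto
  qed
  then obtain n where n: "(br x ^^ n) v = 0" "\<And>m. m < n \<Longrightarrow> (br x ^^ m) v \<noteq> 0"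
    using exists_least_iff[of "\<lambda>n. (br x ^^ n) v = 0"] by auto
  then obtain p where p: "n = Suc p" using assms(6) by (cases n) auto
  then show ?thesis using that[of p] n(1) n(2)[of p] by simp
qed

text \<open>Commuting \<open>x\<close> past the factors \<open>y\<close> leaves copies of
  \<open>br x y\<close>, which acts on step \<open>i\<close> of the string by its value under
  \<open>\<beta> - i \<alpha>\<close>; the coefficient is the sum of these values for
  \<open>i\<close> from 0 to \<open>j\<close>. The value of \<alpha> at \<open>br x y\<close> stays
  general so that it may be 0.\<close>

lemma ad_pow_raise:
  assumes x: "x \<in> root_space L \<alpha>" and y: "y \<in> root_space L (- \<alpha>)" and u: "u \<in> root_space L \<beta>"
    and "br x u = 0"
  shows "br x ((br y ^^ Suc j) u) =
    sc (of_nat (Suc j) * \<beta> (br x y) - of_nat j * of_nat (Suc j) / 2 * \<alpha> (br x y)) ((br y ^^ j) u)"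
proof -
  have h: "br x y \<in> H" using br_root_space[OF x y] root_space_0 by simp
  show ?thesis
  proof (induction j)
    case 0
    have "br x (br y u) = br (br x y) u" using jacobi_right[of x y u] assms(4) by simp
    then show ?case using root_spaceD[OF u h] by simp
  next
    case (Suc j)
    let ?w = "(br y ^^ Suc j) u"
    have "br x (br y ?w) = br (br x y) ?w + br y (br x ?w)" by (rule jacobi_right)
    also have "br (br x y) ?w = sc (\<beta> (br x y) - of_nat (Suc j) * \<alpha> (br x y)) ?w"
      using root_spaceD[OF ad_pow_root_space[OF y u] h, of "Suc j"] by simp
    also have "br y (br x ?w) = sc (of_nat (Suc j) * \<beta> (br x y) - of_nat j * of_nat (Suc j) / 2 * \<alpha> (br x y)) ?w"
      unfolding Suc by (simp add: br_scale_right)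
    finally have "br x (br y ?w) = sc (\<beta> (br x y) - of_nat (Suc j) * \<alpha> (br x y) +
        (of_nat (Suc j) * \<beta> (br x y) - of_nat j * of_nat (Suc j) / 2 * \<alpha> (br x y))) ?w"
      by (simp only: scale_left_distrib)
    moreover have "\<beta> (br x y) - of_nat (Suc j) * \<alpha> (br x y) +
        (of_nat (Suc j) * \<beta> (br x y) - of_nat j * of_nat (Suc j) / 2 * \<alpha> (br x y)) =
      of_nat (Suc (Suc j)) * \<beta> (br x y) - of_nat (Suc j) * of_nat (Suc (Suc j)) / 2 * \<alpha> (br x y)"
      by (simp add: field_simps)
    ultimately show ?case by (simp only: funpow.simps o_apply)
  qed
qed

text \<open>This covers both the \<open>sl\<^sub>2\<close> case \<open>\<alpha> [x, y] = 2\<close> and the Heisenberg case \<open>\<alpha> [x, y] = 0\<close>.\<close>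

lemma string_length:
  assumes x: "x \<in> root_space L \<alpha>" and y: "y \<in> root_space L (- \<alpha>)" and \<alpha>: "\<alpha> \<in> Hdual L" "\<alpha> \<noteq> 0"
    and u: "u \<in> root_space L \<beta>" "\<beta> \<in> Hdual L" "u \<noteq> 0" "br x u = 0"
  obtains q where "\<beta> (br x y) = of_nat q / 2 * \<alpha> (br x y)" "(br y ^^ q) u \<noteq> 0" "(br y ^^ Suc q) u = 0"
proof -
  obtain q where q: "(br y ^^ q) u \<noteq> 0" "br y ((br y ^^ q) u) = 0"
    using string_top[OF y _ _ u(1,2,3)] \<alpha> Hdual_uminus by auto
  \<comment> \<open>One step below the bottom the left side of \<open>ad_pow_raise\<close> vanishes
    while the vector on the right does not, so the coefficient is zero.\<close>
  have "sc (of_nat (Suc q) * \<beta> (br x y) - of_nat q * of_nat (Suc q) / 2 * \<alpha> (br x y)) ((br y ^^ q) u) = 0"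
    using ad_pow_raise[OF x y u(1,4), of q] q(2) by simp
  then have "of_nat (Suc q) * \<beta> (br x y) - of_nat q * of_nat (Suc q) / 2 * \<alpha> (br x y) = 0" using q by simp
  then have "of_nat (Suc q) * (\<beta> (br x y) - of_nat q / 2 * \<alpha> (br x y)) = 0" by (simp add: algebra_simps)
  then have "\<beta> (br x y) = of_nat q / 2 * \<alpha> (br x y)"
    by (metis mult_eq_0_iff of_nat_neq_0 right_minus_eq)
  then show ?thesis by (rule that) (use q in simp_all)
qed

lemma string_nonzero:
  assumes "(br y ^^ q) u \<noteq> 0" "j \<le> q" shows "(br y ^^ j) u \<noteq> 0"
proof
  assume a: "(br y ^^ j) u = 0"
  have "(br y ^^ n) 0 = 0" for n by (induction n) auto
  then have "(br y ^^ (q - j + j)) u = 0" unfolding funpow_add using a by simp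
  then show False using assms by simp
qed

text \<open>If \<alpha> vanishes at \<open>br x y\<close>, all members of an \<alpha>-string take
  the same value there, and \<open>string_length\<close> makes it 0. So every root kills
  \<open>br x y\<close>.\<close>

lemma br_opposite_eq_0:
  assumes x: "x \<in> root_space L \<alpha>" and y: "y \<in> root_space L (- \<alpha>)" and \<alpha>: "\<alpha> \<in> Hdual L" "\<alpha> \<noteq> 0"
    and 0: "\<alpha> (br x y) = 0"
  shows "br x y = 0"
proof (rule H_annihilated_by_roots)
  show "br x y \<in> H" using br_root_space[OF x y] root_space_0 by simp
  fix \<beta> assume \<beta>: "\<beta> \<in> roots L"
  then obtain v where v: "v \<in> root_space L \<beta>" "v \<noteq> 0" by (elim rootE)
  obtain p where p: "(br x ^^ p) v \<noteq> 0" "br x ((br x ^^ p) v) = 0"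
    using string_top[OF x \<alpha> v(1) _ v(2)] \<beta> rootsD by auto
  obtain q where "(\<beta> + fscale (of_nat p) \<alpha>) (br x y) = of_nat q / 2 * \<alpha> (br x y)"
    using string_length[OF x y \<alpha> ad_pow_root_space[OF x v(1)] _ p] \<beta> rootsD \<alpha> Hdual_add Hdual_scale by metis
  then show "\<beta> (br x y) = 0" using 0 by simp
qed

text \<open>The third member of the triple is not stored: it is \<open>br x y\<close>, which will
  turn out to be the coroot.\<close>

definition sl2_triple :: "('g \<Rightarrow> complex) \<Rightarrow> 'g \<Rightarrow> 'g \<Rightarrow> bool" where
  "sl2_triple \<alpha> x y \<longleftrightarrow> \<alpha> \<in> Hdual L \<and> x \<in> root_space L \<alpha> \<and> y \<in> root_space L (- \<alpha>) \<and> \<alpha> (br x y) = 2"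

lemma sl2_tripleD:
  assumes "sl2_triple \<alpha> x y"
  shows "\<alpha> \<in> Hdual L" "x \<in> root_space L \<alpha>" "y \<in> root_space L (- \<alpha>)" "\<alpha> (br x y) = 2" "br x y \<in> H" "\<alpha> \<noteq> 0"
    "x \<noteq> 0" "y \<noteq> 0" "\<alpha> \<in> roots L"
proof -
  show *: "\<alpha> \<in> Hdual L" "x \<in> root_space L \<alpha>" "y \<in> root_space L (- \<alpha>)" "\<alpha> (br x y) = 2"
    using assms by (auto simp: sl2_triple_def)
  then show "br x y \<in> H" "\<alpha> \<noteq> 0" using br_root_space[of x \<alpha> y "- \<alpha>"] root_space_0 by auto
  show "x \<noteq> 0" "y \<noteq> 0" using * Hdual_zero_apply by fastforce+
  then show "\<alpha> \<in> roots L" using rootI * \<open>\<alpha> \<noteq> 0\<close> by blast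
qed

lemma sl2_triple_exists:
  assumes "\<alpha> \<in> Hdual L" "\<alpha> \<noteq> 0" "x \<in> root_space L \<alpha>" "y \<in> root_space L (- \<alpha>)" "br x y \<noteq> 0"
  obtains c where "sl2_triple \<alpha> x (sc c y)" "c \<noteq> 0"
proof -
  have "\<alpha> (br x y) \<noteq> 0" using br_opposite_eq_0[OF assms(3,4,1,2)] assms(5) by auto
  moreover have "br x y \<in> H" using br_root_space[OF assms(3,4)] root_space_0 by simp
  ultimately have "sl2_triple \<alpha> x (sc (2 / \<alpha> (br x y)) y)"
    using assms subspace_scale[OF subspace_root_space] by (auto simp: sl2_triple_def br_scale_right Hdual_scale_apply)
  then show ?thesis using that \<open>\<alpha> (br x y) \<noteq> 0\<close> by force
qed

lemma sl2_triple_swap: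
  assumes "sl2_triple \<alpha> x y" shows "sl2_triple (- \<alpha>) y x"
  using sl2_tripleD[OF assms] br_anti[of y x] Hdual_uminus_apply[of \<alpha> "br x y"]
  by (auto simp: sl2_triple_def Hdual_uminus)

text \<open>\<open>p\<close> counts the steps up to the top of the string, and \<open>q\<close> the
  steps from there to the bottom. The top has value \<open>q\<close> at \<open>br x y\<close>, and
  each upward step has added 2.\<close>

lemma root_string:
  assumes t: "sl2_triple \<alpha> x y" and v: "v \<in> root_space L \<beta>" "v \<noteq> 0" and \<beta>: "\<beta> \<in> Hdual L"
  obtains p q where "\<beta> (br x y) = of_nat q - 2 * of_nat p"
    "\<And>j. j \<le> q \<Longrightarrow> \<exists>w. w \<in> root_space L (\<beta> + fscale (of_nat p) \<alpha> - fscale (of_nat j) \<alpha>) \<and> w \<noteq> 0"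
proof -
  note t = sl2_tripleD[OF t]
  obtain p where p: "(br x ^^ p) v \<noteq> 0" "br x ((br x ^^ p) v) = 0"
    using string_top[OF t(2,1,6) v(1) \<beta> v(2)] by auto
  note u = ad_pow_root_space[OF t(2) v(1), of p]
  obtain q where q: "(\<beta> + fscale (of_nat p) \<alpha>) (br x y) = of_nat q / 2 * \<alpha> (br x y)"
    "(br y ^^ q) ((br x ^^ p) v) \<noteq> 0"
    using string_length[OF t(2,3,1,6) u _ p] \<beta> t Hdual_add Hdual_scale by metis
  have "\<exists>w. w \<in> root_space L (\<beta> + fscale (of_nat p) \<alpha> - fscale (of_nat j) \<alpha>) \<and> w \<noteq> 0" if "j \<le> q" for j
  proof -
    have "\<beta> + fscale (of_nat p) \<alpha> + fscale (of_nat j) (- \<alpha>) = \<beta> + fscale (of_nat p) \<alpha> - fscale (of_nat j) \<alpha>"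
      by (auto simp: fun_eq_iff)
    then show ?thesis using ad_pow_root_space[OF t(3) u, of j] string_nonzero[OF q(2) that] by metis
  qed
  moreover have "\<beta> (br x y) = of_nat q - 2 * of_nat p" using q t by (simp add: algebra_simps)
  ultimately show ?thesis using that by blast
qed

lemma root_pairing_int:
  assumes "sl2_triple \<alpha> x y" "\<beta> \<in> roots L"
  obtains n :: int where "\<beta> (br x y) = of_int n"
proof -
  obtain v where "v \<in> root_space L \<beta>" "v \<noteq> 0" using assms rootE by blast
  then obtain p q where "\<beta> (br x y) = of_nat q - 2 * of_nat p"
    using root_string[OF assms(1)] assms rootsD by metis
  then have "\<beta> (br x y) = of_int (int q - 2 * int p)" by simp
  then show ?thesis using that by blast
qed

lemma reflected_root_aux:
  assumes "sl2_triple \<alpha> x y" "\<beta> \<in> roots L" and n: "\<beta> (br x y) = of_nat n"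
  shows "\<beta> - fscale (\<beta> (br x y)) \<alpha> \<in> roots L"
proof -
  obtain v where "v \<in> root_space L \<beta>" "v \<noteq> 0" using assms rootE by blast
  then obtain p q where q: "\<beta> (br x y) = of_nat q - 2 * of_nat p"
    "\<And>j. j \<le> q \<Longrightarrow> \<exists>w. w \<in> root_space L (\<beta> + fscale (of_nat p) \<alpha> - fscale (of_nat j) \<alpha>) \<and> w \<noteq> 0"
    using root_string[OF assms(1)] assms rootsD by metis
  have "(of_nat q :: complex) = of_nat (n + 2 * p)" using q n by simp
  then have "q = n + 2 * p" by (simp only: of_nat_eq_iff)
  \<comment> \<open>The reflected weight \<open>\<beta> - n \<alpha>\<close> is \<open>n + p\<close>
    steps below the top, which is within the length \<open>n + 2 p\<close> of the string.\<close>
  then obtain w where w: "w \<in> root_space L (\<beta> + fscale (of_nat p) \<alpha> - fscale (of_nat (n + p)) \<alpha>)" "w \<noteq> 0"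
    using q(2)[of "n + p"] by auto
  have eq: "\<beta> + fscale (of_nat p) \<alpha> - fscale (of_nat (n + p)) \<alpha> = \<beta> - fscale (\<beta> (br x y)) \<alpha>"
    using n by (auto simp: fun_eq_iff algebra_simps)
  have w': "w \<in> root_space L (\<beta> - fscale (\<beta> (br x y)) \<alpha>)" using w(1) unfolding eq .
  note t = sl2_tripleD[OF assms(1)]
  have "\<beta> - fscale (\<beta> (br x y)) \<alpha> \<noteq> 0"
  proof
    assume a: "\<beta> - fscale (\<beta> (br x y)) \<alpha> = 0"
    have "\<beta> (br x y) - \<beta> (br x y) * 2 = 0" using fun_cong[OF a, of "br x y"] t by simp
    then have "\<beta> (br x y) = 0" by simp
    then have "\<beta> = 0" using a by (simp add: fun_eq_iff)
    then show False using assms rootsD by blast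
  qed
  then show ?thesis
    using rootI[OF _ _ w' w(2)] assms(2) t rootsD by (auto intro!: Hdual_diff Hdual_scale)
qed

text \<open>A negative pairing becomes positive for the swapped triple, which defines the same
  reflection.\<close>

lemma reflected_root:
  assumes t: "sl2_triple \<alpha> x y" "\<beta> \<in> roots L"
  shows "\<beta> - fscale (\<beta> (br x y)) \<alpha> \<in> roots L"
proof -
  obtain n where n: "\<beta> (br x y) = of_int n" using root_pairing_int[OF t] .
  show ?thesis
  proof (cases "n \<ge> 0")
    case True
    then have "\<beta> (br x y) = of_nat (nat n)" using n by simp
    then show ?thesis using reflected_root_aux t by blast
  next
    case False
    have "br x y \<in> H" using sl2_tripleD[OF t(1)] by simp
    then have *: "\<beta> (br y x) = - \<beta> (br x y)" using br_anti[of y x] Hdual_uminus_apply rootsD(1)[OF t(2)] by simp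
    then have "\<beta> (br y x) = of_nat (nat (- n))" using n False by simp
    then have "\<beta> - fscale (\<beta> (br y x)) (- \<alpha>) \<in> roots L" using reflected_root_aux sl2_triple_swap t by blast
    moreover have "\<beta> - fscale (\<beta> (br y x)) (- \<alpha>) = \<beta> - fscale (\<beta> (br x y)) \<alpha>" using * by (auto simp: fun_eq_iff)
    ultimately show ?thesis by simp
  qed
qed

text \<open>The functional sending \<open>w\<close> to \<open>\<alpha> (br w y)\<close> is injective
  on the root space: a nonzero \<open>w\<close> in its kernel has \<open>br y w = 0\<close> and
  would be the top of a string for the swapped triple, of length -2.\<close>

lemma root_space_dim_1:
  assumes t: "sl2_triple \<alpha> x y" and z: "z \<in> root_space L \<alpha>"
  obtains c where "z = sc c x"
proof -
  note t = sl2_tripleD[OF t]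
  have inj: "w = 0" if w: "w \<in> root_space L \<alpha>" and 0: "\<alpha> (br w y) = 0" for w
  proof (rule ccontr)
    assume "w \<noteq> 0"
    have "br w y = 0" using br_opposite_eq_0[OF w t(3,1,6) 0] .
    then have "br y w = 0" using br_anti[of w y] by simp
    then obtain q where q: "\<alpha> (br y x) = of_nat q / 2 * (- \<alpha>) (br y x)"
      using string_length[of y "- \<alpha>" x w \<alpha>] t w \<open>w \<noteq> 0\<close> Hdual_uminus by auto
    have "\<alpha> (br y x) = - 2" using br_anti[of y x] Hdual_uminus_apply[of \<alpha> "br x y"] t by simp
    moreover from this have "of_nat q / 2 * (- \<alpha>) (br y x) = of_nat q" by simp
    ultimately have "(of_nat q :: complex) + 2 = 0" using q by algebra
    then have "(of_nat (q + 2) :: complex) = 0" by (simp only: of_nat_add of_nat_numeral)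
    then show False by (simp only: of_nat_eq_0_iff)
  qed
  define c where "c = \<alpha> (br z y) / 2"
  have "br z y \<in> H" using br_root_space[OF z t(3)] root_space_0 by simp
  then have "\<alpha> (br (z - sc c x) y) = 0"
    using t by (simp add: br_diff_left br_scale_left Hdual_diff_apply Hdual_scale_apply
      subspace_scale[OF subspace_H] c_def)
  then have "z - sc c x = 0"
    using inj[of "z - sc c x"] z t subspace_root_space subspace_diff subspace_scale by blast
  then show ?thesis using that[of c] by simp
qed

text \<open>The string going down from such a multiple would pass through the root space of
  \<alpha>, which is spanned by \<open>x\<close>. Since \<open>br x x = 0\<close>, applying
  \<open>x\<close> at that point gives zero, whereas the coefficient in \<open>ad_pow_raise\<close>
  is nonzero there.\<close>

lemma root_multiple:
  assumes "sl2_triple \<alpha> x y" "n \<ge> 2" shows "fscale (of_nat n) \<alpha> \<notin> roots L"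
proof
  assume r: "fscale (of_nat n) \<alpha> \<in> roots L"
  note t = sl2_tripleD[OF assms(1)]
  obtain v where v: "v \<in> root_space L (fscale (of_nat n) \<alpha>)" "v \<noteq> 0" using r rootE by blast
  obtain p where p: "(br x ^^ p) v \<noteq> 0" "br x ((br x ^^ p) v) = 0"
    using string_top[OF t(2,1,6) v(1) _ v(2)] r rootsD by auto
  define u where "u = (br x ^^ p) v"
  define \<beta> where "\<beta> = fscale (of_nat n) \<alpha> + fscale (of_nat p) \<alpha>"
  have u: "u \<in> root_space L \<beta>" "\<beta> \<in> Hdual L" "u \<noteq> 0" "br x u = 0"
    using ad_pow_root_space[OF t(2) v(1)] p t by (auto simp: u_def \<beta>_def intro: Hdual_add Hdual_scale)
  obtain q where q: "\<beta> (br x y) = of_nat q / 2 * \<alpha> (br x y)" "(br y ^^ q) u \<noteq> 0"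
    using string_length[OF t(2,3,1,6) u] by auto
  have "(of_nat q :: complex) = of_nat (2 * (n + p))" using q t by (simp add: \<beta>_def algebra_simps)
  then have q2: "q = 2 * (n + p)" by (simp only: of_nat_eq_iff)
  \<comment> \<open>The top of the string has weight \<open>(n + p) \<alpha>\<close>, so
    \<open>Suc j = n + p - 1\<close> steps down lead to \<alpha>.\<close>
  define j where "j = n + p - 2"
  have j: "n + p = j + 2" using assms by (simp add: j_def)
  have "\<beta> + fscale (of_nat (Suc j)) (- \<alpha>) = \<alpha>"
  proof
    fix z
    have "(of_nat n :: complex) + of_nat p = of_nat j + 2" using j by (metis of_nat_add of_nat_numeral)
    then have "(of_nat n + of_nat p) * \<alpha> z = (of_nat j + 2) * \<alpha> z" by simp
    then show "(\<beta> + fscale (of_nat (Suc j)) (- \<alpha>)) z = \<alpha> z" by (simp add: \<beta>_def algebra_simps)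
  qed
  then have "(br y ^^ Suc j) u \<in> root_space L \<alpha>" using ad_pow_root_space[OF t(3) u(1), of "Suc j"] by simp
  then obtain c where "(br y ^^ Suc j) u = sc c x" using root_space_dim_1[OF assms(1)] by blast
  then have "br x ((br y ^^ Suc j) u) = 0" by (simp add: br_scale_right br_alternating)
  then have "sc (of_nat (Suc j) * \<beta> (br x y) - of_nat j * of_nat (Suc j) / 2 * \<alpha> (br x y)) ((br y ^^ j) u) = 0"
    using ad_pow_raise[OF t(2,3) u(1,4), of j] by simp
  moreover have "(br y ^^ j) u \<noteq> 0" using string_nonzero[OF q(2)] q2 j by simp
  ultimately have "of_nat (Suc j) * \<beta> (br x y) - of_nat j * of_nat (Suc j) / 2 * \<alpha> (br x y) = 0" by simp
  then have "of_nat (Suc j) * (of_nat q :: complex) = of_nat j * of_nat (Suc j)" using q t by simp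
  then have "Suc j * q = j * Suc j" by (simp only: of_nat_eq_iff flip: of_nat_mult)
  then have "q = j" by (simp only: mult.commute[of j] mult_cancel1) simp
  then show False using q2 j by simp
qed

subsection \<open>Opposite root spaces\<close>

text \<open>A substitute for the Killing form on \<open>H\<close> that counts each root once. It is positive on coroots
  because roots take integer values there.\<close>

definition root_sum_form :: "'g \<Rightarrow> 'g \<Rightarrow> complex" where
  "root_sum_form h h' = (\<Sum>\<beta>\<in>roots L. \<beta> h * \<beta> h')"

text \<open>The reflection in \<alpha> permutes the roots and negates their values at
  \<open>br x y\<close>; reindexing the sum by it gives the identity. It says that
  \<open>br x y\<close> represents a multiple of \<alpha> under the form.\<close>

lemma root_sum_form_sl2:
  assumes t: "sl2_triple \<alpha> x y" and h: "h \<in> H"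
  shows "2 * root_sum_form h (br x y) = \<alpha> h * root_sum_form (br x y) (br x y)"
proof -
  note t' = sl2_tripleD[OF t]
  define k where "k = br x y"
  define r where "r \<beta> = \<beta> - fscale (\<beta> k) \<alpha>" for \<beta> :: "'g \<Rightarrow> complex"
  have k: "k \<in> H" "\<alpha> k = 2" using t' by (auto simp: k_def)
  have rr: "r (r \<beta>) = \<beta>" for \<beta> using k by (auto simp: r_def fun_eq_iff)
  have rm: "r \<beta> \<in> roots L" if "\<beta> \<in> roots L" for \<beta>
    using reflected_root[OF t that] by (simp add: r_def k_def)
  have "root_sum_form h k = (\<Sum>\<beta>\<in>roots L. r \<beta> h * r \<beta> k)"
    unfolding root_sum_form_def by (rule sum.reindex_bij_witness[of _ r r]) (auto simp: rr rm)
  also have "\<dots> = (\<Sum>\<beta>\<in>roots L. \<alpha> h * (\<beta> k * \<beta> k) - \<beta> h * \<beta> k)"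
    by (rule sum.cong) (use k in \<open>auto simp: r_def algebra_simps\<close>)
  also have "\<dots> = \<alpha> h * root_sum_form k k - root_sum_form h k"
    by (simp add: root_sum_form_def sum_subtractf sum_distrib_left)
  finally show ?thesis by (simp add: k_def algebra_simps)
qed

text \<open>The summands are squares of integers, and \<alpha> itself contributes 4.\<close>

lemma root_sum_form_pos:
  assumes t: "sl2_triple \<alpha> x y"
  obtains r :: real where "r > 0" "root_sum_form (br x y) (br x y) = of_real r"
proof -
  note t' = sl2_tripleD[OF t]
  have "\<exists>n::int. \<beta> (br x y) = of_int n" if "\<beta> \<in> roots L" for \<beta> using root_pairing_int[OF t that] by metis
  then obtain n where n: "\<And>\<beta>. \<beta> \<in> roots L \<Longrightarrow> \<beta> (br x y) = of_int (n \<beta>)" by metis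
  define r :: real where "r = (\<Sum>\<beta>\<in>roots L. (of_int (n \<beta>))^2)"
  have "root_sum_form (br x y) (br x y) = of_real r"
    unfolding root_sum_form_def r_def of_real_sum
    by (rule sum.cong) (auto simp: n power2_eq_square)
  moreover have "r > 0"
    unfolding r_def
  proof (rule sum_pos2[OF finite_roots t'(9)])
    have "n \<alpha> \<noteq> 0" using n[OF t'(9)] t' by auto
    then show "0 < (of_int (n \<alpha>) :: real)^2" by simp
  qed auto
  ultimately show ?thesis using that by blast
qed

text \<open>The mutual pairings are the integers \<open>m = 2 c\<close> and
  \<open>n = 2 / c\<close>, so \<open>m n = 4\<close>. If |m| is 4 or 1, one root is twice the other
  up to sign, which \<open>root_multiple\<close> forbids; this leaves |m| = 2.\<close>

lemma proportional_root:
  assumes a: "sl2_triple \<alpha> x y" and b: "sl2_triple \<beta> x' y'" and c: "\<beta> = fscale c \<alpha>"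
  shows "\<beta> = \<alpha> \<or> \<beta> = - \<alpha>"
proof -
  note ta = sl2_tripleD[OF a] and tb = sl2_tripleD[OF b]
  have c0: "c \<noteq> 0" using tb c by (auto simp: fun_eq_iff)
  obtain m where "\<beta> (br x y) = of_int m" using root_pairing_int[OF a] tb by metis
  then have m: "2 * c = of_int m" using c ta by (simp add: mult.commute)
  obtain n where n0: "\<alpha> (br x' y') = of_int n" using root_pairing_int[OF b] ta by metis
  have n: "c * of_int n = 2" using tb(4) n0 c by simp
  have "of_int (m * n) = (of_int 4 :: complex)" using n by (simp add: m[symmetric])
  then have mn: "m * n = 4" by (simp only: of_int_eq_iff)
  then have "m dvd 4" by (metis dvd_triv_left)
  then have "\<bar>m\<bar> \<le> 4" by (auto dest: zdvd_imp_le simp: zdvd_imp_le)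
  then have "m = -4 \<or> m = -3 \<or> m = -2 \<or> m = -1 \<or> m = 0 \<or> m = 1 \<or> m = 2 \<or> m = 3 \<or> m = 4" by arith
  then have "m = 1 \<or> m = 2 \<or> m = 4 \<or> m = -1 \<or> m = -2 \<or> m = -4"
    using mn by (elim disjE; auto; presburger)
  then consider "m = 2" | "m = -2" | "m = 4" | "m = -4" | "m = 1" | "m = -1" by auto
  then show ?thesis
  proof cases
    case 1
    then have "c = 1" using m by simp
    then show ?thesis using c by (auto simp: fun_eq_iff)
  next
    case 2
    then have "2 * c = 2 * (- 1)" using m by simp
    then have "c = - 1" by (simp only: mult_cancel_left) simp
    then show ?thesis using c by (auto simp: fun_eq_iff)
  next
    case 3
    then have "\<beta> = fscale (of_nat 2) \<alpha>" using m c by simp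
    then show ?thesis using root_multiple[OF a, of 2] tb(9) by simp
  next
    case 4
    then have "2 * c = 2 * (- 2)" using m by simp
    then have "c = - 2" by (simp only: mult_cancel_left) simp
    then have "\<beta> = fscale (of_nat 2) (- \<alpha>)" using c by (auto simp: fun_eq_iff)
    then show ?thesis using root_multiple[OF sl2_triple_swap[OF a], of 2] tb(9) by simp
  next
    case 5
    then have "n = 4" using mn by simp
    then have "\<alpha> = fscale (of_nat 2) \<beta>" using m n c \<open>m = 1\<close> by (auto simp: fun_eq_iff)
    then show ?thesis using root_multiple[OF b, of 2] ta(9) by simp
  next
    case 6
    then have "2 * c = - 1" using m by simp
    then have "2 * (c * z) = - z" for z by (metis mult.assoc mult_minus1)
    then have "\<alpha> = fscale (of_nat 2) (- \<beta>)" using c by (auto simp: fun_eq_iff)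
    then show ?thesis using root_multiple[OF sl2_triple_swap[OF b], of 2] ta(9) by simp
  qed
qed

text \<open>The roots without an \<open>sl\<^sub>2\<close>-triple are closed in the sense of \<open>closed_root_subset_trivial\<close>; were
  there any, \<open>H\<close> would be spanned by zero brackets.\<close>

lemma root_sl2_triple:
  assumes "\<alpha> \<in> roots L"
  obtains x y where "sl2_triple \<alpha> x y"
proof -
  define S where "S = {\<alpha> \<in> roots L. \<forall>x\<in>root_space L \<alpha>. \<forall>y\<in>root_space L (- \<alpha>). br x y = 0}"
  have "S = {}"
  proof (rule ccontr)
    assume "S \<noteq> {}"
    have clos: "\<alpha> + \<beta> \<in> S" if a: "\<alpha> \<in> roots L" and b: "\<beta> \<in> S" and ab: "\<alpha> + \<beta> \<noteq> 0"
      and x: "x \<in> root_space L \<alpha>" and y: "y \<in> root_space L \<beta>" and xy: "br x y \<noteq> 0" for \<alpha> \<beta> x y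
    proof (rule ccontr)
      assume n: "\<alpha> + \<beta> \<notin> S"
      have bH: "\<beta> \<in> Hdual L" "\<beta> \<in> roots L" using b rootsD by (auto simp: S_def)
      have ab': "\<alpha> + \<beta> \<in> roots L" using rootI[OF _ ab br_root_space[OF x y] xy] Hdual_add a bH rootsD by auto
      then obtain z0 c where z0: "z0 \<in> root_space L (\<alpha> + \<beta>)" "c \<in> root_space L (- (\<alpha> + \<beta>))" "br z0 c \<noteq> 0"
        using n by (auto simp: S_def)
      obtain d where d: "sl2_triple (\<alpha> + \<beta>) z0 (sc d c)" "d \<noteq> 0"
        using sl2_triple_exists[OF rootsD(1)[OF ab'] ab z0] .
      obtain e where e: "br x y = sc e z0" using root_space_dim_1[OF d(1) br_root_space[OF x y]] .
      have "e \<noteq> 0" using e xy by auto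
      have "c \<in> root_space L (- \<alpha> - \<beta>)" using z0(2) by (simp add: algebra_simps)
      have "br x c \<in> root_space L (- \<beta>)" using br_root_space[OF x z0(2)] by simp
      then have "br y (br x c) = 0" using b y by (auto simp: S_def)
      \<comment> \<open>Since \<beta> lies in \<open>S\<close>, the Jacobi identity loses one term:
        up to scalars, the same element of \<open>H\<close> is a bracket of root vectors for
        \<alpha> + \<beta> and for \<alpha>.\<close>
      then have 1: "br (br x y) c = br x (br y c)" using jacobi_left[of x y c] by simp
      have yc: "br y c \<in> root_space L (- \<alpha>)" using br_root_space[OF y z0(2)] by simp
      have "br x (br y c) \<noteq> 0" using 1 e \<open>e \<noteq> 0\<close> z0(3) by (auto simp: br_scale_left)
      then obtain f where f: "sl2_triple \<alpha> x (sc f (br y c))" "f \<noteq> 0"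
        using sl2_triple_exists[OF rootsD(1)[OF a] rootsD(2)[OF a] x yc] by auto
      define h where "h = br x (sc f (br y c))"
      define k where "k = br z0 (sc d c)"
      have k0: "br z0 c = sc (1 / d) k" using d(2) by (simp add: k_def br_scale_right)
      have "h = sc f (sc e (br z0 c))"
        using 1 e by (simp add: h_def br_scale_right br_scale_left)
      then have hk: "h = sc (f * e / d) k" unfolding k0 by simp
      define g where "g = f * e / d"
      have "g \<noteq> 0" using f d \<open>e \<noteq> 0\<close> by (simp add: g_def)
      have kH: "k \<in> H" "h \<in> H" using sl2_tripleD(5)[OF d(1)] sl2_tripleD(5)[OF f(1)] by (auto simp: k_def h_def)
      have lin: "root_sum_form l h = g * root_sum_form l k" for l
        unfolding root_sum_form_def hk g_def[symmetric] sum_distrib_left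
        by (rule sum.cong) (use kH rootsD in \<open>auto simp: Hdual_scale_apply\<close>)
      obtain r where r: "r > 0" "root_sum_form h h = of_real r" using root_sum_form_pos[OF f(1)] h_def by auto
      obtain s where s: "s > 0" "root_sum_form k k = of_real s" using root_sum_form_pos[OF d(1)] k_def by auto
      \<comment> \<open>By \<open>root_sum_form_sl2\<close>, proportional elements \<open>h\<close>
        and \<open>k\<close> of the two triples force the two roots to be proportional.\<close>
      have "(\<alpha> + \<beta>) l = (of_real r / (g * of_real s)) * \<alpha> l" if "l \<in> H" for l
      proof -
        have "\<alpha> l * of_real r = 2 * root_sum_form l h" using root_sum_form_sl2[OF f(1) that] r by (simp add: h_def)
        also have "\<dots> = g * (2 * root_sum_form l k)" by (simp add: lin)
        also have "2 * root_sum_form l k = (\<alpha> + \<beta>) l * of_real s"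
          using root_sum_form_sl2[OF d(1) that] s by (simp add: k_def)
        finally have "\<alpha> l * of_real r = g * ((\<alpha> + \<beta>) l * of_real s)" .
        then show ?thesis using \<open>g \<noteq> 0\<close> s(1) by (simp add: field_simps)
      qed
      then have "\<alpha> + \<beta> = fscale (of_real r / (g * of_real s)) \<alpha>"
        by (intro Hdual_eqI) (use a ab' rootsD Hdual_scale in auto)
      then have "\<alpha> + \<beta> = \<alpha> \<or> \<alpha> + \<beta> = - \<alpha>" using proportional_root f(1) d(1) by blast
      \<comment> \<open>\<alpha> + \<beta> = \<alpha> would make \<beta> zero; the remaining case
        makes \<beta> twice the root -\<alpha>.\<close>
      moreover have "\<beta> = fscale (of_nat 2) (- \<alpha>)" if "\<alpha> + \<beta> = - \<alpha>"
      proof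
        fix l show "\<beta> l = fscale (of_nat 2) (- \<alpha>) l" using fun_cong[OF that, of l] by (simp add: algebra_simps add_eq_0_iff)
      qed
      ultimately show False using root_multiple[OF sl2_triple_swap[OF f(1)], of 2] bH rootsD by auto
    qed
    have orth: "\<alpha> (br x y) = 0" if "\<alpha> \<in> roots L - S" "\<beta> \<in> S" "x \<in> root_space L \<beta>"
      "y \<in> root_space L (- \<beta>)" for \<alpha> \<beta> x y
      using that rootsD Hdual_zero_apply by (auto simp: S_def)
    have "H = span {br x y | x y. \<exists>\<beta>\<in>S. x \<in> root_space L \<beta> \<and> y \<in> root_space L (- \<beta>)}"
    proof (rule closed_root_subset_trivial(2))
      show "S \<subseteq> roots L" by (auto simp: S_def)
    qed (fact clos, fact orth, fact \<open>S \<noteq> {}\<close>)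
    also have "\<dots> \<subseteq> span {0}" by (rule span_mono) (auto simp: S_def)
    finally have "H = {0}" using subspace_0[OF subspace_H] by auto
    \<comment> \<open>Every element centralizes \<open>H = {0}\<close>, so the whole algebra would
      be zero.\<close>
    then have "x \<in> H" for x by (intro H_self_centralizing) auto
    then show False using \<open>H = {0}\<close> non_abelian by (metis br_zero(1) singletonD)
  qed
  then obtain x y where "x \<in> root_space L \<alpha>" "y \<in> root_space L (- \<alpha>)" "br x y \<noteq> 0"
    using assms by (auto simp: S_def)
  then show ?thesis using sl2_triple_exists[of \<alpha> x y] assms rootsD that by metis
qed

text \<open>Root spaces are lines, so all brackets of opposite root vectors lie on the line through
  \<open>br x y\<close>, and the value 2 singles out one point of it.\<close>

lemma coroot_sl2:
  assumes t: "sl2_triple \<alpha> x y" shows "coroot L \<alpha> = br x y"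
proof -
  note t' = sl2_tripleD[OF t]
  let ?S = "span {br x y | x y. x \<in> root_space L \<alpha> \<and> y \<in> root_space L (- \<alpha>)}"
  have "{br x y | x y. x \<in> root_space L \<alpha> \<and> y \<in> root_space L (- \<alpha>)} \<subseteq> span {br x y}"
  proof safe
    fix a b assume "a \<in> root_space L \<alpha>" "b \<in> root_space L (- \<alpha>)"
    moreover then obtain c d where "a = sc c x" "b = sc d y"
      using root_space_dim_1[OF t] root_space_dim_1[OF sl2_triple_swap[OF t]] by metis
    ultimately show "br a b \<in> span {br x y}"
      by (simp add: br_scale_left br_scale_right span_scale span_base)
  qed
  then have S: "?S \<subseteq> span {br x y}" by (rule span_minimal) simp
  show ?thesis
    unfolding coroot_def
  proof (rule the_equality)
    show "br x y \<in> ?S \<and> \<alpha> (br x y) = 2" using t' by (auto intro!: span_base)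
    fix h assume h: "h \<in> ?S \<and> \<alpha> h = 2"
    then obtain c where "h = sc c (br x y)" using S by (auto simp: span_singleton)
    then show "h = br x y" using h t' by (auto simp: Hdual_scale_apply)
  qed
qed

lemma coroot_triple:
  assumes "\<alpha> \<in> roots L" obtains x y where "sl2_triple \<alpha> x y" "br x y = coroot L \<alpha>"
  using root_sl2_triple[OF assms] coroot_sl2 by metis

lemma coroot_in_H: "\<alpha> \<in> roots L \<Longrightarrow> coroot L \<alpha> \<in> H"
  and root_coroot_self: "\<alpha> \<in> roots L \<Longrightarrow> \<alpha> (coroot L \<alpha>) = 2"
  by (metis coroot_triple sl2_tripleD(5), metis coroot_triple sl2_tripleD(4))

lemma root_coroot_int: "\<alpha> \<in> roots L \<Longrightarrow> \<beta> \<in> roots L \<Longrightarrow> \<exists>n::int. \<beta> (coroot L \<alpha>) = of_int n"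
  by (metis coroot_triple root_pairing_int)

lemma reflection_root: "\<alpha> \<in> roots L \<Longrightarrow> \<beta> \<in> roots L \<Longrightarrow> \<beta> - fscale (\<beta> (coroot L \<alpha>)) \<alpha> \<in> roots L"
  by (metis coroot_triple reflected_root)

lemma uminus_root: "\<alpha> \<in> roots L \<Longrightarrow> - \<alpha> \<in> roots L"
  by (metis coroot_triple sl2_triple_swap sl2_tripleD(9))

lemma roots_proportional:
  assumes "\<alpha> \<in> roots L" "\<beta> \<in> roots L" "\<beta> = fscale c \<alpha>" shows "\<beta> = \<alpha> \<or> \<beta> = - \<alpha>"
  by (metis assms coroot_triple proportional_root)

text \<open>The set of all roots meets the conditions of \<open>closed_root_subset_trivial\<close>,
  so \<open>H\<close> is spanned by brackets of opposite root vectors, and these are multiples of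
  coroots.\<close>

lemma coroots_span: "H = span (coroot L ` roots L)"
proof
  have "H = span {br x y | x y. \<exists>\<beta>\<in>roots L. x \<in> root_space L \<beta> \<and> y \<in> root_space L (- \<beta>)}"
  proof (rule closed_root_subset_trivial(2))
    show "\<alpha> + \<beta> \<in> roots L" if "\<alpha> \<in> roots L" "\<beta> \<in> roots L" "\<alpha> + \<beta> \<noteq> 0" "x \<in> root_space L \<alpha>"
      "y \<in> root_space L \<beta>" "br x y \<noteq> 0" for \<alpha> \<beta> x y
      using rootI[OF Hdual_add that(3) br_root_space[OF that(4,5)] that(6)] that(1,2) rootsD by blast
  qed (use roots_nonempty in auto)
  also have "\<dots> \<subseteq> span (coroot L ` roots L)"
  proof (rule span_minimal)
    show "{br x y | x y. \<exists>\<beta>\<in>roots L. x \<in> root_space L \<beta> \<and> y \<in> root_space L (- \<beta>)} \<subseteq> span (coroot L ` roots L)"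
    proof safe
      fix a b \<beta> assume r: "\<beta> \<in> roots L" "a \<in> root_space L \<beta>" "b \<in> root_space L (- \<beta>)"
      obtain x y where t: "sl2_triple \<beta> x y" "br x y = coroot L \<beta>" using coroot_triple[OF r(1)] .
      obtain c d where "a = sc c x" "b = sc d y"
        using root_space_dim_1[OF t(1) r(2)] root_space_dim_1[OF sl2_triple_swap[OF t(1)] r(3)] by metis
      then show "br a b \<in> span (coroot L ` roots L)" using r(1) t(2)
        by (simp add: br_scale_left br_scale_right span_scale span_base)
    qed
  qed simp
  finally show "H \<subseteq> span (coroot L ` roots L)" .
  show "span (coroot L ` roots L) \<subseteq> H" by (rule span_minimal) (auto simp: coroot_in_H subspace_H)
qed

text \<open>Up to positive factors both pairings equal the value of the symmetric
  \<open>root_sum_form\<close> at the two coroots. This permits comparing the lengths of two roots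
  before any property of the invariant form is established.\<close>

lemma root_coroot_sign:
  assumes "\<alpha> \<in> roots L" "\<beta> \<in> roots L"
  obtains r :: real where "r > 0" "\<beta> (coroot L \<alpha>) = of_real r * \<alpha> (coroot L \<beta>)"
proof -
  obtain x y where a: "sl2_triple \<alpha> x y" "br x y = coroot L \<alpha>" using coroot_triple[OF assms(1)] .
  obtain x' y' where b: "sl2_triple \<beta> x' y'" "br x' y' = coroot L \<beta>" using coroot_triple[OF assms(2)] .
  obtain r where r: "r > 0" "root_sum_form (coroot L \<alpha>) (coroot L \<alpha>) = of_real r"
    using root_sum_form_pos[OF a(1)] a(2) by auto
  obtain s where s: "s > 0" "root_sum_form (coroot L \<beta>) (coroot L \<beta>) = of_real s"
    using root_sum_form_pos[OF b(1)] b(2) by auto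
  have "\<beta> (coroot L \<alpha>) * of_real s = 2 * root_sum_form (coroot L \<alpha>) (coroot L \<beta>)"
    using root_sum_form_sl2[OF b(1) coroot_in_H[OF assms(1)]] b s by simp
  also have "\<dots> = 2 * root_sum_form (coroot L \<beta>) (coroot L \<alpha>)"
    by (simp add: root_sum_form_def mult.commute)
  also have "\<dots> = \<alpha> (coroot L \<beta>) * of_real r"
    using root_sum_form_sl2[OF a(1) coroot_in_H[OF assms(2)]] a r by simp
  finally have "\<beta> (coroot L \<alpha>) = of_real (r / s) * \<alpha> (coroot L \<beta>)" using s by (simp add: field_simps)
  moreover have "r / s > 0" using r s by simp
  ultimately show ?thesis using that by blast
qed

end

section \<open>Simple roots and the invariant form\<close>

locale simple_lie_root_data =
  fixes L :: "'g::ab_group_add lie_data"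
  assumes data: "simple_lie_data L"

sublocale simple_lie_root_data \<subseteq> simple_lie_cartan
  using data by (simp add: simple_lie_cartan_def simple_lie_data_def)

context simple_lie_root_data
begin

abbreviation I :: "nat set" where "I \<equiv> {1..lie_rank L}"
abbreviation \<alpha> :: "nat \<Rightarrow> 'g \<Rightarrow> complex" where "\<alpha> \<equiv> simple_root L"
abbreviation \<theta> :: "'g \<Rightarrow> complex" where "\<theta> \<equiv> highest_root L"
abbreviation form :: "('g \<Rightarrow> complex) \<Rightarrow> ('g \<Rightarrow> complex) \<Rightarrow> complex" where "form \<equiv> root_form L"
abbreviation co :: "('g \<Rightarrow> complex) \<Rightarrow> 'g" where "co \<equiv> coroot L"

lemma form_add_left: "\<beta> \<in> Hdual L \<Longrightarrow> \<gamma> \<in> Hdual L \<Longrightarrow> \<delta> \<in> Hdual L \<Longrightarrow> form (\<beta> + \<gamma>) \<delta> = form \<beta> \<delta> + form \<gamma> \<delta>"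
  and form_scale_left: "\<beta> \<in> Hdual L \<Longrightarrow> \<gamma> \<in> Hdual L \<Longrightarrow> form (fscale c \<beta>) \<gamma> = c * form \<beta> \<gamma>"
  and form_commute: "\<beta> \<in> Hdual L \<Longrightarrow> \<gamma> \<in> Hdual L \<Longrightarrow> form \<beta> \<gamma> = form \<gamma> \<beta>"
  and form_weyl_group: "w \<in> weyl_group L \<Longrightarrow> \<beta> \<in> Hdual L \<Longrightarrow> \<gamma> \<in> Hdual L \<Longrightarrow> form (w \<beta>) (w \<gamma>) = form \<beta> \<gamma>"
  and form_highest: "form \<theta> \<theta> = 2"
proof -
  have nf: "is_normalized_form L" using data by (simp add: simple_lie_data_def)
  note nf = nf[unfolded is_normalized_form_def]
  show "\<beta> \<in> Hdual L \<Longrightarrow> \<gamma> \<in> Hdual L \<Longrightarrow> \<delta> \<in> Hdual L \<Longrightarrow> form (\<beta> + \<gamma>) \<delta> = form \<beta> \<delta> + form \<gamma> \<delta>"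
    using nf[THEN conjunct1] by simp
  show "\<beta> \<in> Hdual L \<Longrightarrow> \<gamma> \<in> Hdual L \<Longrightarrow> form (fscale c \<beta>) \<gamma> = c * form \<beta> \<gamma>"
    using nf[THEN conjunct2, THEN conjunct1] by simp
  show "\<beta> \<in> Hdual L \<Longrightarrow> \<gamma> \<in> Hdual L \<Longrightarrow> form \<beta> \<gamma> = form \<gamma> \<beta>"
    using nf[THEN conjunct2, THEN conjunct2, THEN conjunct1] by (elim ballE) auto
  show "w \<in> weyl_group L \<Longrightarrow> \<beta> \<in> Hdual L \<Longrightarrow> \<gamma> \<in> Hdual L \<Longrightarrow> form (w \<beta>) (w \<gamma>) = form \<beta> \<gamma>"
    using nf[THEN conjunct2, THEN conjunct2, THEN conjunct2, THEN conjunct1] by simp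
  show "form \<theta> \<theta> = 2"
    using nf[THEN conjunct2, THEN conjunct2, THEN conjunct2, THEN conjunct2] .
qed

lemma highest_root_in_roots: "\<theta> \<in> roots L"
  and highest_root_diff: "\<beta> \<in> roots L \<Longrightarrow> \<exists>n. \<theta> - \<beta> = root_comb L n"
proof -
  have hr: "is_highest_root L" using data by (simp add: simple_lie_data_def)
  note hr = hr[unfolded is_highest_root_def]
  show "\<theta> \<in> roots L" using hr[THEN conjunct1] .
  show "\<beta> \<in> roots L \<Longrightarrow> \<exists>n. \<theta> - \<beta> = root_comb L n" using hr[THEN conjunct2] by (elim ballE) auto
qed

lemma simple_root_inj: "inj_on \<alpha> I"
  and simple_root_in_roots: "i \<in> I \<Longrightarrow> \<alpha> i \<in> roots L"
  and simple_roots_independent: "\<not> module.dependent fscale (\<alpha> ` I)"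
  and simple_roots_span: "module.span fscale (\<alpha> ` I) = Hdual L"
  and root_sign: "\<beta> \<in> roots L \<Longrightarrow> \<exists>n. \<beta> = root_comb L n \<or> \<beta> = - root_comb L n"
proof -
  have ss: "is_simple_system L" using data by (simp add: simple_lie_data_def)
  note ss = ss[unfolded is_simple_system_def]
  show "inj_on \<alpha> I" using ss[THEN conjunct1] .
  show "i \<in> I \<Longrightarrow> \<alpha> i \<in> roots L" using ss[THEN conjunct2, THEN conjunct1] by blast
  show "\<not> module.dependent fscale (\<alpha> ` I)" using ss[THEN conjunct2, THEN conjunct2, THEN conjunct1] .
  show "module.span fscale (\<alpha> ` I) = Hdual L"
    using ss[THEN conjunct2, THEN conjunct2, THEN conjunct2, THEN conjunct1] .
  show "\<beta> \<in> roots L \<Longrightarrow> \<exists>n. \<beta> = root_comb L n \<or> \<beta> = - root_comb L n"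
    using ss[THEN conjunct2, THEN conjunct2, THEN conjunct2, THEN conjunct2] by (elim ballE) auto
qed

lemma form_scale_right: "\<beta> \<in> Hdual L \<Longrightarrow> \<gamma> \<in> Hdual L \<Longrightarrow> form \<beta> (fscale c \<gamma>) = c * form \<beta> \<gamma>"
  by (subst (1 2) form_commute) (auto intro: Hdual_scale form_scale_left)

lemma form_add_right: "\<beta> \<in> Hdual L \<Longrightarrow> \<gamma> \<in> Hdual L \<Longrightarrow> \<delta> \<in> Hdual L \<Longrightarrow> form \<delta> (\<beta> + \<gamma>) = form \<delta> \<beta> + form \<delta> \<gamma>"
  by (subst (1 2 3) form_commute) (auto intro: Hdual_add form_add_left)

lemma uminus_eq_fscale: "- \<beta> = fscale (- 1) \<beta>" for \<beta> :: "'g \<Rightarrow> complex"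
  by (auto simp: fun_eq_iff)

lemma form_minus_left: "\<beta> \<in> Hdual L \<Longrightarrow> \<gamma> \<in> Hdual L \<Longrightarrow> form (- \<beta>) \<gamma> = - form \<beta> \<gamma>"
  and form_minus_right: "\<beta> \<in> Hdual L \<Longrightarrow> \<gamma> \<in> Hdual L \<Longrightarrow> form \<beta> (- \<gamma>) = - form \<beta> \<gamma>"
  unfolding uminus_eq_fscale by (simp_all add: form_scale_left form_scale_right)

lemma form_diff_left: "\<beta> \<in> Hdual L \<Longrightarrow> \<gamma> \<in> Hdual L \<Longrightarrow> \<delta> \<in> Hdual L \<Longrightarrow> form (\<beta> - \<gamma>) \<delta> = form \<beta> \<delta> - form \<gamma> \<delta>"
  using form_add_left[of \<beta> "- \<gamma>" \<delta>] by (simp add: form_minus_left Hdual_uminus)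

lemma form_diff_right: "\<beta> \<in> Hdual L \<Longrightarrow> \<gamma> \<in> Hdual L \<Longrightarrow> \<delta> \<in> Hdual L \<Longrightarrow> form \<delta> (\<beta> - \<gamma>) = form \<delta> \<beta> - form \<delta> \<gamma>"
  using form_add_right[of \<beta> "- \<gamma>" \<delta>] by (simp add: form_minus_right Hdual_uminus)

lemma form_zero_right: "\<delta> \<in> Hdual L \<Longrightarrow> form \<delta> 0 = 0"
  using form_diff_right[of 0 0 \<delta>] by (simp add: Hdual_0)

lemma form_sum_right:
  "\<delta> \<in> Hdual L \<Longrightarrow> (\<And>i. i \<in> A \<Longrightarrow> f i \<in> Hdual L) \<Longrightarrow> form \<delta> (sum f A) = (\<Sum>i\<in>A. form \<delta> (f i))"
  by (induction A rule: infinite_finite_induct) (simp_all add: form_zero_right form_add_right Hdual_sum)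

text \<open>\<open>root_reflection\<close> without the restriction to \<open>Hdual L\<close>, so
  that identities such as \<open>refl_refl\<close> hold for all functions.\<close>

definition refl :: "('g \<Rightarrow> complex) \<Rightarrow> ('g \<Rightarrow> complex) \<Rightarrow> 'g \<Rightarrow> complex" where
  "refl \<beta> v = v - fscale (v (co \<beta>)) \<beta>"

lemma refl_Hdual: "\<beta> \<in> roots L \<Longrightarrow> v \<in> Hdual L \<Longrightarrow> refl \<beta> v \<in> Hdual L"
  by (simp add: refl_def Hdual_diff Hdual_scale rootsD)

lemma refl_root: "\<beta> \<in> roots L \<Longrightarrow> \<gamma> \<in> roots L \<Longrightarrow> refl \<beta> \<gamma> \<in> roots L"
  by (simp add: refl_def reflection_root)

lemma refl_self: "\<beta> \<in> roots L \<Longrightarrow> refl \<beta> \<beta> = - \<beta>"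
  by (auto simp: refl_def root_coroot_self fun_eq_iff)

lemma refl_refl: "\<beta> \<in> roots L \<Longrightarrow> refl \<beta> (refl \<beta> v) = v"
  by (auto simp: refl_def root_coroot_self fun_eq_iff)

lemma refl_uminus: "refl \<beta> (- v) = - refl \<beta> v"
  by (auto simp: refl_def fun_eq_iff)

lemma root_reflection_apply: "v \<in> Hdual L \<Longrightarrow> root_reflection L \<beta> v = refl \<beta> v"
  by (simp add: root_reflection_def refl_def)

lemma form_refl:
  assumes "\<beta> \<in> roots L" "v \<in> Hdual L" "w \<in> Hdual L"
  shows "form (refl \<beta> v) (refl \<beta> w) = form v w"
proof -
  have "root_reflection L \<beta> \<in> weyl_group L"
    unfolding weyl_group_def using assms by (auto intro: generate.incl)
  from form_weyl_group[OF this assms(2,3)] show ?thesis using assms by (simp add: root_reflection_apply)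
qed

text \<open>Invariance under the reflection in \<beta>, which sends \<beta> to its negative. The
  equation is not divided by (\<beta>,\<beta>), which might still be 0 at this stage.\<close>

lemma form_root:
  assumes "\<beta> \<in> roots L" "v \<in> Hdual L"
  shows "2 * form v \<beta> = v (co \<beta>) * form \<beta> \<beta>"
proof -
  have b: "\<beta> \<in> Hdual L" using assms rootsD by auto
  have "form v \<beta> = form (refl \<beta> v) (- \<beta>)" using form_refl[OF assms b] assms by (simp add: refl_self)
  also have "\<dots> = - form v \<beta> + v (co \<beta>) * form \<beta> \<beta>"
    using assms b by (simp add: refl_def form_minus_right form_diff_left form_scale_left Hdual_diff Hdual_scale)
  finally show ?thesis by (simp add: algebra_simps)
qed

lemma root_coroot_sym_0:
  assumes "\<beta> \<in> roots L" "\<gamma> \<in> roots L" "\<beta> (co \<gamma>) = 0" shows "\<gamma> (co \<beta>) = 0"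
  using root_coroot_sign[OF assms(1,2)] assms(3) by (metis mult_zero_right)

text \<open>The roots of positive length are closed in the sense of \<open>closed_root_subset_trivial\<close>, because the
  ratio of the lengths of two non-orthogonal roots is positive by \<open>root_coroot_sign\<close>.\<close>

lemma root_length_pos:
  assumes "\<beta> \<in> roots L" obtains r :: real where "r > 0" "form \<beta> \<beta> = of_real r"
proof -
  define S where "S = {\<beta> \<in> roots L. \<exists>r::real. r > 0 \<and> form \<beta> \<beta> = of_real r}"
  have key: "\<gamma> \<in> S" if b: "\<beta> \<in> S" and g: "\<gamma> \<in> roots L" and n0: "\<gamma> (co \<beta>) \<noteq> 0" for \<beta> \<gamma>
  proof -
    have b': "\<beta> \<in> roots L" using b by (auto simp: S_def)
    obtain r where r: "r > 0" "\<gamma> (co \<beta>) = of_real r * \<beta> (co \<gamma>)" using root_coroot_sign[OF b' g] .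
    \<comment> \<open>Both sides are 2(\<beta>,\<gamma>); where this pairing is not orthogonality,
      the ratio of the squared lengths is the positive number \<open>r\<close>.\<close>
    have "\<gamma> (co \<beta>) * form \<beta> \<beta> = \<beta> (co \<gamma>) * form \<gamma> \<gamma>"
      using form_root[OF b' rootsD(1)[OF g]] form_root[OF g rootsD(1)[OF b']]
        form_commute[OF rootsD(1)[OF g] rootsD(1)[OF b']] by simp
    then have "\<beta> (co \<gamma>) * (of_real r * form \<beta> \<beta> - form \<gamma> \<gamma>) = 0" using r by (simp add: algebra_simps)
    moreover have "\<beta> (co \<gamma>) \<noteq> 0" using n0 r by auto
    ultimately have "form \<gamma> \<gamma> = of_real r * form \<beta> \<beta>" by simp
    moreover obtain s where "s > 0" "form \<beta> \<beta> = of_real s" using b by (auto simp: S_def)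
    ultimately show ?thesis using r(1) g by (auto simp: S_def intro!: exI[of _ "r * s"])
  qed
  have "\<exists>r::real. r > 0 \<and> form \<theta> \<theta> = of_real r"
    by (rule exI[of _ 2]) (simp add: form_highest)
  then have "\<theta> \<in> S" using highest_root_in_roots by (auto simp: S_def)
  have "S = roots L"
  proof (rule closed_root_subset_trivial(1))
    show "S \<subseteq> roots L" by (auto simp: S_def)
    show "S \<noteq> {}" using \<open>\<theta> \<in> S\<close> by auto
    fix \<beta> \<gamma> x y assume a: "\<beta> \<in> roots L - S" "\<gamma> \<in> S" "x \<in> root_space L \<gamma>" "y \<in> root_space L (- \<gamma>)"
    then have g: "\<gamma> \<in> roots L" by (auto simp: S_def)
    have "\<beta> (co \<gamma>) = 0" using key[of \<gamma> \<beta>] a by auto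
    obtain x' y' where t: "sl2_triple \<gamma> x' y'" "br x' y' = co \<gamma>" using coroot_triple[OF g] .
    obtain c d where "x = sc c x'" "y = sc d y'"
      using root_space_dim_1[OF t(1) a(3)] root_space_dim_1[OF sl2_triple_swap[OF t(1)] a(4)] by metis
    then have "br x y = sc (c * d) (co \<gamma>)" using t(2) by (simp add: br_scale_left br_scale_right mult.commute)
    then show "\<beta> (br x y) = 0"
      using \<open>\<beta> (co \<gamma>) = 0\<close> a(1) coroot_in_H[OF g] by (simp add: Hdual_scale_apply rootsD)
  next
    fix \<beta> \<gamma> x y assume a: "\<beta> \<in> roots L" "\<gamma> \<in> S" "\<beta> + \<gamma> \<noteq> 0" "x \<in> root_space L \<beta>" "y \<in> root_space L \<gamma>" "br x y \<noteq> 0"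
    have g: "\<gamma> \<in> roots L" using a by (auto simp: S_def)
    have s: "\<beta> + \<gamma> \<in> roots L"
      using rootI[OF Hdual_add a(3) br_root_space[OF a(4,5)] a(6)] rootsD a(1) g by blast
    show "\<beta> + \<gamma> \<in> S"
    proof (rule ccontr)
      assume n: "\<beta> + \<gamma> \<notin> S"
      \<comment> \<open>A sum outside \<open>S\<close> is orthogonal to all of \<open>S\<close>.
        Orthogonality to \<gamma> gives \<open>\<beta> (co \<gamma>) = -2\<close>, so \<beta> lies
        in \<open>S\<close> too, and the sum would vanish on its own coroot.\<close>
      have *: "\<delta> (co (\<beta> + \<gamma>)) = 0" if "\<delta> \<in> S" for \<delta>
      proof -
        have "\<delta> \<in> roots L" using that by (auto simp: S_def)
        moreover have "(\<beta> + \<gamma>) (co \<delta>) = 0" using key[OF that s] n by auto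
        ultimately show ?thesis using root_coroot_sym_0[OF s] by blast
      qed
      have "(\<beta> + \<gamma>) (co \<gamma>) = 0" using key[OF a(2) s] n by auto
      then have "\<beta> (co \<gamma>) \<noteq> 0" using root_coroot_self[OF g] by auto
      then have "\<beta> \<in> S" using key[OF a(2) a(1)] by auto
      then have "(\<beta> + \<gamma>) (co (\<beta> + \<gamma>)) = 0" using *[of \<beta>] *[OF a(2)] by simp
      then show False using root_coroot_self[OF s] by simp
    qed
  qed
  then show ?thesis using assms that by (auto simp: S_def)
qed

lemma root_length_nonzero: "\<beta> \<in> roots L \<Longrightarrow> form \<beta> \<beta> \<noteq> 0"
  by (metis root_length_pos less_irrefl of_real_eq_0_iff)

lemma root_pairing_coroot: "\<beta> \<in> roots L \<Longrightarrow> v \<in> Hdual L \<Longrightarrow> root_pairing L v \<beta> = v (co \<beta>)"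
  using form_root[of \<beta> v] root_length_nonzero[of \<beta>] by (simp add: root_pairing_def field_simps)

lemma coroot_apply: "\<beta> \<in> roots L \<Longrightarrow> v \<in> Hdual L \<Longrightarrow> v (co \<beta>) = 2 * form v \<beta> / form \<beta> \<beta>"
  using root_pairing_coroot[of \<beta> v] by (simp add: root_pairing_def)

lemma form_eq_coroot: "\<beta> \<in> roots L \<Longrightarrow> v \<in> Hdual L \<Longrightarrow> form v \<beta> = v (co \<beta>) * form \<beta> \<beta> / 2"
  using form_root[of \<beta> v] by (simp add: field_simps)

subsection \<open>Coordinates with respect to the simple roots\<close>

definition comb :: "(nat \<Rightarrow> complex) \<Rightarrow> 'g \<Rightarrow> complex" where
  "comb c = (\<Sum>i\<in>I. fscale (c i) (\<alpha> i))"

lemma simple_root_Hdual: "i \<in> I \<Longrightarrow> \<alpha> i \<in> Hdual L"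
  using simple_root_in_roots rootsD by blast

lemma comb_Hdual: "comb c \<in> Hdual L"
  unfolding comb_def by (auto intro!: Hdual_sum Hdual_scale simple_root_Hdual)

lemma comb_unique:
  assumes "comb c = comb d" "i \<in> I" shows "c i = d i"
proof -
  interpret F: vector_space fscale by (rule vector_space_fscale)
  define u where "u \<beta> = c (the_inv_into I \<alpha> \<beta>) - d (the_inv_into I \<alpha> \<beta>)" for \<beta>
  have u: "u (\<alpha> i) = c i - d i" if "i \<in> I" for i
    using that simple_root_inj by (simp add: u_def the_inv_into_f_f)
  have "(\<Sum>v\<in>\<alpha> ` I. fscale (u v) v) = (\<Sum>i\<in>I. fscale (c i - d i) (\<alpha> i))"
    using simple_root_inj u by (subst sum.reindex) (auto intro: sum.cong)
  also have "\<dots> = comb c - comb d"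
    by (simp add: comb_def F.scale_left_diff_distrib sum_subtractf)
  finally have "(\<Sum>v\<in>\<alpha> ` I. fscale (u v) v) = 0" using assms by simp
  then have "u (\<alpha> i) = 0"
    using F.independentD[OF simple_roots_independent, of "\<alpha> ` I" u "\<alpha> i"] assms(2) by auto
  then show ?thesis using u assms by simp
qed

lemma comb_exists:
  assumes "v \<in> Hdual L" shows "\<exists>c. v = comb c"
proof -
  interpret F: vector_space fscale by (rule vector_space_fscale)
  have "v \<in> F.span (\<alpha> ` I)" using assms simple_roots_span by simp
  then obtain u where "v = (\<Sum>w\<in>\<alpha> ` I. fscale (u w) w)" using F.span_finite[of "\<alpha> ` I"] by auto
  also have "\<dots> = comb (\<lambda>i. u (\<alpha> i))"
    unfolding comb_def using simple_root_inj by (subst sum.reindex) auto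
  finally show ?thesis by blast
qed

text \<open>Only the values on \<open>I\<close> are determined, whence the side conditions
  \<open>i \<in> I\<close> in the rules below.\<close>

definition coef :: "('g \<Rightarrow> complex) \<Rightarrow> nat \<Rightarrow> complex" where
  "coef v = (SOME c. v = comb c)"

lemma comb_coef: "v \<in> Hdual L \<Longrightarrow> comb (coef v) = v"
  unfolding coef_def using someI_ex[OF comb_exists] by metis

lemma coef_comb: "i \<in> I \<Longrightarrow> coef (comb c) i = c i"
  using comb_unique comb_coef comb_Hdual by metis

lemma coef_add: "v \<in> Hdual L \<Longrightarrow> w \<in> Hdual L \<Longrightarrow> i \<in> I \<Longrightarrow> coef (v + w) i = coef v i + coef w i"
proof -
  interpret F: vector_space fscale by (rule vector_space_fscale)
  assume a: "v \<in> Hdual L" "w \<in> Hdual L" "i \<in> I"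
  have "v + w = comb (coef v) + comb (coef w)" using a by (simp add: comb_coef)
  also have "\<dots> = comb (\<lambda>i. coef v i + coef w i)"
    by (simp add: comb_def sum.distrib F.scale_left_distrib)
  finally show ?thesis using coef_comb[OF a(3)] by simp
qed

lemma coef_scale: "v \<in> Hdual L \<Longrightarrow> i \<in> I \<Longrightarrow> coef (fscale c v) i = c * coef v i"
proof -
  interpret F: vector_space fscale by (rule vector_space_fscale)
  assume a: "v \<in> Hdual L" "i \<in> I"
  have "fscale c v = fscale c (comb (coef v))" using a by (simp add: comb_coef)
  also have "\<dots> = comb (\<lambda>i. c * coef v i)"
    by (simp add: comb_def F.scale_sum_right)
  finally show ?thesis using coef_comb[OF a(2)] by simp
qed

lemma coef_uminus: "v \<in> Hdual L \<Longrightarrow> i \<in> I \<Longrightarrow> coef (- v) i = - coef v i"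
  unfolding uminus_eq_fscale by (simp add: coef_scale)

lemma coef_diff: "v \<in> Hdual L \<Longrightarrow> w \<in> Hdual L \<Longrightarrow> i \<in> I \<Longrightarrow> coef (v - w) i = coef v i - coef w i"
  using coef_add[of v "- w" i] by (simp add: coef_uminus Hdual_uminus)

lemma coef_zero: "i \<in> I \<Longrightarrow> coef 0 i = 0"
  using coef_diff[of 0 0 i] Hdual_0 by simp

lemma coef_eqI: "v \<in> Hdual L \<Longrightarrow> w \<in> Hdual L \<Longrightarrow> (\<And>i. i \<in> I \<Longrightarrow> coef v i = coef w i) \<Longrightarrow> v = w"
proof -
  assume a: "v \<in> Hdual L" "w \<in> Hdual L" "\<And>i. i \<in> I \<Longrightarrow> coef v i = coef w i"
  have "comb (coef v) = comb (coef w)" unfolding comb_def by (rule sum.cong) (auto simp: a(3))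
  then show "v = w" using a by (simp add: comb_coef)
qed

lemma coef_simple_root: "i \<in> I \<Longrightarrow> j \<in> I \<Longrightarrow> coef (\<alpha> i) j = (if i = j then 1 else 0)"
proof -
  assume a: "i \<in> I" "j \<in> I"
  have "comb (\<lambda>j. if i = j then 1 else 0) = (\<Sum>j\<in>I. if i = j then \<alpha> j else 0)"
    unfolding comb_def by (rule sum.cong) (auto simp: fun_eq_iff)
  also have "\<dots> = \<alpha> i" using a by simp
  finally show ?thesis using coef_comb[OF a(2), of "\<lambda>j. if i = j then 1 else 0"] by simp
qed

text \<open>Such a \<open>v\<close> is orthogonal to the simple roots, hence to all of
  \<open>Hdual L\<close>, hence vanishes on every coroot, and the coroots span \<open>H\<close>. It
  plays the part of nondegeneracy for the fundamental weights.\<close>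

lemma Hdual_eq_0_if_coroots:
  assumes "v \<in> Hdual L" "\<And>i. i \<in> I \<Longrightarrow> v (co (\<alpha> i)) = 0" shows "v = 0"
proof -
  have "form v w = 0" if "w \<in> Hdual L" for w
  proof -
    have "form v w = form v (comb (coef w))" using that by (simp add: comb_coef)
    also have "\<dots> = (\<Sum>i\<in>I. form v (fscale (coef w i) (\<alpha> i)))"
      unfolding comb_def by (intro form_sum_right assms(1) Hdual_scale simple_root_Hdual)
    also have "\<dots> = 0"
    proof (rule sum.neutral, rule ballI)
      fix i assume i: "i \<in> I"
      have "form v (\<alpha> i) = 0"
        using form_eq_coroot[OF simple_root_in_roots[OF i] assms(1)] assms(2)[OF i] by simp
      then show "form v (fscale (coef w i) (\<alpha> i)) = 0"
        using form_scale_right[OF assms(1) simple_root_Hdual[OF i]] by simp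
    qed
    finally show ?thesis .
  qed
  then have 0: "v (co \<beta>) = 0" if "\<beta> \<in> roots L" for \<beta>
    using coroot_apply[OF that assms(1)] that rootsD by simp
  have "v h = 0" if "h \<in> H" for h
  proof -
    have "h \<in> span (co ` roots L)" using that coroots_span by simp
    then have "h \<in> H \<and> v h = 0"
    proof (induction rule: span_induct_alt)
      case base
      show ?case using Hdual_zero_apply[OF assms(1)] subspace_0[OF subspace_H] by simp
    next
      case (step c x y)
      then have "x \<in> H" "v x = 0" using 0 coroot_in_H by auto
      then show ?case using step subspace_H assms(1)
        by (simp add: Hdual_add_apply Hdual_scale_apply subspace_add subspace_scale)
    qed
    then show ?thesis by simp
  qed
  then show ?thesis using Hdual_eqI[OF assms(1) Hdual_0] by simp
qed

lemma root_comb_eq_comb: "root_comb L n = comb (\<lambda>i. of_nat (n i))"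
  by (simp add: root_comb_def comb_def)

lemma coef_root_comb: "i \<in> I \<Longrightarrow> coef (root_comb L n) i = of_nat (n i)"
  by (simp add: root_comb_eq_comb coef_comb)

lemma root_comb_Hdual: "root_comb L n \<in> Hdual L"
  by (simp add: root_comb_eq_comb comb_Hdual)

lemma positive_rootsD: "\<beta> \<in> positive_roots L \<Longrightarrow> \<beta> \<in> roots L" "\<beta> \<in> positive_roots L \<Longrightarrow> \<exists>n. \<beta> = root_comb L n"
  by (auto simp: positive_roots_def)

lemma positive_or_negative: "\<beta> \<in> roots L \<Longrightarrow> \<beta> \<in> positive_roots L \<or> - \<beta> \<in> positive_roots L"
  using root_sign[of \<beta>] uminus_root[of \<beta>] by (auto simp: positive_roots_def)

text \<open>The coefficients of a root never have mixed signs, so a single positive one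
  decides.\<close>

lemma positive_root_if_coef_pos:
  assumes "\<beta> \<in> roots L" "i \<in> I" "coef \<beta> i = of_nat m" "m > 0" shows "\<beta> \<in> positive_roots L"
proof (rule ccontr)
  assume "\<beta> \<notin> positive_roots L"
  then obtain n where "- \<beta> = root_comb L n" using positive_or_negative assms positive_rootsD by blast
  then have "coef (- \<beta>) i = of_nat (n i)" using coef_root_comb assms by simp
  then have "(of_nat (n i + m) :: complex) = 0"
    using coef_uminus[of \<beta> i] assms rootsD by simp
  then show False using assms(4) by (simp only: of_nat_eq_0_iff)
qed

lemma positive_root_nonzero_coef:
  assumes "\<beta> \<in> positive_roots L" "\<beta> = root_comb L n" obtains i where "i \<in> I" "n i > 0"
proof -
  have "\<exists>i\<in>I. n i > 0"
  proof (rule ccontr)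
    assume "\<not> (\<exists>i\<in>I. n i > 0)"
    then have "root_comb L n = 0"
      by (intro coef_eqI) (auto simp: coef_root_comb root_comb_Hdual Hdual_0 coef_zero)
    then show False using assms rootsD(2)[OF positive_rootsD(1)[OF assms(1)]] by simp
  qed
  then show ?thesis using that by blast
qed

lemma not_positive_and_negative: "\<beta> \<in> positive_roots L \<Longrightarrow> - \<beta> \<in> positive_roots L \<Longrightarrow> False"
proof -
  assume a: "\<beta> \<in> positive_roots L" "- \<beta> \<in> positive_roots L"
  obtain n where n: "\<beta> = root_comb L n" using a positive_rootsD by blast
  obtain m where m: "- \<beta> = root_comb L m" using a positive_rootsD by blast
  obtain i where i: "i \<in> I" "n i > 0" using positive_root_nonzero_coef[OF a(1) n] .
  have "coef (- \<beta>) i = - coef \<beta> i" using a i positive_rootsD rootsD by (intro coef_uminus) auto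
  then have "(of_nat (n i + m i) :: complex) = 0"
    using coef_root_comb[OF i(1), of n] coef_root_comb[OF i(1), of m] n m by simp
  then show False using i by (simp only: of_nat_eq_0_iff)
qed

lemma simple_root_positive: "i \<in> I \<Longrightarrow> \<alpha> i \<in> positive_roots L"
  by (rule positive_root_if_coef_pos[of _ i 1]) (auto simp: simple_root_in_roots coef_simple_root)

text \<open>The reflection changes only the coefficient at \<open>i\<close>. Some other coefficient
  is positive, since otherwise \<beta> would be a multiple of \<open>\<alpha> i\<close>.\<close>

lemma simple_refl_positive:
  assumes "\<beta> \<in> positive_roots L" "i \<in> I" "\<beta> \<noteq> \<alpha> i"
  shows "refl (\<alpha> i) \<beta> \<in> positive_roots L"
proof -
  obtain n where n: "\<beta> = root_comb L n" using assms positive_rootsD by blast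
  note b = positive_rootsD(1)[OF assms(1)] rootsD(1)[OF positive_rootsD(1)[OF assms(1)]]
  have "\<exists>j\<in>I. j \<noteq> i \<and> n j > 0"
  proof (rule ccontr)
    assume a: "\<not> (\<exists>j\<in>I. j \<noteq> i \<and> n j > 0)"
    have "\<beta> = fscale (of_nat (n i)) (\<alpha> i)"
    proof (rule coef_eqI)
      fix j assume j: "j \<in> I"
      have "n j = 0" if "j \<noteq> i" using a that j by auto
      then show "coef \<beta> j = coef (fscale (of_nat (n i)) (\<alpha> i)) j"
        unfolding n coef_root_comb[OF j] coef_scale[OF simple_root_Hdual[OF assms(2)] j]
          coef_simple_root[OF assms(2) j] by auto
    qed (auto intro: b Hdual_scale simple_root_Hdual assms(2))
    then have "\<beta> = \<alpha> i \<or> \<beta> = - \<alpha> i"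
      by (rule roots_proportional[OF simple_root_in_roots[OF assms(2)] b(1)])
    then have "- \<alpha> i \<in> positive_roots L" using assms by auto
    then show False using not_positive_and_negative[OF simple_root_positive[OF assms(2)]] by simp
  qed
  then obtain j where j: "j \<in> I" "j \<noteq> i" "n j > 0" by auto
  have "coef (refl (\<alpha> i) \<beta>) j = of_nat (n j)"
    using j b assms(2) n unfolding refl_def
    by (simp add: coef_diff Hdual_scale simple_root_Hdual coef_scale coef_simple_root coef_root_comb)
  then show ?thesis using positive_root_if_coef_pos[OF refl_root j(1) _ j(3)] simple_root_in_roots assms b by auto
qed

section \<open>The highest root and its pairings with the other roots\<close>

lemma highest_root_positive: "\<theta> \<in> positive_roots L"
proof (rule ccontr)
  assume "\<theta> \<notin> positive_roots L"
  then have m: "- \<theta> \<in> positive_roots L" using positive_or_negative highest_root_in_roots by blast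
  then obtain n where n: "- \<theta> = root_comb L n" using positive_rootsD by blast
  obtain i where i: "i \<in> I" "n i > 0" using positive_root_nonzero_coef[OF m n] .
  obtain k where k: "\<theta> - (- \<theta>) = root_comb L k" using highest_root_diff uminus_root highest_root_in_roots by blast
  have t: "\<theta> \<in> Hdual L" using highest_root_in_roots rootsD by blast
  have "coef (- \<theta>) i = - coef \<theta> i" using t i by (intro coef_uminus) auto
  moreover have "coef (\<theta> - (- \<theta>)) i = 2 * coef \<theta> i"
    using t i by (subst coef_diff) (auto simp: Hdual_uminus coef_uminus)
  ultimately have "(of_nat (2 * n i + k i) :: complex) = 0"
    using coef_root_comb[OF i(1), of n] coef_root_comb[OF i(1), of k] n k by simp
  then show False using i by (simp only: of_nat_eq_0_iff)
qed

text \<open>Both \<beta> and m\<theta> - \<beta>, the negative of its reflection, are roots below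
  \<theta>. The two differences from \<theta> add up to (2 - m)\<theta>, and being nonnegative they
  vanish when m is at least 2, \<theta> being positive.\<close>

lemma highest_root_dominates:
  assumes "\<beta> \<in> roots L" "\<beta> (co \<theta>) = of_int m" "m \<ge> 2" shows "\<beta> = \<theta>"
proof -
  note t = highest_root_in_roots rootsD(1)[OF highest_root_in_roots]
  note b = rootsD(1)[OF assms(1)]
  have "- refl \<theta> \<beta> \<in> roots L" using uminus_root refl_root t assms by blast
  then obtain k where k: "\<theta> - (- refl \<theta> \<beta>) = root_comb L k" using highest_root_diff by blast
  obtain l where l: "\<theta> - \<beta> = root_comb L l" using highest_root_diff assms by blast
  obtain n where n: "\<theta> = root_comb L n" using highest_root_positive positive_rootsD by blast
  show ?thesis
  proof (rule coef_eqI[OF b t(2)])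
    fix i assume i: "i \<in> I"
    have "\<theta> - (- refl \<theta> \<beta>) = \<theta> + \<beta> - fscale (of_int m) \<theta>"
      using assms(2) by (auto simp: refl_def fun_eq_iff)
    then have "coef (\<theta> - (- refl \<theta> \<beta>)) i = coef \<theta> i + coef \<beta> i - of_int m * coef \<theta> i"
      by (simp only: coef_add[OF t(2) b i] coef_diff[OF Hdual_add[OF t(2) b] Hdual_scale[OF t(2)] i]
        coef_scale[OF t(2) i])
    then have 1: "of_nat (k i) = coef \<theta> i + coef \<beta> i - of_int m * coef \<theta> i"
      using coef_root_comb[OF i, of k] k by simp
    have "coef (\<theta> - \<beta>) i = coef \<theta> i - coef \<beta> i" using coef_diff t b i by auto
    then have 2: "coef \<theta> i - coef \<beta> i = of_nat (l i)"
      using coef_root_comb[OF i, of l] l by simp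
    have 3: "coef \<theta> i = of_nat (n i)" using coef_root_comb[OF i] n by simp
    have "(of_int (int (k i) + int (l i) + (m - 2) * int (n i)) :: complex) = 0"
      using 1 2 3 by (simp add: algebra_simps)
    then have "int (k i) + int (l i) + (m - 2) * int (n i) = 0" by (simp only: of_int_eq_0_iff)
    moreover have "(m - 2) * int (n i) \<ge> 0" using assms by simp
    ultimately have "l i = 0" by linarith
    then show "coef \<beta> i = coef \<theta> i" using 2 by simp
  qed
qed

text \<open>The reflection in \<theta> shows that \<theta> - \<beta> is a root. Each of \<beta> and
  \<theta> - \<beta> is \<theta> minus a root, so both have nonnegative coefficients.\<close>

lemma highest_root_pairing_1:
  assumes "\<beta> \<in> roots L" "\<beta> (co \<theta>) = 1"
  shows "\<beta> \<in> positive_roots L" "\<theta> - \<beta> \<in> positive_roots L"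
proof -
  have "refl \<theta> \<beta> = \<beta> - \<theta>" using assms by (auto simp: refl_def fun_eq_iff)
  then have "\<beta> - \<theta> \<in> roots L" using refl_root[OF highest_root_in_roots assms(1)] by simp
  then have d: "\<theta> - \<beta> \<in> roots L" using uminus_root[of "\<beta> - \<theta>"] by simp
  then show "\<theta> - \<beta> \<in> positive_roots L" using highest_root_diff[OF assms(1)] by (auto simp: positive_roots_def)
  have "\<theta> - (\<theta> - \<beta>) = \<beta>" by simp
  then show "\<beta> \<in> positive_roots L" using highest_root_diff[OF d] assms(1) by (auto simp: positive_roots_def)
qed

lemma highest_root_pairing_cases:
  assumes "\<beta> \<in> roots L"
  shows "\<beta> = \<theta> \<or> \<beta> = - \<theta> \<or> \<beta> (co \<theta>) = 0 \<or> \<beta> (co \<theta>) = 1 \<or> \<beta> (co \<theta>) = - 1"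
proof -
  obtain m where m: "\<beta> (co \<theta>) = of_int m" using root_coroot_int highest_root_in_roots assms by blast
  then have m': "(- \<beta>) (co \<theta>) = of_int (- m)" by simp
  consider "m \<ge> 2" | "- m \<ge> 2" | "m = 0" | "m = 1" | "m = -1" by linarith
  then show ?thesis
  proof cases
    case 1
    then show ?thesis using highest_root_dominates[OF assms m] by simp
  next
    case 2
    then have "- \<beta> = \<theta>" by (rule highest_root_dominates[OF uminus_root[OF assms] m'])
    then have "\<beta> = - \<theta>" by (metis minus_minus)
    then show ?thesis by simp
  qed (use m in simp_all)
qed

section \<open>The action on alcoves\<close>

text \<open>The pair \<open>(\<beta>, n)\<close> stands for the affine functional \<open>x \<mapsto> (x, \<beta>) + n K\<close>. The \<open>act a\<close> below is the
  action of the reflection in \<open>a\<close> on these functionals.\<close>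

definition aeval :: "complex \<Rightarrow> ('g \<Rightarrow> complex) \<times> int \<Rightarrow> ('g \<Rightarrow> complex) \<Rightarrow> complex" where
  "aeval K a x = form x (fst a) + of_int (snd a) * K"

definition arefl :: "complex \<Rightarrow> ('g \<Rightarrow> complex) \<times> int \<Rightarrow> ('g \<Rightarrow> complex) \<Rightarrow> 'g \<Rightarrow> complex" where
  "arefl K a x = x - fscale (2 * aeval K a x / form (fst a) (fst a)) (fst a)"

text \<open>The pairing of two roots is an integer of type complex;
  \<open>\<lfloor>Re _\<rfloor>\<close> makes it an \<open>int\<close>. \<open>K\<close> does not
  occur, so the signs of affine roots can be followed independently of the level.\<close>

definition act :: "('g \<Rightarrow> complex) \<times> int \<Rightarrow> ('g \<Rightarrow> complex) \<times> int \<Rightarrow> ('g \<Rightarrow> complex) \<times> int" where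
  "act a b = (refl (fst a) (fst b), snd b - snd a * \<lfloor>Re (fst b (co (fst a)))\<rfloor>)"

definition aroots :: "(('g \<Rightarrow> complex) \<times> int) set" where
  "aroots = {a. fst a \<in> roots L}"

text \<open>The positive real roots \<beta> + n\<delta> of the untwisted affine algebra, with
  \<open>K\<close> as the value of \<delta>: n > 0, or n = 0 and \<beta> positive.\<close>

definition apos :: "('g \<Rightarrow> complex) \<times> int \<Rightarrow> bool" where
  "apos a \<longleftrightarrow> (if fst a \<in> positive_roots L then snd a \<ge> 0 else snd a \<ge> 1)"

text \<open>The pair \<open>(- \<theta>, 1)\<close> is the affine simple root \<delta> -
  \<theta>.\<close>

definition simple_aroots :: "(('g \<Rightarrow> complex) \<times> int) set" where
  "simple_aroots = insert (- \<theta>, 1) ((\<lambda>i. (\<alpha> i, 0)) ` I)"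

lemma arootsD: "a \<in> aroots \<Longrightarrow> fst a \<in> roots L" "a \<in> aroots \<Longrightarrow> fst a \<in> Hdual L"
  by (auto simp: aroots_def rootsD)

lemma simple_aroots_aroots: "a \<in> simple_aroots \<Longrightarrow> a \<in> aroots"
  by (auto simp: simple_aroots_def aroots_def highest_root_in_roots uminus_root simple_root_in_roots)

lemma act_aroots: "a \<in> aroots \<Longrightarrow> b \<in> aroots \<Longrightarrow> act a b \<in> aroots"
  by (auto simp: aroots_def act_def refl_root)

lemma arefl_Hdual: "a \<in> aroots \<Longrightarrow> x \<in> Hdual L \<Longrightarrow> arefl K a x \<in> Hdual L"
  by (simp add: arefl_def Hdual_diff Hdual_scale arootsD)

lemma form_refl_right:
  assumes "\<beta> \<in> roots L" "x \<in> Hdual L" "y \<in> Hdual L"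
  shows "form x (refl \<beta> y) = form x y - y (co \<beta>) * form x \<beta>"
  using assms rootsD[of \<beta>] by (simp add: refl_def form_diff_right Hdual_scale form_scale_right)

lemma aeval_arefl:
  assumes a: "a \<in> aroots" and b: "b \<in> aroots" and x: "x \<in> Hdual L"
  shows "aeval K b (arefl K a x) = aeval K (act a b) x"
proof -
  obtain \<beta> n where ab: "a = (\<beta>, n)" by (cases a)
  obtain \<gamma> m where bg: "b = (\<gamma>, m)" by (cases b)
  have r: "\<beta> \<in> roots L" "\<gamma> \<in> roots L" "\<beta> \<in> Hdual L" "\<gamma> \<in> Hdual L" using a b ab bg arootsD by auto
  obtain z where z: "\<gamma> (co \<beta>) = of_int z" using root_coroot_int r by blast
  have nz: "form \<beta> \<beta> \<noteq> 0" using root_length_nonzero r by simp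
  have z2: "2 * form \<beta> \<gamma> = of_int z * form \<beta> \<beta>"
    using form_root[OF r(1) r(4)] form_commute[OF r(3) r(4)] z by simp
  define e where "e = 2 * (form x \<beta> + of_int n * K) / form \<beta> \<beta>"
  have e: "e * form \<beta> \<beta> = 2 * (form x \<beta> + of_int n * K)" using nz by (simp add: e_def)
  have "e * (2 * form \<beta> \<gamma>) = of_int z * (e * form \<beta> \<beta>)" unfolding z2 by (simp add: algebra_simps)
  then have "2 * (e * form \<beta> \<gamma>) = 2 * (of_int z * (form x \<beta> + of_int n * K))" unfolding e by (simp add: algebra_simps)
  then have 1: "e * form \<beta> \<gamma> = of_int z * (form x \<beta> + of_int n * K)" by (simp only: mult_cancel_left) simp
  have "aeval K b (arefl K a x) = form (x - fscale e \<beta>) \<gamma> + of_int m * K"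
    by (simp add: aeval_def arefl_def ab bg e_def)
  also have "\<dots> = form x \<gamma> - e * form \<beta> \<gamma> + of_int m * K"
    using r x by (simp add: form_diff_left form_scale_left Hdual_scale)
  also have "\<dots> = aeval K (act a b) x"
    unfolding 1 using r x z by (simp add: aeval_def act_def ab bg form_refl_right algebra_simps)
  finally show ?thesis .
qed

text \<open>The linear part of an affine reflection is the reflection in the root
  \<open>fst a\<close>.\<close>

lemma arefl_diff:
  assumes a: "a \<in> aroots" and x: "x \<in> Hdual L" and y: "y \<in> Hdual L"
  shows "arefl K a (x - fscale c y) = arefl K a x - fscale c (refl (fst a) y)"
proof -
  obtain \<beta> n where ab: "a = (\<beta>, n)" by (cases a)
  have r: "\<beta> \<in> roots L" "\<beta> \<in> Hdual L" using a ab arootsD by auto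
  have f: "form (x - fscale c y) \<beta> = form x \<beta> - c * form y \<beta>"
    using r x y by (simp add: form_diff_left form_scale_left Hdual_scale)
  have E: "2 * aeval K a (x - fscale c y) / form \<beta> \<beta> = 2 * aeval K a x / form \<beta> \<beta> - c * y (co \<beta>)"
    unfolding coroot_apply[OF r(1) y] using root_length_nonzero[OF r(1)]
    by (simp add: aeval_def ab f field_simps)
  have fa: "fst a = \<beta>" by (simp add: ab)
  show ?thesis
    unfolding arefl_def fa E refl_def by (auto simp: fun_eq_iff algebra_simps)
qed

lemma arefl_arefl:
  assumes a: "a \<in> aroots" and x: "x \<in> Hdual L"
  shows "arefl K a (arefl K a x) = x"
proof -
  have "arefl K a (arefl K a x) = arefl K a x - fscale (2 * aeval K a x / form (fst a) (fst a)) (refl (fst a) (fst a))"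
    using arefl_diff[OF a x arootsD(2)[OF a]] by (simp add: arefl_def[of K a x])
  also have "\<dots> = x" using refl_self[OF arootsD(1)[OF a]] by (auto simp: arefl_def fun_eq_iff)
  finally show ?thesis .
qed

text \<open>Conjugating a reflection by another gives the reflection in the transformed affine root.
  In this form it lets a reflection be moved to the right through a word.\<close>

lemma arefl_conj:
  assumes a: "a \<in> aroots" and b: "b \<in> aroots" and x: "x \<in> Hdual L"
  shows "arefl K b (arefl K a x) = arefl K a (arefl K (act a b) x)"
proof -
  let ?\<gamma> = "refl (fst a) (fst b)"
  note r = arootsD[OF a] arootsD[OF b]
  define c where "c = 2 * aeval K (act a b) x / form (fst b) (fst b)"
  have "arefl K (act a b) x = x - fscale c ?\<gamma>"
    using form_refl[OF r(1) r(4) r(4)] by (simp add: arefl_def c_def act_def)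
  then have "arefl K a (arefl K (act a b) x) = arefl K a x - fscale c (refl (fst a) ?\<gamma>)"
    using arefl_diff[OF a x refl_Hdual[OF r(1) r(4)]] by simp
  also have "\<dots> = arefl K a x - fscale c (fst b)" using refl_refl r by simp
  also have "\<dots> = arefl K b (arefl K a x)"
    using aeval_arefl[OF a b x] by (simp add: arefl_def[of K b] c_def)
  finally show ?thesis by simp
qed

lemma aeval_arefl_self:
  assumes a: "a \<in> aroots" and x: "x \<in> Hdual L"
  shows "aeval K a (arefl K a x) = - aeval K a x"
proof -
  have "act a a = (- fst a, - snd a)"
    using refl_self[OF arootsD(1)[OF a]] root_coroot_self[OF arootsD(1)[OF a]] by (simp add: act_def)
  then show ?thesis using aeval_arefl[OF a a x, of K] arootsD(2)[OF a] x
    by (simp add: aeval_def form_minus_right)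
qed

lemma coroot_uminus_highest: "v \<in> Hdual L \<Longrightarrow> v (co (- \<theta>)) = - v (co \<theta>)"
  using coroot_apply[OF highest_root_in_roots, of v] coroot_apply[OF uminus_root[OF highest_root_in_roots], of v]
    rootsD(1)[OF highest_root_in_roots]
  by (simp add: form_minus_left form_minus_right Hdual_uminus)

lemma refl_uminus_root: "\<beta> \<in> roots L \<Longrightarrow> v \<in> Hdual L \<Longrightarrow> refl (- \<beta>) v = refl \<beta> v"
  using coroot_apply[of \<beta> v] coroot_apply[of "- \<beta>" v] uminus_root[of \<beta>] rootsD(1)[of \<beta>]
  by (auto simp: refl_def form_minus_left form_minus_right Hdual_uminus fun_eq_iff)

lemma act_zero_root: "\<beta> \<in> roots L \<Longrightarrow> act (- \<theta>, 1) (\<beta>, m) = (refl \<theta> \<beta>, m + \<lfloor>Re (\<beta> (co \<theta>))\<rfloor>)"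
proof -
  assume b: "\<beta> \<in> roots L"
  obtain z where "\<beta> (co \<theta>) = of_int z" using root_coroot_int highest_root_in_roots b by blast
  then show ?thesis
    using b rootsD(1)[OF b] by (simp add: act_def coroot_uminus_highest refl_uminus_root highest_root_in_roots)
qed

text \<open>A simple reflection permutes the positive affine roots other than its own. For
  \<open>(- \<theta>, 1)\<close> this rests on the pairings with \<theta> being 0, 1 or -1 except
  for \<plusminus>\<theta>.\<close>

lemma apos_act_simple:
  assumes a: "a \<in> simple_aroots" and b: "b \<in> aroots" "apos b" and "b \<noteq> a"
  shows "apos (act a b)"
proof -
  obtain \<gamma> m where bg: "b = (\<gamma>, m)" by (cases b)
  have g: "\<gamma> \<in> roots L" using b bg arootsD by auto
  have m0: "m \<ge> 0" using b bg by (auto simp: apos_def split: if_splits)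
  show ?thesis
  proof (cases "a = (- \<theta>, 1)")
    case True
    have act: "act a b = (refl \<theta> \<gamma>, m + \<lfloor>Re (\<gamma> (co \<theta>))\<rfloor>)" using act_zero_root[OF g] True bg by simp
    have tt: "\<theta> (co \<theta>) = 2" using root_coroot_self highest_root_in_roots by simp
    consider "\<gamma> = \<theta>" | "\<gamma> = - \<theta>" | "\<gamma> (co \<theta>) = 0" | "\<gamma> (co \<theta>) = 1" | "\<gamma> (co \<theta>) = - 1"
      using highest_root_pairing_cases[OF g] by blast
    then show ?thesis
    proof cases
      case 1
      then show ?thesis using act tt m0 by (auto simp: apos_def)
    next
      case 2
      \<comment> \<open>The image is \<open>(\<theta>, m - 2)\<close>, and m = 1 is the excluded
        case that \<open>b\<close> equals \<open>a\<close>.\<close>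
      then have "m \<noteq> 1" using True bg assms(4) by auto
      moreover have "m \<ge> 1" using b(2) bg 2 not_positive_and_negative[OF highest_root_positive]
        by (auto simp: apos_def split: if_splits)
      moreover have "refl \<theta> \<gamma> = \<theta>" using 2 refl_self[OF highest_root_in_roots] by (simp add: refl_uminus)
      ultimately show ?thesis using act tt 2 highest_root_positive by (auto simp: apos_def)
    next
      case 3
      then have "refl \<theta> \<gamma> = \<gamma>" by (auto simp: refl_def fun_eq_iff)
      then show ?thesis using act 3 b bg by (simp add: apos_def)
    next
      case 4
      then show ?thesis using act m0 by (auto simp: apos_def)
    next
      case 5
      \<comment> \<open>The image is \<open>(\<theta> + \<gamma>, m - 1)\<close>. The index drops by
        1, which is compensated because \<gamma> is negative and \<theta> + \<gamma>
        positive.\<close>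
      then have "(- \<gamma>) (co \<theta>) = 1" by simp
      then have p: "- \<gamma> \<in> positive_roots L" "\<theta> - (- \<gamma>) \<in> positive_roots L"
        using highest_root_pairing_1[OF uminus_root[OF g]] by blast+
      then have "\<gamma> \<notin> positive_roots L" using not_positive_and_negative by blast
      then have "m \<ge> 1" using b(2) bg by (auto simp: apos_def)
      moreover have "refl \<theta> \<gamma> = \<theta> - (- \<gamma>)" using 5 by (auto simp: refl_def fun_eq_iff)
      moreover have "\<lfloor>Re (\<gamma> (co \<theta>))\<rfloor> = - 1" using 5 by (simp add: floor_eq_iff)
      ultimately show ?thesis using act p by (auto simp: apos_def)
    qed
  next
    case False
    then obtain i where i: "i \<in> I" "a = (\<alpha> i, 0)" using a unfolding simple_aroots_def by blast
    have act: "act a b = (refl (\<alpha> i) \<gamma>, m)" using i bg by (simp add: act_def)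
    show ?thesis
    proof (cases "m \<ge> 1")
      case True
      then show ?thesis using act by (simp add: apos_def)
    next
      case False
      then have "\<gamma> \<in> positive_roots L" "m = 0" using b(2) m0 bg by (auto simp: apos_def split: if_splits)
      moreover then have "\<gamma> \<noteq> \<alpha> i" using i bg assms(4) by auto
      ultimately show ?thesis using act simple_refl_positive i by (simp add: apos_def)
    qed
  qed
qed

section \<open>Words in the simple affine reflections and the exchange condition\<close>

abbreviation aword :: "complex \<Rightarrow> (('g \<Rightarrow> complex) \<times> int) list \<Rightarrow> ('g \<Rightarrow> complex) \<Rightarrow> 'g \<Rightarrow> complex" where
  "aword K \<equiv> foldr (arefl K)"

lemma aword_Hdual: "set ws \<subseteq> aroots \<Longrightarrow> x \<in> Hdual L \<Longrightarrow> aword K ws x \<in> Hdual L"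
  by (induction ws) (auto intro: arefl_Hdual)

text \<open>Pulling a functional back reverses the order: the first letter acts last on points but
  first on functionals, hence \<open>foldr\<close> on one side and \<open>fold\<close> on the
  other.\<close>

lemma aeval_aword:
  "set ws \<subseteq> aroots \<Longrightarrow> a \<in> aroots \<Longrightarrow> x \<in> Hdual L \<Longrightarrow> aeval K a (aword K ws x) = aeval K (fold act ws a) x"
  by (induction ws arbitrary: a) (auto simp: aeval_arefl aword_Hdual act_aroots)

lemma fold_act_aroots: "set ws \<subseteq> aroots \<Longrightarrow> a \<in> aroots \<Longrightarrow> fold act ws a \<in> aroots"
  by (induction ws arbitrary: a) (auto simp: act_aroots)

text \<open>Follow \<open>a\<close> through the word. A letter that first makes it negative must be
  equal to the current affine root, by \<open>apos_act_simple\<close>. Moving the reflection in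
  \<open>a\<close> up to that letter by \<open>arefl_conj\<close> cancels the letter.\<close>

lemma exchange_condition:
  assumes "set ws \<subseteq> simple_aroots" "a \<in> aroots" "apos a" "\<not> apos (fold act ws a)"
  shows "\<exists>ws'. set ws' \<subseteq> simple_aroots \<and> length ws' < length ws \<and>
    (\<forall>x\<in>Hdual L. arefl K a (aword K ws x) = aword K ws' x)"
  using assms
proof (induction ws arbitrary: a)
  case (Cons t ws)
  have t: "t \<in> simple_aroots" "t \<in> aroots" using Cons simple_aroots_aroots by auto
  have ws: "set ws \<subseteq> aroots" using Cons simple_aroots_aroots by auto
  show ?case
  proof (cases "apos (act t a)")
    case True
    then obtain ws' where ws': "set ws' \<subseteq> simple_aroots" "length ws' < length ws"
      "\<forall>x\<in>Hdual L. arefl K (act t a) (aword K ws x) = aword K ws' x"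
      using Cons.IH[of "act t a"] Cons.prems act_aroots t by auto
    have "arefl K a (aword K (t # ws) x) = aword K (t # ws') x" if "x \<in> Hdual L" for x
      using arefl_conj[OF t(2) Cons.prems(2) aword_Hdual[OF ws that]] ws'(3) that by simp
    then show ?thesis using ws' t by (intro exI[of _ "t # ws'"]) auto
  next
    case False
    then have "a = t" using apos_act_simple t Cons.prems by blast
    then show ?thesis using arefl_arefl[OF t(2)] aword_Hdual[OF ws] Cons.prems by (intro exI[of _ ws]) auto
  qed
qed auto

text \<open>All positive affine roots are required to be positive, not just the simple ones, because
  the sign test is applied to arbitrary images under \<open>fold act\<close>.\<close>

definition open_alcove :: "complex \<Rightarrow> ('g \<Rightarrow> complex) set" where
  "open_alcove K = {x \<in> Hdual L. \<forall>a\<in>aroots. apos a \<longrightarrow> Re (aeval K a x) > 0}"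

lemma apos_simple: "a \<in> simple_aroots \<Longrightarrow> apos a"
  by (auto simp: simple_aroots_def apos_def simple_root_positive)

text \<open>If the word starts with \<open>s\<close>, then \<open>s\<close> is positive at the image
  of \<open>x\<close>, so its pullback through the rest of the word is negative at \<open>x\<close>
  and thus not \<open>apos\<close>. The exchange condition now gives a shorter word with the same
  action.\<close>

lemma open_alcove_free:
  assumes "set ws \<subseteq> simple_aroots" "x \<in> open_alcove K" "aword K ws x \<in> open_alcove K" "y \<in> Hdual L"
  shows "aword K ws y = y"
  using assms
proof (induction "length ws" arbitrary: ws rule: less_induct)
  case less
  show ?case
  proof (cases ws)
    case (Cons s ws')
    have s: "s \<in> simple_aroots" "s \<in> aroots" "apos s" using less Cons simple_aroots_aroots apos_simple by auto
    have ws': "set ws' \<subseteq> simple_aroots" "set ws' \<subseteq> aroots" using less Cons simple_aroots_aroots by auto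
    have x: "x \<in> Hdual L" using less by (simp add: open_alcove_def)
    have "0 < Re (aeval K s (aword K ws x))" using less s by (auto simp: open_alcove_def)
    also have "aeval K s (aword K ws x) = - aeval K s (aword K ws' x)"
      using aeval_arefl_self[OF s(2) aword_Hdual[OF ws'(2) x]] Cons by simp
    also have "\<dots> = - aeval K (fold act ws' s) x" using aeval_aword[OF ws'(2) s(2) x] by simp
    finally have "\<not> apos (fold act ws' s)"
      using less.prems(2) fold_act_aroots[OF ws'(2) s(2)] by (auto simp: open_alcove_def)
    then obtain us where us: "set us \<subseteq> simple_aroots" "length us < length ws'"
      "\<And>x. x \<in> Hdual L \<Longrightarrow> arefl K s (aword K ws' x) = aword K us x"
      using exchange_condition[OF ws'(1) s(2,3)] by blast
    have eq: "aword K ws z = aword K us z" if "z \<in> Hdual L" for z using us(3)[OF that] Cons by simp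
    show ?thesis using less.hyps[of us] us less.prems eq[OF x] eq[OF less.prems(4)] Cons by simp
  qed simp
qed

lemma arefl_0: "\<beta> \<in> roots L \<Longrightarrow> x \<in> Hdual L \<Longrightarrow> arefl K (\<beta>, 0) x = refl \<beta> x"
  using coroot_apply[of \<beta> x] by (simp add: arefl_def aeval_def refl_def)

text \<open>The positive number (\<beta>,\<beta>) is the sum of the n_i (\<beta>,\<alpha>_i), so one
  of these terms is positive.\<close>

lemma positive_root_descent:
  assumes "root_comb L n \<in> positive_roots L"
  obtains i m where "i \<in> I" "m > 0" "root_comb L n (co (\<alpha> i)) = of_int m"
proof -
  let ?\<beta> = "root_comb L n"
  have r: "?\<beta> \<in> roots L" "?\<beta> \<in> Hdual L" using assms positive_rootsD rootsD by blast+
  obtain l where l: "l > 0" "form ?\<beta> ?\<beta> = of_real l" using root_length_pos[OF r(1)] .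
  have "form ?\<beta> ?\<beta> = (\<Sum>i\<in>I. form ?\<beta> (fscale (of_nat (n i)) (\<alpha> i)))"
    by (subst (2) root_comb_def) (intro form_sum_right r Hdual_scale simple_root_Hdual)
  also have "\<dots> = (\<Sum>i\<in>I. of_nat (n i) * form ?\<beta> (\<alpha> i))"
    by (intro sum.cong refl form_scale_right r simple_root_Hdual)
  finally have "l = (\<Sum>i\<in>I. Re (of_nat (n i) * form ?\<beta> (\<alpha> i)))" using l by (metis Re_complex_of_real Re_sum)
  then have "\<exists>i\<in>I. Re (of_nat (n i) * form ?\<beta> (\<alpha> i)) > 0" using l(1) sum_nonpos[of I "\<lambda>i. Re (of_nat (n i) * form ?\<beta> (\<alpha> i))"] by force
  then obtain i where i: "i \<in> I" "Re (of_nat (n i) * form ?\<beta> (\<alpha> i)) > 0" by blast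
  obtain s where s: "s > 0" "form (\<alpha> i) (\<alpha> i) = of_real s" using root_length_pos[OF simple_root_in_roots[OF i(1)]] .
  obtain m where m: "?\<beta> (co (\<alpha> i)) = of_int m" using root_coroot_int simple_root_in_roots[OF i(1)] r by blast
  have "form ?\<beta> (\<alpha> i) = of_int m * of_real s / 2"
    using form_eq_coroot[OF simple_root_in_roots[OF i(1)] r(2)] m s by simp
  also have "\<dots> = of_real (of_int m * s / 2)" by simp
  finally have E: "Re (of_nat (n i) * form ?\<beta> (\<alpha> i)) = real (n i) * s * of_int m / 2"
    by (simp del: of_real_mult of_real_divide)
  have "real (n i) * s * of_int m > 0" using i(2) unfolding E by simp
  moreover have "real (n i) * s \<ge> 0" using s(1) by simp
  ultimately have "m > 0" by (auto simp: zero_less_mult_iff)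
  then show ?thesis using that i m by blast
qed

text \<open>Induction on the height: a simple reflection given by
  \<open>positive_root_descent\<close> leads to a lower positive root \<gamma>, and the reflection
  in \<beta> is the conjugate of that in \<gamma>.\<close>

lemma positive_refl_aword:
  assumes "root_comb L n \<in> positive_roots L"
  shows "\<exists>ws. set ws \<subseteq> simple_aroots \<and> (\<forall>x\<in>Hdual L. refl (root_comb L n) x = aword K ws x)"
  using assms
proof (induction "\<Sum>i\<in>I. n i" arbitrary: n rule: less_induct)
  case less
  let ?\<beta> = "root_comb L n"
  have r: "?\<beta> \<in> roots L" "?\<beta> \<in> Hdual L" using less.prems positive_rootsD rootsD by blast+
  obtain i m where i: "i \<in> I" and m: "m > 0" "?\<beta> (co (\<alpha> i)) = of_int m"
    using positive_root_descent[OF less.prems] .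
  have s: "(\<alpha> i, 0) \<in> simple_aroots" "(\<alpha> i, 0) \<in> aroots" "\<alpha> i \<in> roots L"
    using i simple_aroots_aroots simple_root_in_roots by (auto simp: simple_aroots_def)
  show ?case
  proof (cases "?\<beta> = \<alpha> i")
    case True
    then show ?thesis using s by (intro exI[of _ "[(\<alpha> i, 0)]"]) (auto simp: arefl_0)
  next
    case False
    let ?\<gamma> = "refl (\<alpha> i) ?\<beta>"
    have g: "?\<gamma> \<in> positive_roots L" using simple_refl_positive less.prems i False by blast
    obtain n' where n': "?\<gamma> = root_comb L n'" using g positive_rootsD by blast
    have co: "coef ?\<gamma> j = coef ?\<beta> j - of_int m * (if i = j then 1 else 0)" if "j \<in> I" for j
      unfolding refl_def m(2)
      by (simp only: coef_diff[OF r(2) Hdual_scale[OF simple_root_Hdual[OF i]] that]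
          coef_scale[OF simple_root_Hdual[OF i] that] coef_simple_root[OF i that])
    have nj: "int (n' j) = int (n j) - m * (if i = j then 1 else 0)" if "j \<in> I" for j
    proof -
      have "(of_int (int (n' j)) :: complex) = of_int (int (n j) - m * (if i = j then 1 else 0))"
        using co[OF that] coef_root_comb[OF that, of n'] coef_root_comb[OF that, of n] n' by auto
      then show ?thesis by (simp only: of_int_eq_iff)
    qed
    have "(\<Sum>i\<in>I. n' i) < (\<Sum>i\<in>I. n i)"
    proof (rule sum_strict_mono_ex1)
      show "\<forall>j\<in>I. n' j \<le> n j"
      proof
        fix j assume "j \<in> I"
        then show "n' j \<le> n j" using nj[of j] m(1) by (cases "i = j") auto
      qed
      have "n' i < n i" using nj[OF i] m(1) by simp
      then show "\<exists>j\<in>I. n' j < n j" using i by blast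
    qed simp
    then obtain ws where ws: "set ws \<subseteq> simple_aroots" "\<And>x. x \<in> Hdual L \<Longrightarrow> refl ?\<gamma> x = aword K ws x"
      using less.hyps[of n'] g n' by auto
    have "refl ?\<beta> x = aword K ((\<alpha> i, 0) # ws @ [(\<alpha> i, 0)]) x" if x: "x \<in> Hdual L" for x
    proof -
      let ?y = "arefl K (\<alpha> i, 0) x"
      have y: "?y \<in> Hdual L" using arefl_Hdual s x by simp
      have b: "(?\<beta>, 0) \<in> aroots" using r by (simp add: aroots_def)
      have "refl ?\<beta> x = arefl K (?\<beta>, 0) (arefl K (\<alpha> i, 0) ?y)"
        using arefl_arefl[OF s(2) x] arefl_0 r x by simp
      also have "\<dots> = arefl K (\<alpha> i, 0) (arefl K (act (\<alpha> i, 0) (?\<beta>, 0)) ?y)"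
        by (rule arefl_conj[OF s(2) b y])
      also have "act (\<alpha> i, 0) (?\<beta>, 0) = (?\<gamma>, 0)" by (simp add: act_def)
      also have "arefl K (?\<gamma>, 0) ?y = aword K ws ?y" using arefl_0 positive_rootsD(1)[OF g] y ws by simp
      finally show ?thesis by simp
    qed
    then show ?thesis using ws s by (intro exI[of _ "(\<alpha> i, 0) # ws @ [(\<alpha> i, 0)]"]) auto
  qed
qed

lemma refl_aword:
  assumes "\<beta> \<in> roots L"
  shows "\<exists>ws. set ws \<subseteq> simple_aroots \<and> (\<forall>x\<in>Hdual L. refl \<beta> x = aword K ws x)"
proof (cases "\<beta> \<in> positive_roots L")
  case True
  then show ?thesis using positive_refl_aword positive_rootsD by metis
next
  case False
  then have n: "- \<beta> \<in> positive_roots L" using positive_or_negative assms by blast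
  then obtain k where k: "- \<beta> = root_comb L k" using positive_rootsD by blast
  have "refl (root_comb L k) x = refl \<beta> x" if "x \<in> Hdual L" for x
    unfolding k[symmetric] by (rule refl_uminus_root[OF assms that])
  then show ?thesis using positive_refl_aword[of k K] n k by auto
qed

subsection \<open>The affine Weyl group\<close>

text \<open>Membership in \<open>Bij\<close> includes extensionality, so a word determines the group
  element and not only its restriction to \<open>Hdual L\<close>.\<close>

definition is_aword :: "complex \<Rightarrow> (('g \<Rightarrow> complex) \<Rightarrow> 'g \<Rightarrow> complex) \<Rightarrow> bool" where
  "is_aword K w \<longleftrightarrow> w \<in> Bij (Hdual L) \<and>
    (\<exists>ws. set ws \<subseteq> simple_aroots \<and> (\<forall>x\<in>Hdual L. w x = aword K ws x))"

lemma aword_rev: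
  "set ws \<subseteq> aroots \<Longrightarrow> x \<in> Hdual L \<Longrightarrow> aword K ws (aword K (rev ws) x) = x"
  by (induction ws arbitrary: x) (auto simp: arefl_Hdual arefl_arefl)

lemma is_awordI:
  assumes "w \<in> extensional (Hdual L)" "set ws \<subseteq> simple_aroots" "\<And>x. x \<in> Hdual L \<Longrightarrow> w x = aword K ws x"
  shows "is_aword K w"
proof -
  have ws: "set ws \<subseteq> aroots" "set (rev ws) \<subseteq> aroots" using assms(2) simple_aroots_aroots by auto
  have "bij_betw w (Hdual L) (Hdual L)"
    by (rule bij_betw_byWitness[where f' = "aword K (rev ws)"])
      (use assms(3) aword_Hdual[OF ws(1)] aword_Hdual[OF ws(2)] aword_rev[OF ws(1)] aword_rev[OF ws(2)] in auto)
  then show ?thesis using assms by (auto simp: is_aword_def Bij_def)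
qed

lemma is_aword_one: "is_aword K (one (BijGroup (Hdual L)))"
  by (rule is_awordI[of _ "[]"]) (auto simp: BijGroup_def)

lemma is_aword_mult:
  assumes "is_aword K v" "is_aword K w" shows "is_aword K (mult (BijGroup (Hdual L)) v w)"
proof -
  obtain us ws where u: "set us \<subseteq> simple_aroots" "\<And>x. x \<in> Hdual L \<Longrightarrow> v x = aword K us x"
    and w: "set ws \<subseteq> simple_aroots" "\<And>x. x \<in> Hdual L \<Longrightarrow> w x = aword K ws x"
    using assms by (auto simp: is_aword_def)
  have b: "v \<in> Bij (Hdual L)" "w \<in> Bij (Hdual L)" using assms by (auto simp: is_aword_def)
  have ws: "set ws \<subseteq> aroots" using w(1) simple_aroots_aroots by auto
  show ?thesis
    by (rule is_awordI[of _ "us @ ws"])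
      (use b u w aword_Hdual[OF ws] in \<open>auto simp: BijGroup_def compose_def\<close>)
qed

lemma is_aword_inv:
  assumes "is_aword K w" shows "is_aword K (m_inv (BijGroup (Hdual L)) w)"
proof -
  obtain ws where w: "set ws \<subseteq> simple_aroots" "\<And>x. x \<in> Hdual L \<Longrightarrow> w x = aword K ws x"
    using assms by (auto simp: is_aword_def)
  have b: "w \<in> Bij (Hdual L)" using assms by (auto simp: is_aword_def)
  then have inj: "inj_on w (Hdual L)" by (auto simp: Bij_def bij_betw_def)
  have ws: "set ws \<subseteq> aroots" "set (rev ws) \<subseteq> aroots" using w(1) simple_aroots_aroots by auto
  show ?thesis
  proof (rule is_awordI[of _ "rev ws"])
    fix x assume x: "x \<in> Hdual L"
    have "w (aword K (rev ws) x) = x" using w(2) aword_Hdual[OF ws(2) x] aword_rev[OF ws(1) x] by simp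
    then have "inv_into (Hdual L) w x = aword K (rev ws) x"
      using inj aword_Hdual[OF ws(2) x] inv_into_f_eq by metis
    then show "m_inv (BijGroup (Hdual L)) w x = aword K (rev ws) x" using x b by (simp add: inv_BijGroup)
  qed (use b w in \<open>auto simp: inv_BijGroup\<close>)
qed

lemma is_aword_generate:
  assumes "\<And>w. w \<in> X \<Longrightarrow> is_aword K w" "w \<in> generate (BijGroup (Hdual L)) X"
  shows "is_aword K w"
  using assms(2) by induction (auto intro: assms(1) is_aword_one is_aword_mult is_aword_inv)

lemma is_aword_weyl_group: "w \<in> weyl_group L \<Longrightarrow> is_aword K w"
  unfolding weyl_group_def
proof (rule is_aword_generate)
  fix w assume "w \<in> root_reflection L ` roots L"
  then obtain \<beta> where b: "\<beta> \<in> roots L" "w = root_reflection L \<beta>" by auto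
  obtain ws where "set ws \<subseteq> simple_aroots" "\<forall>x\<in>Hdual L. refl \<beta> x = aword K ws x"
    using refl_aword[OF b(1), of K] by blast
  then show "is_aword K w" using b(2)
    by (intro is_awordI[of w ws K]) (auto simp: root_reflection_apply, simp add: root_reflection_def)
qed

abbreviation level :: "nat \<Rightarrow> complex" where "level k \<equiv> of_nat k + dual_coxeter L"

lemma is_aword_affine_weyl_group: "w \<in> affine_weyl_group L k \<Longrightarrow> is_aword (level k) w"
  unfolding affine_weyl_group_def
proof (rule is_aword_generate)
  fix w assume "w \<in> insert (affine_reflection L k) (weyl_group L)"
  then consider "w = affine_reflection L k" | "w \<in> weyl_group L" by blast
  then show "is_aword (level k) w"
  proof cases
    case 1
    have t: "\<theta> \<in> Hdual L" using highest_root_in_roots rootsD by blast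
    show ?thesis
    \<comment> \<open>The affine generator is the reflection in the hyperplane (x,\<theta>) =
      \<open>level k\<close>, the zero set of the affine root
      \<open>(- \<theta>, 1)\<close>.\<close>
    proof (rule is_awordI[of _ "[(- \<theta>, 1)]"])
      fix x assume x: "x \<in> Hdual L"
      have "root_pairing L x \<theta> = form x \<theta>" by (simp add: root_pairing_def form_highest)
      then have "w x = x - fscale (form x \<theta>) \<theta> + fscale (level k) \<theta>"
        using 1 x by (simp add: affine_reflection_def)
      moreover have "aword (level k) [(- \<theta>, 1)] x = x - fscale (level k - form x \<theta>) (- \<theta>)"
        using x t by (simp add: arefl_def aeval_def form_minus_left form_minus_right Hdual_uminus form_highest
          diff_divide_distrib add_divide_distrib)
      moreover have "x - fscale (level k - form x \<theta>) (- \<theta>) = x - fscale (form x \<theta>) \<theta> + fscale (level k) \<theta>"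
        by (auto simp: fun_eq_iff algebra_simps)
      ultimately show "w x = aword (level k) [(- \<theta>, 1)] x" by (simp only:)
    qed (auto simp: 1 affine_reflection_def simple_aroots_def)
  qed (rule is_aword_weyl_group)
qed

lemma affine_weyl_group_free:
  assumes "w \<in> affine_weyl_group L k" "x \<in> open_alcove (level k)" "w x \<in> open_alcove (level k)"
  shows "w = one (BijGroup (Hdual L))"
proof -
  have x: "x \<in> Hdual L" using assms by (simp add: open_alcove_def)
  obtain ws where b: "w \<in> Bij (Hdual L)" and
    w: "set ws \<subseteq> simple_aroots" "\<And>x. x \<in> Hdual L \<Longrightarrow> w x = aword (level k) ws x"
    using is_aword_affine_weyl_group[OF assms(1)] by (auto simp: is_aword_def)
  have "aword (level k) ws y = y" if "y \<in> Hdual L" for y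
    using open_alcove_free[OF w(1) assms(2) _ that] assms(3) w(2)[OF x] by simp
  then have "w y = y" if "y \<in> Hdual L" for y using w(2) that by simp
  moreover have "w \<in> extensional (Hdual L)" using b by (simp add: Bij_imp_extensional)
  ultimately show ?thesis by (intro extensionalityI[of _ "Hdual L"]) (auto simp: BijGroup_def)
qed

subsection \<open>Fundamental weights\<close>

text \<open>Evaluation at the simple coroots, the map \<open>T\<close>, is injective by
  \<open>Hdual_eq_0_if_coroots\<close>. It sends the simple roots to independent vectors, as many as
  the dimension of the space of functions supported on \<open>I\<close>, so \<open>T\<close> is onto
  that space.\<close>

lemma dual_basis_exists:
  assumes i: "i \<in> I"
  shows "\<exists>\<omega>\<in>Hdual L. \<forall>j\<in>I. \<omega> (co (\<alpha> j)) = (if i = j then 1 else 0)"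
proof -
  define T :: "('g \<Rightarrow> complex) \<Rightarrow> nat \<Rightarrow> complex" where
    "T v = (\<lambda>j. if j \<in> I then v (co (\<alpha> j)) else 0)" for v
  define e :: "nat \<Rightarrow> nat \<Rightarrow> complex" where "e j = (\<lambda>k. if k = j then 1 else 0)" for j
  interpret F: vector_space "fscale :: complex \<Rightarrow> ('g \<Rightarrow> complex) \<Rightarrow> _" by (rule vector_space_fscale)
  interpret G: vector_space "fscale :: complex \<Rightarrow> (nat \<Rightarrow> complex) \<Rightarrow> _" by (rule vector_space_fscale)
  interpret T: Vector_Spaces.linear fscale fscale T
    by unfold_locales (auto simp: T_def fun_eq_iff algebra_simps)
  let ?S = "T ` \<alpha> ` I"
  have inj: "inj_on T (F.span (\<alpha> ` I))"
    unfolding simple_roots_span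
  proof (rule inj_onI)
    fix v w assume vw: "v \<in> Hdual L" "w \<in> Hdual L" "T v = T w"
    have "v - w = 0"
    proof (rule Hdual_eq_0_if_coroots)
      fix j assume "j \<in> I"
      then show "(v - w) (co (\<alpha> j)) = 0" using fun_cong[OF vw(3), of j] by (simp add: T_def)
    qed (use vw Hdual_diff in auto)
    then show "v = w" by simp
  qed
  have ind: "G.independent ?S" using simple_roots_independent inj by (rule T.independent_injective_image)
  have card: "card ?S = card I"
    using inj simple_root_inj F.span_superset[of "\<alpha> ` I"] by (simp add: card_image inj_on_subset)
  have sp: "f \<in> G.span (e ` I)" if "\<And>j. j \<notin> I \<Longrightarrow> f j = 0" for f :: "nat \<Rightarrow> complex"
  proof -
    have "f = (\<Sum>j\<in>I. fscale (f j) (e j))"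
    proof
      fix k
      have "(\<Sum>j\<in>I. fscale (f j) (e j)) k = (\<Sum>j\<in>I. if k = j then f j else 0)"
        unfolding sum_fun_apply by (rule sum.cong) (auto simp: e_def)
      also have "\<dots> = (if k \<in> I then f k else 0)" by (simp add: sum.delta)
      finally show "f k = (\<Sum>j\<in>I. fscale (f j) (e j)) k" using that[of k] by auto
    qed
    also have "\<dots> \<in> G.span (e ` I)" by (intro G.span_sum G.span_scale G.span_base) auto
    finally show ?thesis .
  qed
  have "e i \<in> G.span ?S"
  proof (rule ccontr)
    assume n: "e i \<notin> G.span ?S"
    have "G.independent (insert (e i) ?S)" using n ind G.independent_insert by auto
    moreover have "insert (e i) ?S \<subseteq> G.span (e ` I)"
    proof -
      have "e i \<in> G.span (e ` I)" using i by (intro G.span_base) auto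
      moreover have "T v \<in> G.span (e ` I)" for v by (rule sp) (auto simp: T_def)
      ultimately show ?thesis by auto
    qed
    ultimately have "card (insert (e i) ?S) \<le> card (e ` I)"
      using G.independent_span_bound[of "e ` I" "insert (e i) ?S"] by auto
    also have "\<dots> \<le> card I" by (rule card_image_le) simp
    finally show False using card n G.span_base[of "e i" ?S] by (auto simp: card_insert_if split: if_splits)
  qed
  then have "e i \<in> T ` Hdual L" using T.span_image[of "\<alpha> ` I"] simple_roots_span by simp
  then obtain \<omega> where \<omega>: "\<omega> \<in> Hdual L" "e i = T \<omega>" by auto
  have "\<omega> (co (\<alpha> j)) = (if i = j then 1 else 0)" if "j \<in> I" for j
    using fun_cong[OF \<omega>(2), of j] that by (auto simp: T_def e_def split: if_splits)
  then show ?thesis using \<omega> by blast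
qed

lemma fund_weight:
  assumes i: "i \<in> I"
  shows fund_weight_Hdual: "fund_weight L i \<in> Hdual L"
    and fund_weight_coroot: "j \<in> I \<Longrightarrow> fund_weight L i (co (\<alpha> j)) = (if i = j then 1 else 0)"
proof -
  let ?P = "\<lambda>\<omega>. \<omega> \<in> Hdual L \<and> (\<forall>j\<in>I. root_pairing L \<omega> (\<alpha> j) = (if i = j then 1 else 0))"
  have P: "?P \<omega> \<longleftrightarrow> \<omega> \<in> Hdual L \<and> (\<forall>j\<in>I. \<omega> (co (\<alpha> j)) = (if i = j then 1 else 0))" for \<omega>
    using root_pairing_coroot[OF simple_root_in_roots] by auto
  have "\<exists>!\<omega>. ?P \<omega>"
  proof (rule ex_ex1I)
    show "\<exists>\<omega>. ?P \<omega>" using dual_basis_exists[OF i] P by blast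
    fix v w assume "?P v" "?P w"
    then have vw: "v \<in> Hdual L" "w \<in> Hdual L" "\<And>j. j \<in> I \<Longrightarrow> v (co (\<alpha> j)) = w (co (\<alpha> j))" unfolding P by auto
    have "v - w = 0" by (rule Hdual_eq_0_if_coroots) (use vw Hdual_diff in auto)
    then show "v = w" by simp
  qed
  from theI'[OF this] have "?P (fund_weight L i)" unfolding fund_weight_def .
  then show "fund_weight L i \<in> Hdual L"
    and "j \<in> I \<Longrightarrow> fund_weight L i (co (\<alpha> j)) = (if i = j then 1 else 0)" unfolding P by auto
qed

lemma fund_weight_comb:
  shows "(\<Sum>i\<in>I. fscale (c i) (fund_weight L i)) \<in> Hdual L"
    and "j \<in> I \<Longrightarrow> (\<Sum>i\<in>I. fscale (c i) (fund_weight L i)) (co (\<alpha> j)) = c j"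
proof -
  show "(\<Sum>i\<in>I. fscale (c i) (fund_weight L i)) \<in> Hdual L"
    by (intro Hdual_sum Hdual_scale fund_weight_Hdual)
  assume j: "j \<in> I"
  have "(\<Sum>i\<in>I. fscale (c i) (fund_weight L i)) (co (\<alpha> j)) = (\<Sum>i\<in>I. if j = i then c i else 0)"
    unfolding sum_fun_apply by (rule sum.cong) (use fund_weight_coroot[OF _ j] in auto)
  then show "(\<Sum>i\<in>I. fscale (c i) (fund_weight L i)) (co (\<alpha> j)) = c j" using j by (simp add: sum.delta)
qed

lemma weyl_vector_eq: "weyl_vector L = (\<Sum>i\<in>I. fscale 1 (fund_weight L i))"
  unfolding weyl_vector_def by (intro sum.cong) (auto simp: fun_eq_iff)

lemma weyl_vector_Hdual: "weyl_vector L \<in> Hdual L"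
  and weyl_vector_coroot: "j \<in> I \<Longrightarrow> weyl_vector L (co (\<alpha> j)) = 1"
  unfolding weyl_vector_eq using fund_weight_comb by auto

section \<open>Dominant weights and the fundamental alcove\<close>

lemma dominant_Hdual:
  assumes "v \<in> dominant_weights L" shows "v \<in> Hdual L"
proof -
  obtain n :: "nat \<Rightarrow> nat" where "v = (\<Sum>i\<in>I. fscale (of_nat (n i)) (fund_weight L i))"
    using assms unfolding dominant_weights_def by blast
  then show ?thesis using fund_weight_comb(1)[of "\<lambda>i. of_nat (n i)"] by simp
qed

lemma dominant_coroot:
  assumes "v \<in> dominant_weights L" "j \<in> I" shows "\<exists>n. v (co (\<alpha> j)) = of_nat n"
proof -
  obtain n :: "nat \<Rightarrow> nat" where "v = (\<Sum>i\<in>I. fscale (of_nat (n i)) (fund_weight L i))"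
    using assms unfolding dominant_weights_def by blast
  then show ?thesis using fund_weight_comb(2)[OF assms(2), of "\<lambda>i. of_nat (n i)"] by auto
qed

text \<open>(x,\<alpha>_i) is \<open>r i\<close> times half the positive length of \<alpha>_i. The
  weak bound serves for \<theta> - \<beta>, which may be 0, the strict one for positive
  roots.\<close>

lemma form_root_comb_real:
  assumes x: "x \<in> Hdual L" and r: "\<And>i. i \<in> I \<Longrightarrow> r i > 0 \<and> x (co (\<alpha> i)) = of_real (r i)"
  obtains q :: real where "form x (root_comb L n) = of_real q" "q \<ge> 0" "(\<exists>i\<in>I. n i > 0) \<Longrightarrow> q > 0"
proof -
  have "\<exists>s>0. form (\<alpha> i) (\<alpha> i) = complex_of_real s" if "i \<in> I" for i
    using root_length_pos[OF simple_root_in_roots[OF that]] by metis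
  then obtain s where s: "\<And>i. i \<in> I \<Longrightarrow> s i > 0 \<and> form (\<alpha> i) (\<alpha> i) = complex_of_real (s i)" by metis
  define q where "q = (\<Sum>i\<in>I. real (n i) * (r i * s i / 2))"
  have "form x (root_comb L n) = (\<Sum>i\<in>I. form x (fscale (of_nat (n i)) (\<alpha> i)))"
    unfolding root_comb_def by (intro form_sum_right x Hdual_scale simple_root_Hdual)
  also have "\<dots> = (\<Sum>i\<in>I. of_real (real (n i) * (r i * s i / 2)))"
  proof (rule sum.cong[OF refl])
    fix i assume i: "i \<in> I"
    show "form x (fscale (of_nat (n i)) (\<alpha> i)) = of_real (real (n i) * (r i * s i / 2))"
      using form_scale_right[OF x simple_root_Hdual[OF i], of "of_nat (n i)"]
        form_eq_coroot[OF simple_root_in_roots[OF i] x] r[OF i] s[OF i] by simp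
  qed
  finally have 1: "form x (root_comb L n) = of_real q" by (simp add: q_def)
  have t: "real (n i) * (r i * s i / 2) \<ge> 0" if "i \<in> I" for i using r[OF that] s[OF that] by simp
  then have 2: "q \<ge> 0" unfolding q_def by (intro sum_nonneg) auto
  have 3: "q > 0" if pos: "\<exists>i\<in>I. n i > 0"
  proof -
    obtain i where i: "i \<in> I" "n i > 0" using pos by blast
    show ?thesis unfolding q_def
      by (rule sum_pos2[OF _ i(1)]) (use t i r[OF i(1)] s[OF i(1)] in auto)
  qed
  show ?thesis using that 1 2 3 by blast
qed

text \<open>The infinitely many inequalities reduce to the walls, since 0 < (x,\<beta>) and
  (x,\<beta>) is at most (x,\<theta>) < \<kappa> for every positive root \<beta>.\<close>

lemma open_alcoveI:
  assumes x: "x \<in> Hdual L" and r: "\<And>i. i \<in> I \<Longrightarrow> \<exists>r>0. x (co (\<alpha> i)) = complex_of_real r"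
    and \<theta>: "Re (form x \<theta>) < \<kappa>"
  shows "x \<in> open_alcove (of_real \<kappa>)"
proof -
  obtain r where r: "\<And>i. i \<in> I \<Longrightarrow> r i > 0 \<and> x (co (\<alpha> i)) = complex_of_real (r i)" using r by metis
  have tH: "\<theta> \<in> Hdual L" using highest_root_in_roots rootsD by blast
  have pos: "Re (form x \<beta>) > 0 \<and> Re (form x \<beta>) \<le> Re (form x \<theta>)" if b: "\<beta> \<in> positive_roots L" for \<beta>
  proof -
    obtain n where n: "\<beta> = root_comb L n" using positive_rootsD b by blast
    obtain i where "i \<in> I" "n i > 0" using positive_root_nonzero_coef[OF b n] .
    then have "Re (form x \<beta>) > 0" using form_root_comb_real[OF x r, of n] n by (metis Re_complex_of_real)
    moreover obtain m where m: "\<theta> - \<beta> = root_comb L m" using highest_root_diff positive_rootsD(1)[OF b] by blast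
    obtain q where "form x (\<theta> - \<beta>) = of_real q" "q \<ge> 0" using form_root_comb_real[OF x r, of m] m by metis
    then have "Re (form x \<theta>) - Re (form x \<beta>) \<ge> 0"
      using form_diff_right[OF tH _ x, of \<beta>] positive_rootsD(1)[OF b] rootsD(1)
      by (metis Re_complex_of_real minus_complex.sel(1))
    ultimately show ?thesis by simp
  qed
  have k: "\<kappa> > 0" using pos[OF highest_root_positive] \<theta> by simp
  have "Re (aeval (of_real \<kappa>) a x) > 0" if a: "a \<in> aroots" "apos a" for a
  proof (cases "fst a \<in> positive_roots L")
    case True
    then have "snd a \<ge> 0" using a by (simp add: apos_def)
    then have "of_int (snd a) * \<kappa> \<ge> 0" using k by simp
    then show ?thesis using pos[OF True] by (simp add: aeval_def)
  next
    case False
    then have n: "- fst a \<in> positive_roots L" using positive_or_negative arootsD[OF a(1)] by blast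
    \<comment> \<open>For a negative root, \<open>apos\<close> gives an index of at least 1, and one
      \<kappa> already outweighs the negative pairing.\<close>
    have "\<kappa> \<le> of_int (snd a) * \<kappa>"
      using mult_right_mono[of 1 "of_int (snd a)" \<kappa>] False a k by (simp add: apos_def)
    moreover have "Re (form x (fst a)) = - Re (form x (- fst a))"
      using form_minus_right[OF x arootsD(2)[OF a(1)]] by simp
    moreover have "Re (aeval (of_real \<kappa>) a x) = Re (form x (fst a)) + of_int (snd a) * \<kappa>"
      by (simp add: aeval_def)
    ultimately show ?thesis using pos[OF n] \<theta> by linarith
  qed
  then show ?thesis using x by (simp add: open_alcove_def)
qed

lemma root_pairing_highest: "root_pairing L x \<theta> = form x \<theta>"
  by (simp add: root_pairing_def form_highest)

lemma dual_coxeter_real: "dual_coxeter L = of_real (Re (dual_coxeter L))"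
proof -
  obtain n where n: "\<theta> = root_comb L n" using highest_root_positive positive_rootsD by blast
  obtain q where "form (weyl_vector L) \<theta> = of_real q"
    unfolding n by (rule form_root_comb_real[OF weyl_vector_Hdual, of "\<lambda>_. 1" n]) (simp_all add: weyl_vector_coroot)
  then show ?thesis by (simp add: dual_coxeter_def root_pairing_highest)
qed

lemma level_real: "level k = of_real (real k + Re (dual_coxeter L))"
  using dual_coxeter_real by simp

lemma shifted_dominant_alcove:
  assumes v: "v \<in> dominant_weights L"
    and "Re (root_pairing L (v + weyl_vector L) \<theta>) < real k + Re (dual_coxeter L)"
  shows "v + weyl_vector L \<in> open_alcove (level k)"
  unfolding level_real
proof (rule open_alcoveI)
  show "v + weyl_vector L \<in> Hdual L" using dominant_Hdual[OF v] weyl_vector_Hdual Hdual_add by blast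
  fix i assume i: "i \<in> I"
  obtain n where "v (co (\<alpha> i)) = of_nat n" using dominant_coroot[OF v i] by blast
  then have "(v + weyl_vector L) (co (\<alpha> i)) = complex_of_real (real n + 1)" using weyl_vector_coroot[OF i] by simp
  moreover have "real n + 1 > 0" by simp
  ultimately show "\<exists>r>0. (v + weyl_vector L) (co (\<alpha> i)) = complex_of_real r" by blast
qed (use assms(2) in \<open>simp add: root_pairing_highest\<close>)

text \<open>(\<rho>,\<theta>) is the dual Coxeter number minus 1; this 1 turns the weak inequality
  defining \<open>level_weights\<close> into a strict one.\<close>

lemma level_weight_alcove:
  assumes "\<nu> \<in> level_weights L k"
  shows "\<nu> + weyl_vector L \<in> open_alcove (level k)"
proof (rule shifted_dominant_alcove)
  show d: "\<nu> \<in> dominant_weights L" using assms by (simp add: level_weights_def)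
  have "form (\<nu> + weyl_vector L) \<theta> = form \<nu> \<theta> + form (weyl_vector L) \<theta>"
    using dominant_Hdual[OF d] weyl_vector_Hdual rootsD(1)[OF highest_root_in_roots] by (simp add: form_add_left)
  then show "Re (root_pairing L (\<nu> + weyl_vector L) \<theta>) < real k + Re (dual_coxeter L)"
    using assms by (simp add: level_weights_def dual_coxeter_def root_pairing_highest)
qed

lemma weyl_one: "one (BijGroup (Hdual L)) \<in> weyl_group L"
  unfolding weyl_group_def by (rule generate.one)

text \<open>For w = 1 the condition of \<open>F'\<close> is the bound at the affine wall; the shift
  by \<rho> keeps a dominant weight off the other walls.\<close>

lemma F'_alcove:
  assumes v: "v \<in> dominant_weights L" and "v + weyl_vector L \<in> F' L k"
  shows "v + weyl_vector L \<in> open_alcove (level k)"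
proof (rule shifted_dominant_alcove[OF v])
  have "one (BijGroup (Hdual L)) \<theta> = \<theta>" using rootsD(1)[OF highest_root_in_roots] by (simp add: BijGroup_def)
  then show "Re (root_pairing L (v + weyl_vector L) \<theta>) < real k + Re (dual_coxeter L)"
    using assms(2) weyl_one by (force simp: F'_def)
qed

end

section \<open>Highest weight modules\<close>

lemma (in vector_space) linear_functional_exists:
  assumes "x \<notin> span S"
  obtains f where "\<And>u v. f (u + v) = f u + f v" "\<And>c u. f (scale c u) = c * f u" "f x = 1"
    "\<And>s. s \<in> S \<Longrightarrow> f s = 0"
proof -
  interpret K: vector_space "(*) :: 'a \<Rightarrow> 'a \<Rightarrow> 'a" by unfold_locales (auto simp: algebra_simps)
  interpret P: vector_space_pair scale "(*) :: 'a \<Rightarrow> 'a \<Rightarrow> 'a" ..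
  obtain B where B: "B \<subseteq> S" "independent B" "S \<subseteq> span B" using maximal_independent_subset[of S] by blast
  have nB: "x \<notin> span B" using assms B(1) span_mono by blast
  then have "independent (insert x B)" using B(2) independent_insert by auto
  then obtain f where f: "Vector_Spaces.linear scale (*) f" "\<forall>b\<in>insert x B. f b = (if b = x then 1 else 0)"
    using P.linear_independent_extend[of "insert x B" "\<lambda>b. if b = x then 1 else 0"] by blast
  interpret f: Vector_Spaces.linear scale "(*)" f by (rule f(1))
  have "x \<notin> B" using nB span_base by blast
  then have "f b = 0" if "b \<in> B" for b using f(2) that by auto
  then have "f s = 0" if "s \<in> S" for s using f.eq_0_on_span[of B s] that B(3) by auto
  then show ?thesis using that[of f] f(2) f.add f.scale by auto
qed

lemma submodule_on_simps [simp]: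
  "mcarrier (submodule_on M S) = S" "mscale (submodule_on M S) = mscale M" "mact (submodule_on M S) = mact M"
  by (simp_all add: submodule_on_def)

lemma is_lie_module_submodule:
  assumes "is_lie_module L M" "S \<subseteq> mcarrier M" "module.subspace (mscale M) S"
    "\<And>x v. v \<in> S \<Longrightarrow> mact M x v \<in> S"
  shows "is_lie_module L (submodule_on M S)"
  using assms unfolding is_lie_module_def submodule_on_simps by (intro conjI) (blast dest: subsetD)+

locale root_data_module = simple_lie_root_data L
  for L :: "'g::ab_group_add lie_data" +
  fixes M :: "('g, 'v::ab_group_add) lie_module"
  assumes lie_module: "is_lie_module L M"
begin

abbreviation V :: "'v set" where "V \<equiv> mcarrier M"
abbreviation ms :: "complex \<Rightarrow> 'v \<Rightarrow> 'v" where "ms \<equiv> mscale M"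
abbreviation ma :: "'g \<Rightarrow> 'v \<Rightarrow> 'v" where "ma \<equiv> mact M"

lemma vector_space_ms: "vector_space ms"
  using lie_module unfolding is_lie_module_def by (rule conjunct1)

sublocale M: vector_space ms by (rule vector_space_ms)

lemma subspace_V: "M.subspace V"
  and ma_closed: "v \<in> V \<Longrightarrow> ma x v \<in> V"
  and ma_add_right: "v \<in> V \<Longrightarrow> u \<in> V \<Longrightarrow> ma x (v + u) = ma x v + ma x u"
  and ma_scale_right: "v \<in> V \<Longrightarrow> ma x (ms c v) = ms c (ma x v)"
  and ma_add_left: "v \<in> V \<Longrightarrow> ma (x + y) v = ma x v + ma y v"
  and ma_scale_left: "v \<in> V \<Longrightarrow> ma (sc c x) v = ms c (ma x v)"
  and ma_bracket: "v \<in> V \<Longrightarrow> ma (br x y) v = ma x (ma y v) - ma y (ma x v)"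
  using lie_module unfolding is_lie_module_def by simp_all

lemma ma_zero_right: "ma x 0 = 0"
  using ma_scale_right[OF M.subspace_0[OF subspace_V], of x 0] by simp

lemma ma_zero_left: "v \<in> V \<Longrightarrow> ma 0 v = 0"
  using ma_scale_left[of v 0 0] by simp

lemma subspace_vimage_ma: "M.subspace X \<Longrightarrow> M.subspace {v \<in> V. ma x v \<in> X}"
  using subspace_V by (auto simp: M.subspace_def ma_zero_right ma_add_right ma_scale_right)

lemma weight_spaceD: "v \<in> weight_space L M \<beta> \<Longrightarrow> v \<in> V" "v \<in> weight_space L M \<beta> \<Longrightarrow> h \<in> H \<Longrightarrow> ma h v = ms (\<beta> h) v"
  by (auto simp: weight_space_def)

lemma ma_weight_space:
  assumes "v \<in> weight_space L M \<beta>" "x \<in> root_space L \<gamma>"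
  shows "ma x v \<in> weight_space L M (\<gamma> + \<beta>)"
  unfolding weight_space_def
proof (safe)
  show "ma x v \<in> V" using ma_closed weight_spaceD assms by blast
  fix h assume h: "h \<in> H"
  note v = weight_spaceD(1)[OF assms(1)]
  have "ma h (ma x v) = ma (br h x) v + ma x (ma h v)" using ma_bracket[OF v, of h x] by simp
  then show "ma h (ma x v) = ms ((\<gamma> + \<beta>) h) (ma x v)"
    using weight_spaceD(2)[OF assms(1) h] root_spaceD[OF assms(2) h] v
    by (simp add: ma_scale_left ma_scale_right M.scale_left_distrib)
qed

text \<open>By the root decomposition it suffices to test \<open>H\<close>, raising and lowering
  operators.\<close>

lemma ma_in_span_induct:
  assumes "v \<in> V" and P: "M.subspace P"
    and "\<And>h. h \<in> H \<Longrightarrow> ma h v \<in> P"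
    and "\<And>\<beta> x. \<beta> \<in> positive_roots L \<Longrightarrow> x \<in> root_space L \<beta> \<Longrightarrow> ma x v \<in> P"
    and "\<And>\<beta> x. \<beta> \<in> positive_roots L \<Longrightarrow> x \<in> root_space L (- \<beta>) \<Longrightarrow> ma x v \<in> P"
  shows "ma z v \<in> P"
proof -
  have gen: "ma x v \<in> P" if x: "x \<in> H \<union> (\<Union>\<alpha>\<in>roots L. root_space L \<alpha>)" for x
  proof (cases "x \<in> H")
    case False
    then obtain \<beta> where b: "\<beta> \<in> roots L" "x \<in> root_space L \<beta>" using x by auto
    show ?thesis
    proof (cases "\<beta> \<in> positive_roots L")
      case False
      then have "- \<beta> \<in> positive_roots L" using positive_or_negative b by blast
      then show ?thesis using assms(5)[of "- \<beta>" x] b by simp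
    qed (use assms(4) b in blast)
  qed (use assms(3) in blast)
  have "z \<in> span (H \<union> (\<Union>\<alpha>\<in>roots L. root_space L \<alpha>))" using root_decomposition by auto
  then show ?thesis
  proof (induction rule: span_induct_alt)
    case base
    show ?case using ma_zero_left[OF assms(1)] M.subspace_0[OF P] by simp
  next
    case (step c x y)
    then show ?case using gen[of x] assms(1) P
      by (simp add: ma_add_left ma_scale_left M.subspace_add M.subspace_scale)
  qed
qed

end

locale highest_weight_module = root_data_module L M
  for L :: "'g::ab_group_add lie_data" and M :: "('g, 'v::ab_group_add) lie_module" +
  fixes \<mu> :: "'g \<Rightarrow> complex"
  assumes irrep: "is_highest_weight_irrep L \<mu> M"
begin

lemma \<mu>_Hdual: "\<mu> \<in> Hdual L"
  using irrep by (simp add: is_highest_weight_irrep_def)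

lemma irreducible:
  assumes "S \<subseteq> V" "M.subspace S" "\<And>x v. v \<in> S \<Longrightarrow> ma x v \<in> S" shows "S = {0} \<or> S = V"
  using irrep is_lie_module_submodule[OF lie_module assms] assms(1)
  unfolding is_highest_weight_irrep_def irreducible_module_def by blast

definition hv :: 'v where
  "hv = (SOME v. v \<in> weight_space L M \<mu> \<and> v \<noteq> 0 \<and> (\<forall>\<alpha>\<in>positive_roots L. \<forall>x\<in>root_space L \<alpha>. ma x v = 0))"

lemma hv_props: "hv \<in> weight_space L M \<mu>" "hv \<noteq> 0" "\<And>\<beta> x. \<beta> \<in> positive_roots L \<Longrightarrow> x \<in> root_space L \<beta> \<Longrightarrow> ma x hv = 0"
proof -
  have "\<exists>v. v \<in> weight_space L M \<mu> \<and> v \<noteq> 0 \<and> (\<forall>\<alpha>\<in>positive_roots L. \<forall>x\<in>root_space L \<alpha>. ma x v = 0)"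
    using irrep by (auto simp: is_highest_weight_irrep_def)
  from someI_ex[OF this]
  show "hv \<in> weight_space L M \<mu>" "hv \<noteq> 0" "\<And>\<beta> x. \<beta> \<in> positive_roots L \<Longrightarrow> x \<in> root_space L \<beta> \<Longrightarrow> ma x hv = 0"
    unfolding hv_def by blast+
qed

text \<open>In \<open>lowered w n\<close>, the weight of \<open>w\<close> is \<open>\<mu> - root_comb L n\<close>.\<close>

inductive lowered :: "'v \<Rightarrow> (nat \<Rightarrow> nat) \<Rightarrow> bool" where
  hv: "lowered hv (\<lambda>_. 0)"
| lower: "lowered w n \<Longrightarrow> \<beta> \<in> positive_roots L \<Longrightarrow> \<beta> = root_comb L m \<Longrightarrow> y \<in> root_space L (- \<beta>) \<Longrightarrow>
    lowered (ma y w) (\<lambda>i. n i + m i)"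

lemma root_comb_add: "root_comb L (\<lambda>i. n i + m i) = root_comb L n + root_comb L m"
  by (rule coef_eqI) (auto simp: coef_root_comb coef_add root_comb_Hdual Hdual_add)

lemma root_comb_zero: "(\<And>i. i \<in> I \<Longrightarrow> n i = 0) \<Longrightarrow> root_comb L n = 0"
  by (rule coef_eqI) (auto simp: coef_root_comb coef_zero root_comb_Hdual Hdual_0)

lemma lowered_weight_space: "lowered w n \<Longrightarrow> w \<in> weight_space L M (\<mu> - root_comb L n)"
proof (induction rule: lowered.induct)
  case hv
  show ?case using hv_props(1) root_comb_zero[of "\<lambda>_. 0"] by simp
next
  case (lower w n \<beta> m y)
  have eq: "- \<beta> + (\<mu> - root_comb L n) = \<mu> - root_comb L (\<lambda>i. n i + m i)"
    unfolding root_comb_add lower(3) by simp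
  show ?case using ma_weight_space[OF lower.IH lower(4)] unfolding eq .
qed

lemma lowered_in_V: "lowered w n \<Longrightarrow> w \<in> V"
  using lowered_weight_space weight_spaceD by blast

lemma lowered_cases: "lowered w n \<Longrightarrow> w = hv \<or> (\<exists>i\<in>I. n i > 0)"
proof (induction rule: lowered.induct)
  case (lower w n \<beta> m y)
  obtain i where "i \<in> I" "m i > 0" using positive_root_nonzero_coef[OF lower(2,3)] .
  then show ?case by auto
qed simp

abbreviation lowspan :: "'v set" where
  "lowspan \<equiv> M.span {w. \<exists>n. lowered w n \<and> (\<exists>i\<in>I. n i > 0)}"

text \<open>Induction for all \<open>z\<close> at once: in \<open>z y w = [z,y] w + y z w\<close>
  the bracket is again an element of the algebra, so both terms are covered by the hypothesis for
  \<open>w\<close>.\<close>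

lemma lowered_ma: "lowered w n \<Longrightarrow> ma z w \<in> M.span {w. \<exists>n. lowered w n}"
proof (induction arbitrary: z rule: lowered.induct)
  case hv
  show ?case
  proof (rule ma_in_span_induct)
    show "ma h hv \<in> M.span {w. \<exists>n. lowered w n}" if "h \<in> H" for h
    proof -
      have "hv \<in> M.span {w. \<exists>n. lowered w n}" using lowered.hv by (blast intro: M.span_base)
      then show ?thesis using weight_spaceD(2)[OF hv_props(1) that] by (simp add: M.span_scale)
    qed
    show "ma x hv \<in> M.span {w. \<exists>n. lowered w n}" if "\<beta> \<in> positive_roots L" "x \<in> root_space L \<beta>" for \<beta> x
      using hv_props(3)[OF that] by (simp add: M.span_zero)
    show "ma x hv \<in> M.span {w. \<exists>n. lowered w n}" if b: "\<beta> \<in> positive_roots L" "x \<in> root_space L (- \<beta>)" for \<beta> x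
    proof -
      obtain m where "\<beta> = root_comb L m" using positive_rootsD(2)[OF b(1)] by blast
      then show ?thesis using lowered.lower[OF lowered.hv b(1) _ b(2)] by (blast intro: M.span_base)
    qed
  qed (use hv_props weight_spaceD in auto)
next
  case (lower w n \<beta> m y)
  let ?X = "M.span {w. \<exists>n. lowered w n}"
  have w: "w \<in> V" using lowered_in_V lower by blast
  have XV: "?X \<subseteq> V" by (rule M.span_minimal) (use lowered_in_V subspace_V in auto)
  have yX: "?X \<subseteq> {u \<in> V. ma y u \<in> ?X}"
  proof (rule M.span_minimal)
    show "{w. \<exists>n. lowered w n} \<subseteq> {u \<in> V. ma y u \<in> ?X}"
      using lowered_in_V lowered.lower[OF _ lower(2,3,4)] by (blast intro: M.span_base)
  qed (intro subspace_vimage_ma M.subspace_span)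
  have "ma z (ma y w) = ma (br z y) w + ma y (ma z w)" using ma_bracket[OF w, of z y] by simp
  moreover have "ma (br z y) w \<in> ?X" by (rule lower.IH)
  moreover have "ma y (ma z w) \<in> ?X" using lower.IH[of z] yX by blast
  ultimately show ?case by (simp add: M.span_add)
qed

lemma span_lowered: "M.span {w. \<exists>n. lowered w n} = V"
proof -
  let ?X = "M.span {w. \<exists>n. lowered w n}"
  have XV: "?X \<subseteq> V" by (rule M.span_minimal) (use lowered_in_V subspace_V in auto)
  have "?X \<subseteq> {u \<in> V. ma x u \<in> ?X}" for x
  proof (rule M.span_minimal)
    show "{w. \<exists>n. lowered w n} \<subseteq> {u \<in> V. ma x u \<in> ?X}" using lowered_in_V lowered_ma by blast
  qed (intro subspace_vimage_ma M.subspace_span)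
  then have "?X = {0} \<or> ?X = V" by (intro irreducible[OF XV]) auto
  moreover have "hv \<in> ?X" using lowered.hv by (blast intro: M.span_base)
  ultimately show ?thesis using hv_props(2) by auto
qed

text \<open>The spanning vectors have weights that differ from \<mu> by a nonzero combination of
  simple roots, and different weights are independent.\<close>

lemma hv_not_in_lowspan: "hv \<notin> lowspan"
proof
  assume a: "hv \<in> lowspan"
  define J where "J = {\<mu> - root_comb L n | n. \<exists>i\<in>I. n i > 0}"
  have J: "\<mu> \<notin> J"
  proof
    assume "\<mu> \<in> J"
    then obtain n i where n: "\<mu> = \<mu> - root_comb L n" "i \<in> I" "n i > 0" by (auto simp: J_def)
    then have "root_comb L n = 0" by simp
    then have "coef 0 i = of_nat (n i)" using coef_root_comb[OF n(2), of n] by simp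
    then show False using coef_zero[OF n(2)] n(3) by simp
  qed
  have JH: "J \<subseteq> Hdual L" using \<mu>_Hdual root_comb_Hdual Hdual_diff by (auto simp: J_def)
  have "{w. \<exists>n. lowered w n \<and> (\<exists>i\<in>I. n i > 0)} \<subseteq> (\<Union>\<beta>\<in>J. weight_space L M \<beta>)"
    using lowered_weight_space unfolding J_def by blast
  then have "hv \<in> M.span (\<Union>\<beta>\<in>J. weight_space L M \<beta>)" using a M.span_mono by blast
  then have "hv = 0"
  proof (intro M.joint_eigenvector_in_span_others[where C = V and I = H and T = ma and k = \<mu> and J = J and e = "\<lambda>\<beta>. \<beta>"])
    show "\<exists>i\<in>H. j i \<noteq> j' i" if "j \<in> insert \<mu> J" "j' \<in> insert \<mu> J" "j \<noteq> j'" for j j'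
      using Hdual_neqE[of j j'] that JH \<mu>_Hdual by blast
  qed (use J hv_props(1) subspace_V in \<open>auto simp: ma_add_right ma_scale_right weight_space_def\<close>)
  then show False using hv_props(2) by simp
qed

text \<open>The lowest weight vector of the dual module: the coordinate functional of the highest weight
  vector.\<close>

lemma dual_highest_vector_exists:
  "\<exists>g\<in>mdual M. g hv = 1 \<and> (\<forall>h\<in>H. \<forall>u\<in>V. g (ma h u) = \<mu> h * g u) \<and>
    (\<forall>\<beta>\<in>positive_roots L. \<forall>y\<in>root_space L (- \<beta>). \<forall>u\<in>V. g (ma y u) = 0)"
proof -
  obtain f where f: "\<And>u v. f (u + v) = f u + f v" "\<And>c u. f (ms c u) = c * f u" "f hv = 1"
    "\<And>s. s \<in> {w. \<exists>n. lowered w n \<and> (\<exists>i\<in>I. n i > 0)} \<Longrightarrow> f s = 0"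
    using M.linear_functional_exists[OF hv_not_in_lowspan] by blast
  have f0: "f 0 = 0" using f(2)[of 0 0] by simp
  define g where "g u = (if u \<in> V then f u else 0)" for u
  have gV: "g u = f u" if "u \<in> V" for u using that by (simp add: g_def)
  have gm: "g \<in> mdual M"
    using subspace_V by (auto simp: dual_space_def g_def f M.subspace_add M.subspace_scale)
  \<comment> \<open>In the dual module, whose action carries a minus sign, this is weight
    -\<mu>.\<close>
  have wt: "f (ma h u) = \<mu> h * f u" if h: "h \<in> H" and u: "u \<in> V" for h u
  proof -
    have "u \<in> M.span {w. \<exists>n. lowered w n}" using u span_lowered by simp
    then have "u \<in> V \<and> f (ma h u) = \<mu> h * f u"
    proof (induction rule: M.span_induct_alt)
      case base
      show ?case using M.subspace_0[OF subspace_V] by (simp add: ma_zero_right f0)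
    next
      case (step c a b)
      then obtain n where n: "lowered a n" by blast
      note aV = lowered_in_V[OF n]
      have "f (ma h a) = \<mu> h * f a"
      proof (cases "a = hv")
        case True
        then show ?thesis using weight_spaceD(2)[OF hv_props(1) h] f by simp
      next
        case False
        then have "f a = 0" using lowered_cases[OF n] f(4) n by blast
        then show ?thesis using weight_spaceD(2)[OF lowered_weight_space[OF n] h] f(2) by simp
      qed
      then show ?case using step aV subspace_V
        by (simp add: ma_add_right ma_scale_right M.subspace_add M.subspace_scale f algebra_simps)
    qed
    then show ?thesis by simp
  qed
  have low: "f (ma y u) = 0" if b: "\<beta> \<in> positive_roots L" and y: "y \<in> root_space L (- \<beta>)" and u: "u \<in> V" for \<beta> y u
  proof -
    obtain m where m: "\<beta> = root_comb L m" using positive_rootsD b by blast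
    obtain i where i: "i \<in> I" "m i > 0" using positive_root_nonzero_coef[OF b m] .
    have "u \<in> M.span {w. \<exists>n. lowered w n}" using u span_lowered by simp
    then have "u \<in> V \<and> f (ma y u) = 0"
    proof (induction rule: M.span_induct_alt)
      case base
      show ?case using M.subspace_0[OF subspace_V] by (simp add: ma_zero_right f0)
    next
      case (step c a b)
      then obtain n where n: "lowered a n" by blast
      \<comment> \<open>Lowering never returns to the weight of \<open>hv\<close>, so
        \<open>f\<close> vanishes on the result.\<close>
      have "\<exists>j\<in>I. n j + m j > 0" using i by (intro bexI[of _ i]) auto
      then have "f (ma y a) = 0" using f(4) lowered.lower[OF n \<open>\<beta> \<in> positive_roots L\<close> m y] by blast
      then show ?case using step lowered_in_V[OF n] subspace_V
        by (simp add: ma_add_right ma_scale_right M.subspace_add M.subspace_scale f)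
    qed
    then show ?thesis by simp
  qed
  have "hv \<in> V" using hv_props(1) weight_spaceD by blast
  then show ?thesis using gm f(3) wt low ma_closed by (intro bexI[of _ g]) (auto simp: gV)
qed

definition dhv :: "'v \<Rightarrow> complex" where
  "dhv = (SOME g. g \<in> mdual M \<and> g hv = 1 \<and> (\<forall>h\<in>H. \<forall>u\<in>V. g (ma h u) = \<mu> h * g u) \<and>
    (\<forall>\<beta>\<in>positive_roots L. \<forall>y\<in>root_space L (- \<beta>). \<forall>u\<in>V. g (ma y u) = 0))"

lemma dhv: "dhv \<in> mdual M" "dhv hv = 1" "\<And>h u. h \<in> H \<Longrightarrow> u \<in> V \<Longrightarrow> dhv (ma h u) = \<mu> h * dhv u"
  "\<And>\<beta> y u. \<beta> \<in> positive_roots L \<Longrightarrow> y \<in> root_space L (- \<beta>) \<Longrightarrow> u \<in> V \<Longrightarrow> dhv (ma y u) = 0"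
proof -
  have "\<exists>g. g \<in> mdual M \<and> g hv = 1 \<and> (\<forall>h\<in>H. \<forall>u\<in>V. g (ma h u) = \<mu> h * g u) \<and>
    (\<forall>\<beta>\<in>positive_roots L. \<forall>y\<in>root_space L (- \<beta>). \<forall>u\<in>V. g (ma y u) = 0)"
    using dual_highest_vector_exists by blast
  from someI_ex[OF this, folded dhv_def]
  show "dhv \<in> mdual M" "dhv hv = 1" "\<And>h u. h \<in> H \<Longrightarrow> u \<in> V \<Longrightarrow> dhv (ma h u) = \<mu> h * dhv u"
    "\<And>\<beta> y u. \<beta> \<in> positive_roots L \<Longrightarrow> y \<in> root_space L (- \<beta>) \<Longrightarrow> u \<in> V \<Longrightarrow> dhv (ma y u) = 0" by blast+
qed

lemma dhv_linear: "u \<in> V \<Longrightarrow> v \<in> V \<Longrightarrow> dhv (u + v) = dhv u + dhv v" "u \<in> V \<Longrightarrow> dhv (ms c u) = c * dhv u"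
  using dhv(1) by (auto simp: dual_space_def)

abbreviation raising :: "'g set" where
  "raising \<equiv> \<Union>\<beta>\<in>positive_roots L. root_space L \<beta>"

abbreviation mword :: "'g list \<Rightarrow> 'v \<Rightarrow> 'v" where "mword \<equiv> foldr ma"

lemma mword_V: "u \<in> V \<Longrightarrow> mword xs u \<in> V"
  by (induction xs) (auto intro: ma_closed)

lemma mword_linear:
  "u \<in> V \<Longrightarrow> v \<in> V \<Longrightarrow> mword xs (u + v) = mword xs u + mword xs v"
  "u \<in> V \<Longrightarrow> mword xs (ms c u) = ms c (mword xs u)"
  by (induction xs) (auto simp: ma_add_right ma_scale_right mword_V)

text \<open>The dual module is generated by its lowest weight vector under raising operators: their common
  kernel is a proper submodule. Moving \<open>z\<close> to the left through the word shows that it is stable.\<close>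

lemma raised_dhv_separate:
  assumes "u \<in> V" "\<And>xs. set xs \<subseteq> raising \<Longrightarrow> dhv (mword xs u) = 0"
  shows "u = 0"
proof -
  define N where "N = {u \<in> V. \<forall>xs. set xs \<subseteq> raising \<longrightarrow> dhv (mword xs u) = 0}"
  have NV: "N \<subseteq> V" by (auto simp: N_def)
  have "dhv 0 = 0" using dhv_linear(2)[OF M.subspace_0[OF subspace_V], of 0] by simp
  moreover have "mword xs 0 = 0" for xs by (induction xs) (auto simp: ma_zero_right)
  ultimately have sN: "M.subspace N"
    using subspace_V by (auto simp: N_def M.subspace_def mword_linear dhv_linear mword_V)
  have Nr: "ma x v \<in> N" if "v \<in> N" "x \<in> raising" for x v
    unfolding N_def
  proof safe
    show "ma x v \<in> V" using that NV ma_closed by blast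
    fix xs assume "set xs \<subseteq> raising"
    then have "set (xs @ [x]) \<subseteq> raising" using that(2) by auto
    then have "dhv (mword (xs @ [x]) v) = 0" using that(1) unfolding N_def by blast
    then show "dhv (mword xs (ma x v)) = 0" by simp
  qed
  have key: "dhv (mword xs (ma z v)) = 0" if "set xs \<subseteq> raising" "v \<in> N" for xs z v
    using that
  proof (induction xs arbitrary: z v rule: rev_induct)
    case Nil
    have "dhv (mword ys v) = 0" if "set ys \<subseteq> raising" for ys
      using Nil.prems(2) that unfolding N_def by blast
    from this[of "[]"] this[of "[_]"] have v: "v \<in> V" "dhv v = 0" "\<And>x. x \<in> raising \<Longrightarrow> dhv (ma x v) = 0"
      using NV Nil.prems(2) by auto
    have "ma z v \<in> {u \<in> V. dhv u = 0}"
    \<comment> \<open>\<open>H\<close> acts under \<open>dhv\<close> by a scalar, lowering operators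
      are killed by \<open>dhv\<close>, and for raising operators the one-letter words in the
      definition of \<open>N\<close> apply.\<close>
    proof (rule ma_in_span_induct[OF v(1)])
      show "M.subspace {u \<in> V. dhv u = 0}" using subspace_V \<open>dhv 0 = 0\<close>
        by (auto simp: M.subspace_def dhv_linear)
    qed (use v dhv ma_closed in auto)
    then show ?case by simp
  next
    case (snoc x xs)
    have v: "v \<in> V" using snoc NV by auto
    have x: "x \<in> raising" "set xs \<subseteq> raising" using snoc by auto
    \<comment> \<open>The innermost letter \<open>x\<close> passes \<open>z\<close>: both [x,z]
      applied to \<open>v\<close> and \<open>z\<close> applied to \<open>x v\<close>, which is again
      in \<open>N\<close>, are covered by the shorter word.\<close>
    have "ma x (ma z v) = ma (br x z) v + ma z (ma x v)" using ma_bracket[OF v, of x z] by simp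
    then have "mword (xs @ [x]) (ma z v) = mword xs (ma (br x z) v) + mword xs (ma z (ma x v))"
      using mword_linear(1) ma_closed v by simp
    then show ?case
      using snoc.IH[OF x(2) snoc.prems(2)] snoc.IH[OF x(2) Nr[OF snoc.prems(2) x(1)]] mword_V ma_closed v
      by (simp add: dhv_linear)
  qed
  have "ma x v \<in> N" if "v \<in> N" for x v
    using key that NV ma_closed by (auto simp: N_def)
  then have "N = {0} \<or> N = V" using irreducible[OF NV sN] by blast
  moreover have "hv \<notin> N" using dhv(2) unfolding N_def by (auto intro!: exI[of _ "[]"])
  ultimately have "N = {0}" using hv_props(1) weight_spaceD by blast
  then show ?thesis using assms by (auto simp: N_def)
qed

end

lemma highest_weight_moduleI:
  assumes "simple_lie_data L" "is_highest_weight_irrep L \<mu> M"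
  shows "highest_weight_module L M \<mu>"
  using assms
  by (auto simp: highest_weight_module_def highest_weight_module_axioms_def root_data_module_def
    root_data_module_axioms_def simple_lie_root_data_def is_highest_weight_irrep_def irreducible_module_def)

subsection \<open>Weights of highest weight vectors in tensor products\<close>

lemma vector_space_tscale: "vector_space tscale"
  by unfold_locales (auto simp: tscale_def fun_eq_iff algebra_simps)

text \<open>An elementary tensor with the first functional fixed is evaluation at a multiple of
  \<open>u\<close>, and evaluations are closed under linear combinations. This turns a bilinear form
  in the tensor product into a vector of \<open>U\<close>.\<close>

lemma tensor_contract_left:
  assumes V: "is_lie_module L V" and U: "is_lie_module L U" and t: "t \<in> mcarrier (tensor_module V U)" and f: "f \<in> mdual V"
  shows "\<exists>u\<in>mcarrier U. \<forall>g\<in>mdual U. t f g = g u"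
proof -
  interpret T: vector_space tscale by (rule vector_space_tscale)
  interpret U: vector_space "mscale U" using U by (simp add: is_lie_module_def)
  have sU: "U.subspace (mcarrier U)" using U by (simp add: is_lie_module_def)
  let ?A = "{t. \<exists>u\<in>mcarrier U. \<forall>g\<in>mdual U. t f g = g u}"
  have "T.span {elem_tensor V U v u | v u. v \<in> mcarrier V \<and> u \<in> mcarrier U} \<subseteq> ?A"
  proof (rule T.span_minimal)
    show "{elem_tensor V U v u | v u. v \<in> mcarrier V \<and> u \<in> mcarrier U} \<subseteq> ?A"
    proof safe
      fix v u assume u: "u \<in> mcarrier U"
      have "elem_tensor V U v u f g = g (mscale U (f v) u)" if "g \<in> mdual U" for g
        using that f u by (auto simp: elem_tensor_def dual_space_def)
      then show "\<exists>w\<in>mcarrier U. \<forall>g\<in>mdual U. elem_tensor V U v u f g = g w"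
        using U.subspace_scale[OF sU u] by blast
    qed
    show "T.subspace ?A"
      unfolding T.subspace_def
    proof (intro conjI allI ballI)
      have "g 0 = 0" if "g \<in> mdual U" for g
      proof -
        have "g (mscale U 0 0) = 0 * g 0" using that U.subspace_0[OF sU] unfolding dual_space_def by blast
        then show ?thesis by simp
      qed
      then show "0 \<in> ?A" using U.subspace_0[OF sU] by (auto intro!: bexI[of _ 0])
    next
      fix s t assume "s \<in> ?A" "t \<in> ?A"
      then obtain u w where "u \<in> mcarrier U" "\<forall>g\<in>mdual U. s f g = g u" "w \<in> mcarrier U" "\<forall>g\<in>mdual U. t f g = g w"
        by blast
      then show "s + t \<in> ?A" using U.subspace_add[OF sU, of u w]
        by (auto simp: dual_space_def intro!: bexI[of _ "u + w"])
    next
      fix c t assume "t \<in> ?A"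
      then obtain u where "u \<in> mcarrier U" "\<forall>g\<in>mdual U. t f g = g u" by blast
      then show "tscale c t \<in> ?A" using U.subspace_scale[OF sU, of u c]
        by (auto simp: dual_space_def tscale_def intro!: bexI[of _ "mscale U c u"])
    qed
  qed
  then show ?thesis using t by (auto simp: tensor_module_def)
qed

lemma tensor_contract_right:
  assumes V: "is_lie_module L V" and U: "is_lie_module L U" and t: "t \<in> mcarrier (tensor_module V U)" and g: "g \<in> mdual U"
  shows "\<exists>v\<in>mcarrier V. \<forall>f\<in>mdual V. t f g = f v"
proof -
  interpret T: vector_space tscale by (rule vector_space_tscale)
  interpret V: vector_space "mscale V" using V by (simp add: is_lie_module_def)
  have sV: "V.subspace (mcarrier V)" using V by (simp add: is_lie_module_def)
  let ?A = "{t. \<exists>v\<in>mcarrier V. \<forall>f\<in>mdual V. t f g = f v}"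
  have "T.span {elem_tensor V U v u | v u. v \<in> mcarrier V \<and> u \<in> mcarrier U} \<subseteq> ?A"
  proof (rule T.span_minimal)
    show "{elem_tensor V U v u | v u. v \<in> mcarrier V \<and> u \<in> mcarrier U} \<subseteq> ?A"
    proof safe
      fix v u assume v: "v \<in> mcarrier V"
      have "elem_tensor V U v u f g = f (mscale V (g u) v)" if "f \<in> mdual V" for f
        using that g v by (auto simp: elem_tensor_def dual_space_def)
      then show "\<exists>w\<in>mcarrier V. \<forall>f\<in>mdual V. elem_tensor V U v u f g = f w"
        using V.subspace_scale[OF sV v] by blast
    qed
    show "T.subspace ?A"
      unfolding T.subspace_def
    proof (intro conjI allI ballI)
      have "f 0 = 0" if "f \<in> mdual V" for f
      proof -
        have "f (mscale V 0 0) = 0 * f 0" using that V.subspace_0[OF sV] unfolding dual_space_def by blast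
        then show ?thesis by simp
      qed
      then show "0 \<in> ?A" using V.subspace_0[OF sV] by (auto intro!: bexI[of _ 0])
    next
      fix s t assume "s \<in> ?A" "t \<in> ?A"
      then obtain u w where "u \<in> mcarrier V" "\<forall>f\<in>mdual V. s f g = f u" "w \<in> mcarrier V" "\<forall>f\<in>mdual V. t f g = f w"
        by blast
      then show "s + t \<in> ?A" using V.subspace_add[OF sV, of u w]
        by (auto simp: dual_space_def intro!: bexI[of _ "u + w"])
    next
      fix c t assume "t \<in> ?A"
      then obtain u where "u \<in> mcarrier V" "\<forall>f\<in>mdual V. t f g = f u" by blast
      then show "tscale c t \<in> ?A" using V.subspace_scale[OF sV, of u c]
        by (auto simp: dual_space_def tscale_def intro!: bexI[of _ "mscale V c u"])
    qed
  qed
  then show ?thesis using t by (auto simp: tensor_module_def)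
qed

lemma tensor_outside:
  assumes t: "t \<in> mcarrier (tensor_module V U)" and n: "f \<notin> mdual V \<or> g \<notin> mdual U"
  shows "t f g = 0"
proof -
  interpret T: vector_space tscale by (rule vector_space_tscale)
  have "T.span {elem_tensor V U v u | v u. v \<in> mcarrier V \<and> u \<in> mcarrier U} \<subseteq> {t. t f g = 0}"
    by (rule T.span_minimal) (use n in \<open>auto simp: T.subspace_def elem_tensor_def tscale_def\<close>)
  then show ?thesis using t by (auto simp: tensor_module_def)
qed

lemma mdual_separates:
  assumes V: "is_lie_module L V" and v: "v \<in> mcarrier V" "w \<in> mcarrier V" and eq: "\<And>f. f \<in> mdual V \<Longrightarrow> f v = f w"
  shows "v = w"
proof (rule ccontr)
  assume "v \<noteq> w"
  interpret V: vector_space "mscale V" using V by (simp add: is_lie_module_def)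
  have sV: "V.subspace (mcarrier V)" using V by (simp add: is_lie_module_def)
  \<comment> \<open>With the empty set, \<open>linear_functional_exists\<close> yields a functional
    that does not vanish on the nonzero vector \<open>v - w\<close>.\<close>
  have n: "v - w \<notin> V.span {}" using \<open>v \<noteq> w\<close> by simp
  obtain f where f: "\<And>u v. f (u + v) = f u + f v" "\<And>c u. f (mscale V c u) = c * f u" "f (v - w) = 1"
    by (rule V.linear_functional_exists[OF n], rule that)
  define g where "g u = (if u \<in> mcarrier V then f u else 0)" for u
  have "g \<in> mdual V" using sV by (auto simp: dual_space_def g_def f V.subspace_add V.subspace_scale)
  then have "f v = f w" using eq[of g] v by (simp add: g_def)
  moreover have "f v = f (v - w) + f w" using f(1)[of "v - w" w] by simp
  ultimately show False using f(3) by simp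
qed

lemma tensor_highest_weight:
  assumes data: "simple_lie_data L" and V: "is_highest_weight_irrep L \<kappa> V" and U: "is_highest_weight_irrep L \<mu> U"
    and t: "t \<in> mcarrier (tensor_module V U)" "t \<noteq> 0" and \<gamma>: "\<gamma> \<in> Hdual L"
    and wt: "\<And>h. h \<in> cartan L \<Longrightarrow> tensor_act V U h t = tscale (\<gamma> h) t"
    and hi: "\<And>\<beta> x. \<beta> \<in> positive_roots L \<Longrightarrow> x \<in> root_space L \<beta> \<Longrightarrow> tensor_act V U x t = 0"
  shows "\<gamma> - \<mu> \<in> module_weights L V"
proof -
  interpret V: highest_weight_module L V \<kappa> using data V by (rule highest_weight_moduleI)
  interpret U: highest_weight_module L U \<mu> using data U by (rule highest_weight_moduleI)
  have act: "tensor_act V U x t f g = t (precomp_act V x f) g + t f (precomp_act U x g)"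
    if "f \<in> mdual V" "g \<in> mdual U" for x f g using that by (simp add: tensor_act_def)
  have "\<exists>f\<in>mdual V. t f U.dhv \<noteq> 0"
  proof (rule ccontr)
    assume "\<not> ?thesis"
    then have n: "t f U.dhv = 0" if "f \<in> mdual V" for f using that by blast
    \<comment> \<open>\<open>G xs\<close> arises from \<open>dhv\<close> by raising operators.
      \<open>precomp_act\<close> composes on the inside, so a letter appended to the word acts last
      on the functional.\<close>
    define G where "G xs = (\<lambda>u. if u \<in> mcarrier U then U.dhv (U.mword xs u) else 0)" for xs
    have Gm: "G xs \<in> mdual U" for xs
      using U.subspace_V unfolding dual_space_def G_def
      by (auto simp: U.mword_linear U.dhv_linear U.mword_V U.M.subspace_add U.M.subspace_scale)
    have G0: "G [] = U.dhv" using U.dhv(1) by (auto simp: G_def dual_space_def fun_eq_iff)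
    have Gs: "G (xs @ [x]) = precomp_act U x (G xs)" for xs x
      by (auto simp: G_def precomp_act_def fun_eq_iff U.ma_closed)
    have tG: "t f (G xs) = 0" if "set xs \<subseteq> U.raising" "f \<in> mdual V" for xs f
      using that
    proof (induction xs arbitrary: f rule: rev_induct)
      case (snoc x xs)
      then obtain \<beta> where b: "\<beta> \<in> positive_roots L" "x \<in> root_space L \<beta>" by auto
      \<comment> \<open>Because \<open>x\<close> annihilates \<open>t\<close>, it can be moved from
        the second argument to the first up to sign; there the hypothesis for \<open>xs\<close>
        holds for every functional.\<close>
      have "t (precomp_act V x f) (G xs) + t f (precomp_act U x (G xs)) = 0"
        using act[OF snoc.prems(2) Gm, of x xs] hi[OF b] by simp
      moreover have "t (precomp_act V x f) (G xs) = 0"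
        using snoc precomp_act_in_mdual[OF V.lie_module] by simp
      ultimately show ?case by (simp add: Gs)
    qed (use n G0 in simp)
    have "t f g = 0" for f g
    proof (cases "f \<in> mdual V \<and> g \<in> mdual U")
      case True
      then obtain u where u: "u \<in> mcarrier U" "\<And>g. g \<in> mdual U \<Longrightarrow> t f g = g u"
        using tensor_contract_left[OF V.lie_module U.lie_module t(1)] by blast
      have "u = 0"
      proof (rule U.raised_dhv_separate[OF u(1)])
        fix xs assume "set xs \<subseteq> U.raising"
        then have "G xs u = 0" using tG[of xs f] True u(2)[OF Gm] by simp
        then show "U.dhv (U.mword xs u) = 0" using u(1) by (simp add: G_def)
      qed
      moreover have "t f 0 = 0" if "(0::_ \<Rightarrow> complex) \<in> mdual U" using u(2)[OF that] by simp
      moreover have "g 0 = 0"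
      proof -
        have "g (mscale U 0 0) = 0 * g 0" using True U.M.subspace_0[OF U.subspace_V] unfolding dual_space_def by blast
        then show ?thesis by simp
      qed
      ultimately show ?thesis using u(2)[of g] True by simp
    qed (use tensor_outside[OF t(1)] in blast)
    then have "t = 0" by (auto simp: fun_eq_iff)
    then show False using t(2) by simp
  qed
  then obtain f1 where f1: "f1 \<in> mdual V" "t f1 U.dhv \<noteq> 0" by blast
  obtain v where v: "v \<in> mcarrier V" "\<And>f. f \<in> mdual V \<Longrightarrow> t f U.dhv = f v"
    using tensor_contract_right[OF V.lie_module U.lie_module t(1) U.dhv(1)] by blast
  have "mact V h v = mscale V ((\<gamma> - \<mu>) h) v" if h: "h \<in> cartan L" for h
  proof (rule mdual_separates[OF V.lie_module])
    show "mact V h v \<in> mcarrier V" "mscale V ((\<gamma> - \<mu>) h) v \<in> mcarrier V"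
      using V.ma_closed v(1) V.M.subspace_scale[OF V.subspace_V] by blast+
    fix f assume f: "f \<in> mdual V"
    \<comment> \<open>The action of \<open>h\<close> on \<open>t\<close> is the sum of its actions
      on the two arguments. It has value \<gamma>, the second argument contributes \<mu>, and the
      first is the action on \<open>v\<close>.\<close>
    have "precomp_act U h U.dhv = fscale (\<mu> h) U.dhv"
      using U.dhv(3)[OF h] U.dhv(1) by (auto simp: precomp_act_def dual_space_def fun_eq_iff)
    moreover obtain u where u: "u \<in> mcarrier U" "\<And>g. g \<in> mdual U \<Longrightarrow> t f g = g u"
      using tensor_contract_left[OF V.lie_module U.lie_module t(1) f] by blast
    moreover have "fscale (\<mu> h) U.dhv \<in> mdual U"
      using precomp_act_in_mdual[OF U.lie_module U.dhv(1), of h] calculation(1) by simp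
    ultimately have "t f (precomp_act U h U.dhv) = \<mu> h * t f U.dhv" using U.dhv(1) by simp
    moreover have "t (precomp_act V h f) U.dhv + t f (precomp_act U h U.dhv) = \<gamma> h * t f U.dhv"
      using act[OF f U.dhv(1), of h] wt[OF h] by (simp add: tscale_def)
    moreover have "t (precomp_act V h f) U.dhv = f (mact V h v)"
      using v(2)[OF precomp_act_in_mdual[OF V.lie_module f]] v(1) by (simp add: precomp_act_def)
    ultimately have "f (mact V h v) = (\<gamma> - \<mu>) h * f v"
      using v(2)[OF f] by (simp add: algebra_simps)
    also have "\<dots> = f (mscale V ((\<gamma> - \<mu>) h) v)"
    proof -
      have "f (mscale V c x) = c * f x" if "x \<in> mcarrier V" for c x using f that by (simp add: dual_space_def)
      from this[OF v(1)] show ?thesis by (rule sym)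
    qed
    finally show "f (mact V h v) = f (mscale V ((\<gamma> - \<mu>) h) v)" .
  qed
  then have "v \<in> weight_space L V (\<gamma> - \<mu>)" using v(1) by (simp add: weight_space_def)
  moreover have "v \<noteq> 0"
  proof
    assume "v = 0"
    have "f1 (mscale V 0 0) = 0 * f1 0" using f1(1) V.M.subspace_0[OF V.subspace_V] unfolding dual_space_def by blast
    then show False using f1 v(2)[OF f1(1)] \<open>v = 0\<close> by simp
  qed
  ultimately show ?thesis using V.Hdual_diff[OF \<gamma> U.\<mu>_Hdual] by (auto simp: module_weights_def)
qed

text \<open>A nonzero count exhibits a summand inside the tensor product; its highest weight vector
  is the tensor required by \<open>tensor_highest_weight\<close>.\<close>

lemma tensor_mult_nonzero:
  assumes data: "simple_lie_data L" and V: "is_highest_weight_irrep L \<kappa> V" and U: "is_highest_weight_irrep L \<mu> U"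
    and nz: "tensor_mult L V U \<gamma> \<noteq> 0"
  shows "\<gamma> \<in> dominant_weights L" "\<gamma> - \<mu> \<in> module_weights L V"
proof -
  let ?T = "tensor_module V U"
  show "\<gamma> \<in> dominant_weights L" using nz by (auto simp: tensor_mult_def split: if_splits)
  then have "irrep_multiplicity L ?T \<gamma> \<noteq> 0" using nz by (simp add: tensor_mult_def)
  then have "{S \<in> (SOME D. irreducible_decomposition L ?T D).
      S \<subseteq> mcarrier ?T \<and> is_highest_weight_irrep L \<gamma> (submodule_on ?T S)} \<noteq> {}"
    unfolding irrep_multiplicity_def by (metis card.empty)
  then obtain S where S: "S \<subseteq> mcarrier ?T" "is_highest_weight_irrep L \<gamma> (submodule_on ?T S)" by blast
  then obtain t where t: "t \<in> weight_space L (submodule_on ?T S) \<gamma>" "t \<noteq> 0"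
    "\<forall>\<alpha>\<in>positive_roots L. \<forall>x\<in>root_space L \<alpha>. mact (submodule_on ?T S) x t = 0"
    and \<gamma>: "\<gamma> \<in> Hdual L"
    unfolding is_highest_weight_irrep_def by blast
  have T: "mact ?T = tensor_act V U" "mscale ?T = tscale" by (simp_all add: tensor_module_def)
  show "\<gamma> - \<mu> \<in> module_weights L V"
    by (rule tensor_highest_weight[OF data V U _ t(2) \<gamma>])
      (use t S(1) in \<open>auto simp: weight_space_def T\<close>)
qed

theorem theorem6p1:
  fixes L :: "'g::ab_group_add lie_data"
    and V :: "('g, 'v::ab_group_add) lie_module"
    and U :: "('g, 'u::ab_group_add) lie_module"
    and lam mu :: "'g \<Rightarrow> complex"
    and k :: nat
  assumes "simple_lie_data L"
    and "lam \<in> dominant_weights L" and "mu \<in> dominant_weights L"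
    and "is_highest_weight_irrep L lam V" and "is_highest_weight_irrep L mu U"
    and "k \<ge> 1"
    and "(\<lambda>\<beta>. \<beta> + mu + weyl_vector L) ` module_weights L V \<subseteq> F' L k"
  shows "\<forall>nu \<in> level_weights L k. fusion_coeff L k V U nu = int (tensor_mult L V U nu)"
proof
  fix nu assume nu: "nu \<in> level_weights L k"
  interpret simple_lie_root_data L by unfold_locales (rule assms(1))
  let ?\<rho> = "weyl_vector L" and ?e = "one (BijGroup (Hdual L))"
  let ?m = "\<lambda>w. tensor_mult L V U (w (nu + ?\<rho>) - ?\<rho>)"
  let ?A = "{w \<in> affine_weyl_group L k. ?m w \<noteq> 0}"
  have "nu \<in> dominant_weights L" using nu by (simp add: level_weights_def)
  then have e: "?e (nu + ?\<rho>) = nu + ?\<rho>"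
    using Hdual_add[OF dominant_Hdual weyl_vector_Hdual] by (simp add: BijGroup_def)
  have A: "w = ?e" if w: "w \<in> ?A" for w
  proof -
    let ?\<gamma> = "w (nu + ?\<rho>) - ?\<rho>"
    have g: "?\<gamma> \<in> dominant_weights L" "?\<gamma> - mu \<in> module_weights L V"
      using tensor_mult_nonzero[OF assms(1,4,5)] w by blast+
    have "?\<gamma> - mu + mu + ?\<rho> \<in> F' L k" using assms(7) g(2) by blast
    then have "?\<gamma> + ?\<rho> \<in> F' L k" by simp
    then have "?\<gamma> + ?\<rho> \<in> open_alcove (level k)" by (rule F'_alcove[OF g(1)])
    then show ?thesis using affine_weyl_group_free[OF _ level_weight_alcove[OF nu]] w by simp
  qed
  have E: "?e \<in> affine_weyl_group L k" unfolding affine_weyl_group_def by (rule generate.one)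
  \<comment> \<open>The identity is the empty word and has sign 1. The sum ranges over nonzero terms
    only, so it is empty if the multiplicity of \<open>nu\<close> is 0 and consists of the term of
    the identity otherwise.\<close>
  have "affine_length L k ?e = 0"
    unfolding affine_length_def by (rule Least_eq_0) (auto intro!: exI[of _ "[]"])
  moreover have "?A = (if tensor_mult L V U nu = 0 then {} else {?e})"
  proof -
    define B where "B = ?A"
    have "?e \<in> B \<longleftrightarrow> tensor_mult L V U nu \<noteq> 0" using E e by (simp add: B_def)
    moreover have "w = ?e" if "w \<in> B" for w using A that by (simp add: B_def)
    ultimately show ?thesis unfolding B_def[symmetric] by auto
  qed
  ultimately show "fusion_coeff L k V U nu = int (tensor_mult L V U nu)"
    unfolding fusion_coeff_def by (simp add: e)
qed

end
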